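(* Let $\mathcal{H}$ be a separable Hilbert space and $N\in\mathcal{B}(\mathcal{H})$ a normal operator. Then the von Neumann algebra $\mathcal{W}^*_N$ generated by $N$ has the closability property if and only if $N$ has uniform finite multiplicity.
   Context: For a compactly supported regular Borel measure $\mu$ on $\mathbb{C}$, $N_\mu$ is multiplication by $z$ on $L^2(\mu)$. Every normal operator $N$ on a separable Hilbert space is unitarily equivalent to $N_{\mu_\infty}^{(\infty)}\oplus N_{\mu_1}\oplus N_{\mu_2}^{(2)}\oplus N_{\mu_3}^{(3)}\oplus\cdots$ for mutually singular such measures $\mu_\infty,\mu_1,\mu_2,\dots$ (some possibly zero), where $A^{(k)}$ denotes the direct sum of $k$ copies of $A$. The multiplicity function of $N$ takes the value $k$ on (the carrier of) $\mu_k$; $N$ has uniform finite multiplicity if its multiplicity function is finite almost everywhere, i.e. $\mu_\infty=0$. $\mathcal{W}^*_N$ is the smallest von Neumann algebra containing $N$. A linear transformation $X$ with domain $\mathcal{D}(X)$ commutes with an algebra $\mathcal{A}\subset\mathcal{B}(\mathcal{H})$ if $\mathcal{D}(X)$ is dense and invariant under $\mathcal{A}$ and $XT=TX$ on $\mathcal{D}(X)$ for all $T\in\mathcal{A}$; $X$ is closable if the closure of its graph is a graph. A unital algebra has the closability property if every densely defined linear transformation commuting with it is closable. *)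

theory Defs
  imports "HOL-Analysis.Analysis"
begin

class complex_vector = real_vector +
  fixes scaleC :: "complex \<Rightarrow> 'a \<Rightarrow> 'a"  (infixr \<open>*\<^sub>C\<close> 75)
  assumes scaleC_add_right: "a *\<^sub>C (x + y) = a *\<^sub>C x + a *\<^sub>C y"
    and scaleC_add_left: "(a + b) *\<^sub>C x = a *\<^sub>C x + b *\<^sub>C x"
    and scaleC_scaleC: "a *\<^sub>C (b *\<^sub>C x) = (a * b) *\<^sub>C x"
    and scaleC_one: "1 *\<^sub>C x = x"
    and scaleR_scaleC: "scaleR r x = complex_of_real r *\<^sub>C x"

class complex_inner = complex_vector + real_normed_vector +
  fixes cinner :: "'a \<Rightarrow> 'a \<Rightarrow> complex"
  assumes cinner_add_left: "cinner (x + y) z = cinner x z + cinner y z"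
    and cinner_scaleC_left: "cinner (a *\<^sub>C x) y = a * cinner x y"
    and cinner_conj: "cinner x y = cnj (cinner y x)"
    and cinner_pos: "Im (cinner x x) = 0 \<and> Re (cinner x x) \<ge> 0"
    and cinner_eq_zero: "cinner x x = 0 \<longleftrightarrow> x = 0"
    and norm_eq_sqrt_cinner: "norm x = sqrt (Re (cinner x x))"

class chilbert_space = complex_inner + complete_space

definition separable_hspace :: "'a::topological_space itself \<Rightarrow> bool" where
  "separable_hspace _ \<longleftrightarrow> (\<exists>D::'a set. countable D \<and> closure D = UNIV)"

definition bounded_clinear :: "('a::complex_inner \<Rightarrow> 'b::complex_inner) \<Rightarrow> bool" where
  "bounded_clinear T \<longleftrightarrow>
     (\<forall>x y. T (x + y) = T x + T y) \<and> (\<forall>c x. T (c *\<^sub>C x) = c *\<^sub>C T x) \<and>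
     (\<exists>K. \<forall>x. norm (T x) \<le> norm x * K)"

definition adjoint :: "('a::complex_inner \<Rightarrow> 'a) \<Rightarrow> ('a \<Rightarrow> 'a)" where
  "adjoint T = (SOME S. \<forall>x y. cinner (T x) y = cinner x (S y))"

definition normal_op :: "('a::chilbert_space \<Rightarrow> 'a) \<Rightarrow> bool" where
  "normal_op N \<longleftrightarrow> bounded_clinear N \<and> N \<circ> adjoint N = adjoint N \<circ> N"

definition wot_closure :: "('a::complex_inner \<Rightarrow> 'a) set \<Rightarrow> ('a \<Rightarrow> 'a) set" where
  "wot_closure A = {T. \<forall>F::('a \<times> 'a) set. finite F \<longrightarrow> (\<forall>e>0. \<exists>S\<in>A.
        \<forall>(x, y)\<in>F. cmod (cinner (T x - S x) y) < e)}"

definition von_neumann_algebra :: "('a::chilbert_space \<Rightarrow> 'a) set \<Rightarrow> bool" where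
  "von_neumann_algebra A \<longleftrightarrow>
     (\<forall>T\<in>A. bounded_clinear T) \<and> id \<in> A \<and>
     (\<forall>S\<in>A. \<forall>T\<in>A. (\<lambda>x. S x + T x) \<in> A) \<and>
     (\<forall>c. \<forall>T\<in>A. (\<lambda>x. c *\<^sub>C T x) \<in> A) \<and>
     (\<forall>S\<in>A. \<forall>T\<in>A. S \<circ> T \<in> A) \<and>
     (\<forall>T\<in>A. adjoint T \<in> A) \<and>
     (\<forall>T. bounded_clinear T \<and> T \<in> wot_closure A \<longrightarrow> T \<in> A)"

definition vN_generated :: "('a::chilbert_space \<Rightarrow> 'a) \<Rightarrow> ('a \<Rightarrow> 'a) set" where
  "vN_generated N = \<Inter> {A. von_neumann_algebra A \<and> N \<in> A}"

definition commutes_with :: "('a::chilbert_space \<Rightarrow> 'a) \<Rightarrow> 'a set \<Rightarrow> ('a \<Rightarrow> 'a) set \<Rightarrow> bool" where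
  "commutes_with X D A \<longleftrightarrow>
     0 \<in> D \<and> (\<forall>x\<in>D. \<forall>y\<in>D. x + y \<in> D) \<and> (\<forall>c. \<forall>x\<in>D. c *\<^sub>C x \<in> D) \<and>
     (\<forall>x\<in>D. \<forall>y\<in>D. X (x + y) = X x + X y) \<and> (\<forall>c. \<forall>x\<in>D. X (c *\<^sub>C x) = c *\<^sub>C X x) \<and>
     closure D = UNIV \<and>
     (\<forall>T\<in>A. T ` D \<subseteq> D) \<and>
     (\<forall>T\<in>A. \<forall>x\<in>D. X (T x) = T (X x))"

definition graph :: "('a \<Rightarrow> 'b) \<Rightarrow> 'a set \<Rightarrow> ('a \<times> 'b) set" where
  "graph X D = {(x, X x) | x. x \<in> D}"

definition closable :: "('a::chilbert_space \<Rightarrow> 'a) \<Rightarrow> 'a set \<Rightarrow> bool" where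
  "closable X D \<longleftrightarrow>
     (\<forall>x y1 y2. (x, y1) \<in> closure (graph X D) \<and> (x, y2) \<in> closure (graph X D) \<longrightarrow> y1 = y2)"

definition closability_property :: "('a::chilbert_space \<Rightarrow> 'a) set \<Rightarrow> bool" where
  "closability_property A \<longleftrightarrow> (\<forall>X D. commutes_with X D A \<longrightarrow> closable X D)"

definition cs_regular_borel :: "complex measure \<Rightarrow> bool" where
  "cs_regular_borel \<mu> \<longleftrightarrow>
     sets \<mu> = sets borel \<and> emeasure \<mu> (space \<mu>) < \<infinity> \<and>
     (\<exists>K. compact K \<and> emeasure \<mu> (space \<mu> - K) = 0) \<and>
     (\<forall>B\<in>sets \<mu>. emeasure \<mu> B = (INF U\<in>{U. open U \<and> B \<subseteq> U}. emeasure \<mu> U) \<and>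
                   emeasure \<mu> B = (SUP K\<in>{K. compact K \<and> K \<subseteq> B}. emeasure \<mu> K))"

definition mutually_singular :: "complex measure \<Rightarrow> complex measure \<Rightarrow> bool" where
  "mutually_singular \<mu> \<nu> \<longleftrightarrow>
     (\<exists>S\<in>sets borel. emeasure \<mu> S = 0 \<and> emeasure \<nu> (UNIV - S) = 0)"

text \<open>Index convention: measure index 0 stands for the infinite multiplicity
  part (\<mu>_\<infinity>, countably many copies), index k \<ge> 1 for multiplicity k (k copies).\<close>
definition copies :: "nat \<Rightarrow> nat set" where
  "copies k = (if k = 0 then UNIV else {..<k})"

text \<open>Elements of the model space
  L2(\<mu>_\<infinity>)^(\<infinity>) \<oplus> L2(\<mu>_1) \<oplus> L2(\<mu>_2)^(2) \<oplus> ...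
  are represented by families g k j (k the multiplicity index, j \<in> copies k the copy),
  taken modulo \<mu>_k-a.e. equality. This is the squared norm.\<close>
definition model_norm2 :: "(nat \<Rightarrow> complex measure) \<Rightarrow> (nat \<Rightarrow> nat \<Rightarrow> complex \<Rightarrow> complex) \<Rightarrow> ennreal" where
  "model_norm2 \<mu> g = (\<Sum>k. \<Sum>j. if j \<in> copies k
       then (\<integral>\<^sup>+ z. ennreal ((cmod (g k j z))\<^sup>2) \<partial>(\<mu> k)) else 0)"

definition model_elem :: "(nat \<Rightarrow> complex measure) \<Rightarrow> (nat \<Rightarrow> nat \<Rightarrow> complex \<Rightarrow> complex) \<Rightarrow> bool" where
  "model_elem \<mu> g \<longleftrightarrow> (\<forall>k. \<forall>j\<in>copies k. g k j \<in> borel_measurable borel) \<and> model_norm2 \<mu> g < \<infinity>"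

definition ae_eq_model :: "(nat \<Rightarrow> complex measure) \<Rightarrow> (nat \<Rightarrow> nat \<Rightarrow> complex \<Rightarrow> complex) \<Rightarrow> (nat \<Rightarrow> nat \<Rightarrow> complex \<Rightarrow> complex) \<Rightarrow> bool" where
  "ae_eq_model \<mu> g h \<longleftrightarrow> (\<forall>k. \<forall>j\<in>copies k. AE z in \<mu> k. g k j z = h k j z)"

definition unitary_to_model :: "('a::chilbert_space \<Rightarrow> 'a) \<Rightarrow> (nat \<Rightarrow> complex measure) \<Rightarrow> ('a \<Rightarrow> nat \<Rightarrow> nat \<Rightarrow> complex \<Rightarrow> complex) \<Rightarrow> bool" where
  "unitary_to_model N \<mu> U \<longleftrightarrow>
     (\<forall>x. model_elem \<mu> (U x)) \<and>
     (\<forall>x y. ae_eq_model \<mu> (U (x + y)) (\<lambda>k j z. U x k j z + U y k j z)) \<and>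
     (\<forall>c x. ae_eq_model \<mu> (U (c *\<^sub>C x)) (\<lambda>k j z. c * U x k j z)) \<and>
     (\<forall>x. ennreal ((norm x)\<^sup>2) = model_norm2 \<mu> (U x)) \<and>
     (\<forall>g. model_elem \<mu> g \<longrightarrow> (\<exists>x. ae_eq_model \<mu> (U x) g)) \<and>
     (\<forall>x. ae_eq_model \<mu> (U (N x)) (\<lambda>k j z. z * U x k j z))"

definition multiplicity_decomposition :: "('a::chilbert_space \<Rightarrow> 'a) \<Rightarrow> (nat \<Rightarrow> complex measure) \<Rightarrow> bool" where
  "multiplicity_decomposition N \<mu> \<longleftrightarrow>
     (\<forall>k. cs_regular_borel (\<mu> k)) \<and>
     (\<forall>i j. i \<noteq> j \<longrightarrow> mutually_singular (\<mu> i) (\<mu> j)) \<and>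
     (\<exists>U. unitary_to_model N \<mu> U)"

text \<open>Uniform finite multiplicity: in the multiplicity decomposition, \<mu>_\<infinity> = 0
  (the decomposition is unique up to equivalence of the measures, so this does
  not depend on the chosen decomposition).\<close>
definition uniform_finite_multiplicity :: "('a::chilbert_space \<Rightarrow> 'a) \<Rightarrow> bool" where
  "uniform_finite_multiplicity N \<longleftrightarrow>
     (\<exists>\<mu>. multiplicity_decomposition N \<mu> \<and> emeasure (\<mu> 0) UNIV = 0)"

end

theory Submission
  imports Defs
begin

text \<open>
  A normal operator is represented as multiplication by \<open>z\<close> as follows. A joint approximate
  eigenvector argument bounds a polynomial in \<open>N\<close> and its adjoint by its supremum on a disc, so
  each vector induces a positive functional and hence a measure on the disc. An orthogonal family
  of cyclic subspaces together with Radon-Nikodym derivatives with respect to one dominating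
  measure gives the multiplicity decomposition.

  If the part of infinite multiplicity is nonzero, the transformation adding up the components of
  vectors with finitely many of them commutes with the algebra and is not closable. Conversely, let
  \<open>X\<close> have domain \<open>D\<close> and commute with the algebra, which contains all multiplications by bounded
  Borel functions. On a part of multiplicity \<open>k\<close> a maximal pointwise orthonormal family in \<open>D\<close>
  exists locally, of length at most \<open>k\<close>, and its maximality forces it to span \<open>D\<close> pointwise.
  Hence \<open>X\<close> acts there as multiplication by a measurable matrix, and almost everywhere convergent
  subsequences show that \<open>X\<close> is closable.
\<close>

section \<open>Complex inner product spaces\<close>

text \<open>Vector measures are built on a whole disc whose radius bounds \<open>N\<close>, rather
  than on the spectrum: a norm estimate over the disc already gives positivity, and the measures are
  built from positivity. The model consists of functions, not of classes, so maps into it are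
  relations or choices and identities hold up to null sets; exact identities between vectors are
  recovered because the isometry determines a vector from its class. The direction from finite
  multiplicity to closability is shaped by one obstacle: the domain of \<open>X\<close> is known to
  be invariant only under bounded functions, while the coefficients in Gram-Schmidt
  orthogonalisation and in expansions are in general unbounded. Both are therefore carried out on
  countably many sets where these coefficients are bounded. Finiteness of \<open>k\<close> enters
  twice: it stops the growth of a frame, and it lets coordinatewise convergence to 0 pass through a
  finite matrix product. The sum over infinitely many copies is exactly the kind of map for which
  the latter fails.\<close>

lemma cinner_add_right: "cinner x (y + z) = cinner x y + cinner x z"
  by (metis cinner_add_left cinner_conj complex_cnj_add)

lemma cinner_scaleC_right: "cinner x (a *\<^sub>C y) = cnj a * cinner x y"
  by (metis cinner_scaleC_left cinner_conj complex_cnj_mult)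

lemma scaleC_zero_left [simp]: "0 *\<^sub>C (x::'a::complex_vector) = 0"
  by (metis of_real_0 scaleR_scaleC scaleR_zero_left)

lemma scaleC_zero_right [simp]: "a *\<^sub>C (0::'a::complex_vector) = 0"
  by (metis add_cancel_right_right scaleC_add_right)

lemma scaleC_minus1: "(- 1) *\<^sub>C (x::'a::complex_vector) = - x"
  by (metis of_real_1 of_real_minus scaleR_minus1_left scaleR_scaleC)

lemma scaleC_minus_left: "(- a) *\<^sub>C (x::'a::complex_vector) = - (a *\<^sub>C x)"
  by (metis mult_minus1 scaleC_minus1 scaleC_scaleC)

lemma scaleC_minus_right: "a *\<^sub>C (- x::'a::complex_vector) = - (a *\<^sub>C x)"
  by (metis mult.commute scaleC_minus1 scaleC_scaleC)

lemma scaleC_diff_right: "a *\<^sub>C (x - y::'a::complex_vector) = a *\<^sub>C x - a *\<^sub>C y"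
  by (metis scaleC_add_right scaleC_minus_right add_uminus_conv_diff)

lemma scaleC_diff_left: "(a - b) *\<^sub>C (x::'a::complex_vector) = a *\<^sub>C x - b *\<^sub>C x"
  by (metis scaleC_add_left scaleC_minus_left add_uminus_conv_diff)

lemma scaleC_one' [simp]: "1 *\<^sub>C (x::'a::complex_vector) = x"
  by (rule scaleC_one)

lemma cinner_zero_left [simp]: "cinner 0 x = 0"
  by (metis cinner_scaleC_left mult_zero_left scaleC_zero_left)

lemma cinner_zero_right [simp]: "cinner x 0 = 0"
  by (metis cinner_conj cinner_zero_left complex_cnj_zero)

lemma cinner_minus_left: "cinner (- x) y = - cinner x y"
  by (metis cinner_scaleC_left mult_minus1 scaleC_minus1)

lemma cinner_minus_right: "cinner x (- y) = - cinner x y"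
  by (metis cinner_conj cinner_minus_left complex_cnj_minus)

lemma cinner_diff_left: "cinner (x - y) z = cinner x z - cinner y z"
  by (metis cinner_add_left cinner_minus_left add_uminus_conv_diff)

lemma cinner_diff_right: "cinner x (y - z) = cinner x y - cinner x z"
  by (metis cinner_add_right cinner_minus_right add_uminus_conv_diff)

lemma cinner_scaleR_left: "cinner (r *\<^sub>R x) y = r *\<^sub>R cinner x y"
  by (simp add: scaleR_scaleC cinner_scaleC_left scaleR_conv_of_real)

lemma cinner_scaleR_right: "cinner x (r *\<^sub>R y) = r *\<^sub>R cinner x y"
  by (simp add: scaleR_scaleC cinner_scaleC_right scaleR_conv_of_real)

lemma norm_sq_cinner: "(norm x)\<^sup>2 = Re (cinner x x)"
  using cinner_pos[of x] by (simp add: norm_eq_sqrt_cinner)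

lemma cinner_self: "cinner x x = complex_of_real ((norm x)\<^sup>2)"
  using cinner_pos[of x] by (simp add: norm_sq_cinner complex_eq_iff)

lemma Re_cinner_commute: "Re (cinner y x) = Re (cinner x y)"
  by (subst cinner_conj) simp

lemma norm_add_sq: "(norm (x + y))\<^sup>2 = (norm x)\<^sup>2 + (norm y)\<^sup>2 + 2 * Re (cinner x y)"
  by (simp add: norm_sq_cinner cinner_add_left cinner_add_right Re_cinner_commute[of y x])

lemma norm_diff_sq: "(norm (x - y))\<^sup>2 = (norm x)\<^sup>2 + (norm y)\<^sup>2 - 2 * Re (cinner x y)"
  by (simp add: norm_sq_cinner cinner_diff_left cinner_diff_right Re_cinner_commute[of y x])

lemma norm_scaleC: "norm (c *\<^sub>C (x::'a::complex_inner)) = cmod c * norm x"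
proof -
  have "(norm (c *\<^sub>C x))\<^sup>2 = Re (c * cnj c * cinner x x)"
    by (simp add: norm_sq_cinner cinner_scaleC_left cinner_scaleC_right algebra_simps)
  also have "\<dots> = (cmod c * norm x)\<^sup>2"
    by (simp add: cinner_self complex_norm_square[symmetric] power_mult_distrib flip: of_real_mult)
  finally show ?thesis by simp
qed

lemma cinner_Cauchy_Schwarz: "cmod (cinner x y) \<le> norm x * norm y"
proof (cases "y = 0")
  case False
  define t where "t = cinner x y / complex_of_real ((norm y)\<^sup>2)"
  have y: "(norm y)\<^sup>2 > 0" using False by simp
  have ct: "cnj t * cinner x y = complex_of_real ((cmod (cinner x y))\<^sup>2 / (norm y)\<^sup>2)"
    using complex_norm_square[of "cinner x y"] by (simp add: t_def mult.commute)
  have "0 \<le> (norm (x - t *\<^sub>C y))\<^sup>2" by simp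
  also have "\<dots> = (norm x)\<^sup>2 + (cmod t * norm y)\<^sup>2 - 2 * Re (cnj t * cinner x y)"
    by (simp add: norm_diff_sq norm_scaleC cinner_scaleC_right)
  also have "cmod t * norm y = cmod (cinner x y) / norm y"
    using False by (simp add: t_def norm_divide power2_eq_square norm_mult)
  finally have "(cmod (cinner x y))\<^sup>2 / (norm y)\<^sup>2 \<le> (norm x)\<^sup>2"
    unfolding ct by (simp add: power_divide)
  then have "(cmod (cinner x y))\<^sup>2 \<le> (norm x * norm y)\<^sup>2"
    using y by (simp add: field_simps power_mult_distrib)
  then show ?thesis by (rule power2_le_imp_le) simp
qed simp

lemma bounded_bilinear_cinner: "bounded_bilinear (cinner :: 'a::complex_inner \<Rightarrow> 'a \<Rightarrow> complex)"
proof
  show "\<exists>K. \<forall>a b::'a. norm (cinner a b) \<le> norm a * norm b * K"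
    by (rule exI[of _ 1]) (simp add: cinner_Cauchy_Schwarz)
qed (simp_all add: cinner_add_left cinner_add_right cinner_scaleR_left cinner_scaleR_right)

lemmas tendsto_cinner [tendsto_intros] = bounded_bilinear.tendsto[OF bounded_bilinear_cinner]
lemmas continuous_on_cinner [continuous_intros] =
  bounded_bilinear.continuous_on[OF bounded_bilinear_cinner]
lemmas cinner_sum_right = bounded_bilinear.sum_right[OF bounded_bilinear_cinner]

lemma bounded_bilinear_scaleC: "bounded_bilinear ((*\<^sub>C) :: complex \<Rightarrow> 'a::complex_inner \<Rightarrow> 'a)"
proof
  fix r :: real and a :: complex and b :: 'a
  show "(r *\<^sub>R a) *\<^sub>C b = r *\<^sub>R (a *\<^sub>C b)"
    by (simp add: scaleR_scaleC scaleC_scaleC scaleR_conv_of_real)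
  show "a *\<^sub>C (r *\<^sub>R b) = r *\<^sub>R (a *\<^sub>C b)"
    by (simp add: scaleR_scaleC scaleC_scaleC mult.commute)
next
  show "\<exists>K. \<forall>a (b::'a). norm (a *\<^sub>C b) \<le> norm a * norm b * K"
    by (rule exI[of _ 1]) (simp add: norm_scaleC)
qed (simp_all add: scaleC_add_left scaleC_add_right)

lemmas tendsto_scaleC [tendsto_intros] = bounded_bilinear.tendsto[OF bounded_bilinear_scaleC]
lemmas scaleC_sum_right = bounded_bilinear.sum_right[OF bounded_bilinear_scaleC]
lemmas scaleC_sum_left = bounded_bilinear.sum_left[OF bounded_bilinear_scaleC]

lemma cinner_ext:
  assumes "\<And>x. cinner x y = cinner x z"
  shows "y = z"
  using assms[of "y - z"] cinner_eq_zero[of "y - z"] by (simp add: cinner_diff_right)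

subsection \<open>Orthogonal projection\<close>

definition csubspace :: "'a::complex_vector set \<Rightarrow> bool" where
  "csubspace M \<longleftrightarrow> 0 \<in> M \<and> (\<forall>x\<in>M. \<forall>y\<in>M. x + y \<in> M) \<and> (\<forall>c. \<forall>x\<in>M. c *\<^sub>C x \<in> M)"

lemma csubspace_closure:
  fixes M :: "'a::complex_inner set"
  assumes "csubspace M"
  shows "csubspace (closure M)"
  unfolding csubspace_def
proof (intro conjI ballI allI)
  show "0 \<in> closure M" using assms closure_subset by (auto simp: csubspace_def)
next
  fix x y assume "x \<in> closure M" "y \<in> closure M"
  then obtain f g where "\<forall>n. f n \<in> M" "f \<longlonglongrightarrow> x" "\<forall>n. g n \<in> M" "g \<longlonglongrightarrow> y"
    unfolding closure_sequential by blast
  then show "x + y \<in> closure M"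
    unfolding closure_sequential using assms
    by (intro exI[of _ "\<lambda>n. f n + g n"]) (auto simp: csubspace_def intro: tendsto_intros)
next
  fix c x assume "x \<in> closure M"
  then obtain f where "\<forall>n. f n \<in> M" "f \<longlonglongrightarrow> x"
    unfolding closure_sequential by blast
  then show "c *\<^sub>C x \<in> closure M"
    unfolding closure_sequential using assms
    by (intro exI[of _ "\<lambda>n. c *\<^sub>C f n"]) (auto simp: csubspace_def intro: tendsto_intros)
qed

lemma orthogonal_projection_exists:
  fixes M :: "'a::chilbert_space set"
  assumes cl: "closed M" and sub: "csubspace M"
  shows "\<exists>m\<in>M. \<forall>y\<in>M. cinner (x - m) y = 0"
proof -
  have ne: "M \<noteq> {}" using sub by (auto simp: csubspace_def)
  define d where "d = infdist x M"
  have dle: "d \<le> norm (x - m)" if "m \<in> M" for m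
    using infdist_le[OF that, of x] by (simp add: d_def dist_norm)
  have d0: "0 \<le> d" by (simp add: d_def infdist_nonneg)
  have "\<exists>m\<in>M. norm (x - m) < d + 1 / Suc n" for n
  proof (rule ccontr)
    assume "\<not> ?thesis"
    then have "d + 1 / Suc n \<le> d"
      unfolding d_def using ne
      by (subst (2) infdist_notempty) (auto intro!: cINF_greatest simp: dist_norm not_less)
    then show False by (simp add: field_simps)
  qed
  then obtain m where m: "\<And>n. m n \<in> M" "\<And>n. norm (x - m n) < d + 1 / Suc n" by metis
  have "Cauchy m"
  proof (rule metric_CauchyI)
    fix e :: real assume e: "e > 0"
    \<comment> \<open>The parallelogram law below bounds a squared distance by
      \<open>4 * (2 * d + \<eta>) * \<eta>\<close>. With \<open>\<eta> \<le> 1\<close> this is at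
      most \<open>4 * (2 * d + 1) * \<eta>\<close>, which the second argument of \<open>min\<close>
      keeps at most half of \<open>e\<^sup>2\<close>.\<close>
    define \<eta> where "\<eta> = min 1 (e\<^sup>2 / (4 * (2 * d + 1) * 2))"
    have eta: "\<eta> > 0" "\<eta> \<le> 1" "4 * (2 * d + 1) * \<eta> < e\<^sup>2"
    proof -
      define c where "c = 4 * (2 * d + 1)"
      have c: "c > 0" using d0 by (simp add: c_def)
      have ep: "e\<^sup>2 > 0" using e by simp
      show "\<eta> > 0" "\<eta> \<le> 1" unfolding \<eta>_def c_def[symmetric] using c ep by auto
      have "c * \<eta> \<le> c * (e\<^sup>2 / (c * 2))"
        unfolding \<eta>_def c_def[symmetric] using c by (intro mult_left_mono) auto
      also have "\<dots> = e\<^sup>2 / 2" using c by simp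
      finally show "4 * (2 * d + 1) * \<eta> < e\<^sup>2" unfolding c_def using ep by linarith
    qed
    obtain n0 where n0: "1 / Suc n0 < \<eta>" using eta(1) nat_approx_posE by blast
    show "\<exists>n0. \<forall>i\<ge>n0. \<forall>j\<ge>n0. dist (m i) (m j) < e"
    proof (intro exI allI impI)
      fix i j assume ij: "n0 \<le> i" "n0 \<le> j"
      have small: "norm (x - m k) \<le> d + \<eta>" if "n0 \<le> k" for k
      proof -
        have "1 / Suc k \<le> 1 / Suc n0" using that by (simp add: frac_le)
        then show ?thesis using m(2)[of k] n0 by linarith
      qed
      define u v where "u = x - m i" and "v = x - m j"
      have mid: "(1/2) *\<^sub>R (m i + m j) \<in> M"
        using sub m(1) by (auto simp: csubspace_def scaleR_scaleC)
      have "u + v = 2 *\<^sub>R (x - (1/2) *\<^sub>R (m i + m j))"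
        by (simp add: u_def v_def algebra_simps scaleR_2)
      then have "norm (u + v) \<ge> 2 * d" using dle[OF mid] by simp
      then have uv: "(norm (u + v))\<^sup>2 \<ge> 4 * d\<^sup>2" using d0 power_mono[of "2*d" "norm (u+v)" 2] by simp
      have sm: "(norm u)\<^sup>2 \<le> (d + \<eta>)\<^sup>2" "(norm v)\<^sup>2 \<le> (d + \<eta>)\<^sup>2"
        unfolding u_def v_def using small[OF ij(1)] small[OF ij(2)] by (simp_all add: power_mono)
      have "(norm (u - v))\<^sup>2 = 2 * (norm u)\<^sup>2 + 2 * (norm v)\<^sup>2 - (norm (u + v))\<^sup>2"
        by (simp add: norm_add_sq norm_diff_sq)
      also have "\<dots> \<le> 4 * (d + \<eta>)\<^sup>2 - 4 * d\<^sup>2" using uv sm by linarith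
      also have "\<dots> = 4 * (2 * d + \<eta>) * \<eta>" by (simp add: power2_eq_square algebra_simps)
      also have "\<dots> \<le> 4 * (2 * d + 1) * \<eta>" using eta by (intro mult_right_mono) auto
      also have "\<dots> < e\<^sup>2" by (rule eta(3))
      finally have "norm (u - v) < e" using e by (simp add: power2_less_imp_less)
      moreover have "norm (u - v) = dist (m i) (m j)"
        by (simp add: u_def v_def dist_norm norm_minus_commute)
      ultimately show "dist (m i) (m j) < e" by simp
    qed
  qed
  then obtain l where l: "m \<longlonglongrightarrow> l" using Cauchy_convergent convergent_def by blast
  have lM: "l \<in> M" using closed_sequentially[OF cl] m(1) l by blast
  have "(\<lambda>n. norm (x - m n)) \<longlonglongrightarrow> norm (x - l)" by (intro tendsto_intros l)
  moreover have "(\<lambda>n. d + 1 / real (Suc n)) \<longlonglongrightarrow> d + 0"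
    by (intro tendsto_intros LIMSEQ_Suc[OF lim_1_over_n])
  ultimately have "norm (x - l) \<le> d + 0"
    by (rule LIMSEQ_le) (use m(2) less_imp_le in blast)
  then have ld: "norm (x - l) \<le> d" by simp
  show ?thesis
  proof (intro bexI[OF _ lM] ballI)
    fix y assume y: "y \<in> M"
    define u where "u = x - l"
    show "cinner (x - l) y = 0"
    proof (cases "y = 0")
      case False
      \<comment> \<open>Removing the component of \<open>u\<close> along \<open>y\<close> would
        shorten \<open>u\<close> unless \<open>cinner u y\<close> is 0, against minimality.\<close>
      define c where "c = cinner u y / complex_of_real ((norm y)\<^sup>2)"
      have ct: "cnj c * cinner u y = complex_of_real ((cmod (cinner u y))\<^sup>2 / (norm y)\<^sup>2)"
        using complex_norm_square[of "cinner u y"] by (simp add: c_def mult.commute)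
      have "l + c *\<^sub>C y \<in> M" using lM y sub by (auto simp: csubspace_def)
      then have "norm u \<le> norm (u - c *\<^sub>C y)"
        using dle[of "l + c *\<^sub>C y"] ld by (simp add: u_def algebra_simps)
      then have "(norm u)\<^sup>2 \<le> (norm (u - c *\<^sub>C y))\<^sup>2" by (simp add: power_mono)
      also have "\<dots> = (norm u)\<^sup>2 + (cmod c * norm y)\<^sup>2 - 2 * Re (cnj c * cinner u y)"
        by (simp add: norm_diff_sq norm_scaleC cinner_scaleC_right)
      also have "cmod c * norm y = cmod (cinner u y) / norm y"
        using False by (simp add: c_def norm_divide power2_eq_square norm_mult)
      finally have "(cmod (cinner u y))\<^sup>2 / (norm y)\<^sup>2 \<le> 0"
        unfolding ct by (simp add: power_divide)
      then show ?thesis using False by (simp add: u_def divide_le_0_iff)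
    qed simp
  qed
qed

lemma closed_csubspace_eq_UNIV:
  fixes M :: "'a::chilbert_space set"
  assumes "closed M" "csubspace M" "\<And>v. (\<And>y. y \<in> M \<Longrightarrow> cinner v y = 0) \<Longrightarrow> v = 0"
  shows "M = UNIV"
proof -
  have "x \<in> M" for x
    using orthogonal_projection_exists[OF assms(1,2), of x] assms(3) by force
  then show ?thesis by auto
qed

subsection \<open>Bounded operators and adjoints\<close>

lemma bounded_clinear_add: "bounded_clinear T \<Longrightarrow> T (x + y) = T x + T y"
  by (simp add: bounded_clinear_def)

lemma bounded_clinear_scaleC: "bounded_clinear T \<Longrightarrow> T (c *\<^sub>C x) = c *\<^sub>C T x"
  by (simp add: bounded_clinear_def)

lemma bounded_clinear_zero: "bounded_clinear T \<Longrightarrow> T 0 = 0"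
  by (metis bounded_clinear_scaleC scaleC_zero_left)

lemma bounded_clinear_minus: "bounded_clinear T \<Longrightarrow> T (- x) = - T x"
  by (metis bounded_clinear_scaleC scaleC_minus1)

lemma bounded_clinear_diff: "bounded_clinear T \<Longrightarrow> T (x - y) = T x - T y"
  using bounded_clinear_add[of T x "- y"] bounded_clinear_minus[of T y] by simp

lemma bounded_clinear_bound:
  assumes "bounded_clinear T"
  obtains K where "K > 0" "\<And>x. norm (T x) \<le> K * norm x"
proof -
  obtain K where K: "\<forall>x. norm (T x) \<le> norm x * K"
    using assms by (auto simp: bounded_clinear_def)
  show thesis
  proof (rule that[of "max 1 K"])
    fix x
    show "norm (T x) \<le> max 1 K * norm x"
      using K[rule_format, of x] mult_left_mono[of K "max 1 K" "norm x"]
      by (simp add: mult.commute)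
  qed simp
qed

lemma bounded_clinearI:
  assumes "\<And>x y. T (x + y) = T x + T y" "\<And>c x. T (c *\<^sub>C x) = c *\<^sub>C T x"
    "\<And>x. norm (T x) \<le> K * norm x"
  shows "bounded_clinear T"
  unfolding bounded_clinear_def using assms by (metis mult.commute)

lemma bounded_clinear_bounded_linear: "bounded_clinear T \<Longrightarrow> bounded_linear T"
proof -
  assume T: "bounded_clinear T"
  then obtain K where "\<forall>x. norm (T x) \<le> norm x * K" by (auto simp: bounded_clinear_def)
  then show ?thesis
    by (intro bounded_linear_intro[where K=K])
       (auto simp: bounded_clinear_add[OF T] bounded_clinear_scaleC[OF T] scaleR_scaleC)
qed

lemma bounded_clinear_tendsto: "bounded_clinear T \<Longrightarrow> (f \<longlongrightarrow> l) F \<Longrightarrow> ((\<lambda>n. T (f n)) \<longlongrightarrow> T l) F"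
  using bounded_clinear_bounded_linear bounded_linear.tendsto by blast

lemma bounded_clinear_continuous_on: "bounded_clinear T \<Longrightarrow> continuous_on S T"
  using bounded_clinear_bounded_linear linear_continuous_on by blast

lemma bounded_clinear_sum: "bounded_clinear T \<Longrightarrow> T (sum f A) = (\<Sum>i\<in>A. T (f i))"
  using bounded_clinear_bounded_linear bounded_linear.linear linear_sum by blast

lemma bounded_clinear_scaleC_op: "bounded_clinear (\<lambda>x::'a::complex_inner. c *\<^sub>C x)"
  by (rule bounded_clinearI[where K="cmod c"])
     (auto simp: scaleC_add_right scaleC_scaleC norm_scaleC mult.commute)

lemma bounded_clinear_id: "bounded_clinear (\<lambda>x::'a::complex_inner. x)"
  by (rule bounded_clinearI[where K=1]) auto

lemma bounded_clinear_plus: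
  assumes "bounded_clinear S" "bounded_clinear T"
  shows "bounded_clinear (\<lambda>x. S x + T x)"
proof -
  obtain K L where "\<And>x. norm (S x) \<le> K * norm x" "\<And>x. norm (T x) \<le> L * norm x"
    using assms bounded_clinear_bound by metis
  then have "norm (S x + T x) \<le> (K + L) * norm x" for x
    using norm_triangle_ineq[of "S x" "T x"] by (smt (verit) distrib_right)
  then show ?thesis
    using assms
    by (intro bounded_clinearI[where K="K+L"])
       (auto simp: bounded_clinear_add bounded_clinear_scaleC scaleC_add_right)
qed

lemma bounded_clinear_compose:
  assumes "bounded_clinear S" "bounded_clinear T"
  shows "bounded_clinear (\<lambda>x. S (T x))"
proof -
  obtain K L where K: "K > 0" "\<And>x. norm (S x) \<le> K * norm x" and L: "\<And>x. norm (T x) \<le> L * norm x"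
    using assms bounded_clinear_bound by metis
  then have "norm (S (T x)) \<le> (K * L) * norm x" for x
    by (smt (verit) mult.assoc mult_left_mono)
  then show ?thesis
    using assms
    by (intro bounded_clinearI[where K="K*L"])
       (auto simp: bounded_clinear_add bounded_clinear_scaleC)
qed

text \<open>\<open>adjoint\<close> is a choice, so it has this property once some function has it.
  That is Riesz representation: either the functional \<open>cinner (T x) y\<close> of
  \<open>x\<close> vanishes, or its closed kernel has a nonzero orthogonal vector \<open>u\<close>,
  and a multiple of \<open>u\<close> represents it.\<close>

lemma adjoint_eq:
  fixes T :: "'a::chilbert_space \<Rightarrow> 'a"
  assumes T: "bounded_clinear T"
  shows "cinner (T x) y = cinner x (adjoint T y)"
proof -
  have "\<exists>z. \<forall>x. cinner (T x) y = cinner x z" for y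
  proof -
    define M where "M = {x. cinner (T x) y = 0}"
    have cl: "closed M" unfolding M_def
      by (intro closed_Collect_eq continuous_intros bounded_clinear_continuous_on[OF T])
    have sub: "csubspace M"
      using T by (auto simp: csubspace_def M_def bounded_clinear_add bounded_clinear_scaleC
          bounded_clinear_zero cinner_add_left cinner_scaleC_left)
    show ?thesis
    proof (cases "\<forall>v. (\<forall>y\<in>M. cinner v y = 0) \<longrightarrow> v = 0")
      case True
      then have "M = UNIV" using closed_csubspace_eq_UNIV[OF cl sub] by blast
      then show ?thesis by (intro exI[of _ 0]) (auto simp: M_def)
    next
      case False
      then obtain u where u: "u \<noteq> 0" "\<And>y. y \<in> M \<Longrightarrow> cinner u y = 0" by blast
      have uu: "cinner u u \<noteq> 0" using u(1) by (simp add: cinner_eq_zero)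
      define f where "f x = cinner (T x) y" for x
      \<comment> \<open>This combination is annihilated by \<open>f\<close>; its orthogonality to
        \<open>u\<close> expresses \<open>f x\<close> through \<open>cinner x u\<close>.\<close>
      have "f u *\<^sub>C x - f x *\<^sub>C u \<in> M" for x
        using T by (simp add: M_def f_def bounded_clinear_diff bounded_clinear_scaleC
            cinner_diff_left cinner_scaleC_left)
      then have "cinner (f u *\<^sub>C x - f x *\<^sub>C u) u = 0" for x
        using u(2) by (metis cinner_conj complex_cnj_zero)
      then have *: "f u * cinner x u = f x * cinner u u" for x
        by (simp add: cinner_diff_left cinner_scaleC_left)
      show ?thesis
      proof (intro exI allI)
        fix x
        show "cinner (T x) y = cinner x ((cnj (f u / cinner u u)) *\<^sub>C u)"
          using *[of x] uu by (simp add: cinner_scaleC_right f_def field_simps)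
      qed
    qed
  qed
  then have ex: "\<exists>S. \<forall>x y. cinner (T x) y = cinner x (S y)" by metis
  have "\<forall>x y. cinner (T x) y = cinner x (adjoint T y)"
    unfolding adjoint_def by (rule someI_ex[OF ex])
  then show ?thesis by blast
qed

lemma adjoint_unique:
  fixes T :: "'a::chilbert_space \<Rightarrow> 'a"
  assumes "bounded_clinear T" "\<And>x y. cinner (T x) y = cinner x (S y)"
  shows "adjoint T = S"
  using adjoint_eq[OF assms(1)] assms(2) by (metis cinner_ext ext)

lemma adjoint_eq':
  fixes T :: "'a::chilbert_space \<Rightarrow> 'a"
  assumes "bounded_clinear T"
  shows "cinner (adjoint T x) y = cinner x (T y)"
  by (metis adjoint_eq[OF assms] cinner_conj)

lemma bounded_clinear_adjoint:
  fixes T :: "'a::chilbert_space \<Rightarrow> 'a"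
  assumes T: "bounded_clinear T"
  shows "bounded_clinear (adjoint T)"
proof -
  obtain K where K: "K > 0" "\<And>x. norm (T x) \<le> K * norm x"
    using bounded_clinear_bound[OF T] by blast
  note ad = adjoint_eq[OF T, symmetric]
  show ?thesis
  proof (rule bounded_clinearI)
    show "adjoint T (x + y) = adjoint T x + adjoint T y" for x y
      by (rule cinner_ext) (simp add: ad cinner_add_right)
    show "adjoint T (c *\<^sub>C x) = c *\<^sub>C adjoint T x" for c x
      by (rule cinner_ext) (simp add: ad cinner_scaleC_right)
    fix x
    let ?w = "adjoint T x"
    have "(norm ?w)\<^sup>2 = cmod (cinner ?w ?w)" by (simp add: cinner_self norm_power)
    also have "\<dots> = cmod (cinner (T ?w) x)" by (simp add: ad)
    also have "\<dots> \<le> norm (T ?w) * norm x" by (rule cinner_Cauchy_Schwarz)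
    also have "\<dots> \<le> K * norm ?w * norm x" by (intro mult_right_mono K) auto
    finally have "norm ?w * norm ?w \<le> norm ?w * (K * norm x)"
      by (simp add: power2_eq_square algebra_simps)
    then show "norm ?w \<le> K * norm x"
      by (cases "?w = 0") (use K in \<open>auto intro: mult_nonneg_nonneg\<close>)
  qed
qed

lemma adjoint_adjoint:
  fixes T :: "'a::chilbert_space \<Rightarrow> 'a"
  shows "bounded_clinear T \<Longrightarrow> adjoint (adjoint T) = T"
  by (intro adjoint_unique bounded_clinear_adjoint adjoint_eq')

section \<open>Commutants and the generated von Neumann algebra\<close>

definition commutant :: "('a::chilbert_space \<Rightarrow> 'a) set \<Rightarrow> ('a \<Rightarrow> 'a) set" where
  "commutant \<S> = {T. bounded_clinear T \<and> (\<forall>X\<in>\<S>. \<forall>x. T (X x) = X (T x))}"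

text \<open>Commuting with a fixed \<open>X\<close> is a linear condition that can be tested on
  matrix coefficients, which weak operator approximation controls. Closure under adjoints comes from
  \<open>\<S>\<close> being closed under adjoints.\<close>

lemma von_neumann_algebra_commutant:
  fixes \<S> :: "('a::chilbert_space \<Rightarrow> 'a) set"
  assumes bc: "\<And>X. X \<in> \<S> \<Longrightarrow> bounded_clinear X" and adj: "\<And>X. X \<in> \<S> \<Longrightarrow> adjoint X \<in> \<S>"
  shows "von_neumann_algebra (commutant \<S>)"
  unfolding von_neumann_algebra_def
proof (intro conjI ballI allI impI)
  show "id \<in> commutant \<S>" using bounded_clinear_id by (simp add: commutant_def id_def)
next
  fix T assume "T \<in> commutant \<S>" then show "bounded_clinear T" by (simp add: commutant_def)
next
  fix S T assume "S \<in> commutant \<S>" "T \<in> commutant \<S>"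
  then show "(\<lambda>x. S x + T x) \<in> commutant \<S>" "S \<circ> T \<in> commutant \<S>"
    using bounded_clinear_compose[of S T]
    by (auto simp: commutant_def bounded_clinear_plus bounded_clinear_add[OF bc] o_def)
next
  fix T c assume "T \<in> commutant \<S>"
  then show "(\<lambda>x. c *\<^sub>C T x) \<in> commutant \<S>"
    using bounded_clinear_compose[OF bounded_clinear_scaleC_op]
    by (auto simp: commutant_def bounded_clinear_scaleC[OF bc])
next
  fix T assume T: "T \<in> commutant \<S>"
  then have bT: "bounded_clinear T" by (simp add: commutant_def)
  have "adjoint T (X x) = X (adjoint T x)" if X: "X \<in> \<S>" for X x
  proof (rule cinner_ext)
    fix w
    have "cinner w (adjoint T (X x)) = cinner (T w) (X x)" by (simp add: adjoint_eq[OF bT])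
    also have "\<dots> = cinner (adjoint X (T w)) x" by (simp add: adjoint_eq'[OF bc[OF X]])
    also have "\<dots> = cinner (T (adjoint X w)) x" using T adj[OF X] by (simp add: commutant_def)
    also have "\<dots> = cinner w (X (adjoint T x))"
      by (simp add: adjoint_eq[OF bT] adjoint_eq'[OF bc[OF X]])
    finally show "cinner w (adjoint T (X x)) = cinner w (X (adjoint T x))" .
  qed
  then show "adjoint T \<in> commutant \<S>" using bounded_clinear_adjoint[OF bT] by (simp add: commutant_def)
next
  fix T assume T: "bounded_clinear T \<and> T \<in> wot_closure (commutant \<S>)"
  have "T (X x) = X (T x)" if X: "X \<in> \<S>" for X x
  proof (rule cinner_ext)
    fix w
    have *: "cmod (cinner (T (X x)) w - cinner (X (T x)) w) < 2 * e" if e: "e > 0" for e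
    proof -
      \<comment> \<open>The second pair arises by moving \<open>X\<close> across the inner product
        in \<open>cinner (X (T x - S x)) w\<close>; one \<open>S\<close> near \<open>T\<close> on
        both pairs then controls the whole commutator.\<close>
      let ?F = "{(X x, w), (x, adjoint X w)}"
      obtain S where S: "S \<in> commutant \<S>" "\<forall>(x, y)\<in>?F. cmod (cinner (T x - S x) y) < e"
      proof -
        have "finite ?F" by simp
        then show ?thesis using T e that unfolding wot_closure_def by blast
      qed
      have "S (X x) = X (S x)" using S(1) X by (simp add: commutant_def)
      then have "cinner (T (X x)) w - cinner (X (T x)) w
          = cinner (T (X x) - S (X x)) w - cinner (X (T x - S x)) w"
        by (simp add: cinner_diff_left bounded_clinear_diff[OF bc[OF X]])
      also have "\<dots> = cinner (T (X x) - S (X x)) w - cinner (T x - S x) (adjoint X w)"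
        by (simp add: adjoint_eq[OF bc[OF X]])
      also have "cmod \<dots> < 2 * e"
        using S(2) norm_triangle_ineq4[of "cinner (T (X x) - S (X x)) w" "cinner (T x - S x) (adjoint X w)"]
        by simp
      finally show ?thesis .
    qed
    have "cinner (T (X x)) w - cinner (X (T x)) w = 0"
    proof (rule ccontr)
      assume "\<not> ?thesis"
      then show False using *[of "cmod (cinner (T (X x)) w - cinner (X (T x)) w) / 2"] by simp
    qed
    then show "cinner w (T (X x)) = cinner w (X (T x))"
      by (metis cinner_conj right_minus_eq)
  qed
  then show "T \<in> commutant \<S>" using T by (simp add: commutant_def)
qed

text \<open>The easy half of the double commutant theorem: the operators commuting with
  \<open>N\<close> and \<open>adjoint N\<close> form a set closed under adjoints, so its commutant
  is a von Neumann algebra; it contains \<open>N\<close>, hence all of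
  \<open>vN_generated N\<close>.\<close>

lemma vN_generated_commutes:
  fixes N :: "'a::chilbert_space \<Rightarrow> 'a"
  assumes N: "bounded_clinear N" and X: "bounded_clinear X"
    "\<And>x. X (N x) = N (X x)" "\<And>x. X (adjoint N x) = adjoint N (X x)"
    and T: "T \<in> vN_generated N"
  shows "T (X x) = X (T x)"
proof -
  define \<S> where "\<S> = {X. bounded_clinear X \<and> (\<forall>x. X (N x) = N (X x)) \<and>
    (\<forall>x. X (adjoint N x) = adjoint N (X x))}"
  have comm: "adjoint X (A x) = A (adjoint X x)"
    if X: "bounded_clinear X" and A: "bounded_clinear A" and XA: "\<And>x. X (adjoint A x) = adjoint A (X x)"
    for X A :: "'a \<Rightarrow> 'a" and x
  proof (rule cinner_ext)
    fix w
    have "cinner w (adjoint X (A x)) = cinner (adjoint A (X w)) x"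
      by (simp add: adjoint_eq[OF X, symmetric] adjoint_eq'[OF A])
    also have "\<dots> = cinner w (A (adjoint X x))"
      by (simp add: XA[symmetric] adjoint_eq[OF X] adjoint_eq'[OF A])
    finally show "cinner w (adjoint X (A x)) = cinner w (A (adjoint X x))" .
  qed
  have "adjoint X \<in> \<S>" if "X \<in> \<S>" for X
    using that N bounded_clinear_adjoint[of X] comm[of X N] comm[of X "adjoint N"]
    by (simp add: \<S>_def adjoint_adjoint bounded_clinear_adjoint)
  then have "von_neumann_algebra (commutant \<S>)"
    by (intro von_neumann_algebra_commutant) (auto simp: \<S>_def)
  moreover have "N \<in> commutant \<S>" using N by (simp add: commutant_def \<S>_def)
  ultimately have "T \<in> commutant \<S>" using T by (auto simp: vN_generated_def)
  then show ?thesis using X by (simp add: commutant_def \<S>_def)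
qed

section \<open>Polynomials of a normal operator\<close>

text \<open>\<open>npoly N f T\<close> says that \<open>f\<close> is a polynomial in \<open>z\<close> and its conjugate, and that \<open>T\<close>
  arises from \<open>f\<close> by substituting \<open>N\<close> and its adjoint. That \<open>T\<close> depends only on the values
  of \<open>f\<close> is not assumed; it follows from \<open>npoly_norm_bound\<close>.\<close>

inductive npoly :: "('a::chilbert_space \<Rightarrow> 'a) \<Rightarrow> (complex \<Rightarrow> complex) \<Rightarrow> ('a \<Rightarrow> 'a) \<Rightarrow> bool"
  for N where
  const: "npoly N (\<lambda>z. c) (\<lambda>x. c *\<^sub>C x)"
| ident: "npoly N (\<lambda>z. z) N"
| conj: "npoly N cnj (adjoint N)"
| add: "npoly N f S \<Longrightarrow> npoly N g T \<Longrightarrow> npoly N (\<lambda>z. f z + g z) (\<lambda>x. S x + T x)"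
| mult: "npoly N f S \<Longrightarrow> npoly N g T \<Longrightarrow> npoly N (\<lambda>z. f z * g z) (\<lambda>x. S (T x))"

lemma normal_op_bounded: "normal_op N \<Longrightarrow> bounded_clinear N"
  by (simp add: normal_op_def)

lemma normal_op_commute: "normal_op N \<Longrightarrow> N (adjoint N x) = adjoint N (N x)"
  by (simp add: normal_op_def fun_eq_iff)

lemma npoly_bounded:
  assumes "bounded_clinear N" "npoly N f S"
  shows "bounded_clinear S"
  using assms(2)
  by induction (auto simp: assms(1) bounded_clinear_scaleC_op bounded_clinear_adjoint
      bounded_clinear_plus bounded_clinear_compose)

lemma npoly_continuous: "npoly N f S \<Longrightarrow> continuous_on UNIV f"
  by (induction rule: npoly.induct) (auto intro!: continuous_intros)

lemma npoly_commute:
  assumes "npoly N f S" and X: "bounded_clinear X"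
    "\<And>x. X (N x) = N (X x)" "\<And>x. X (adjoint N x) = adjoint N (X x)"
  shows "X (S x) = S (X x)"
  using assms(1)
  by (induction arbitrary: x) (auto simp: X bounded_clinear_add bounded_clinear_scaleC)

lemma npoly_commute_npoly:
  assumes N: "normal_op N" and S: "npoly N f S" and T: "npoly N g T"
  shows "S (T x) = T (S x)"
proof -
  note b = normal_op_bounded[OF N]
  have "N (T x) = T (N x)" for x
    by (rule npoly_commute[OF T b]) (auto simp: normal_op_commute[OF N])
  moreover have "adjoint N (T x) = T (adjoint N x)" for x
    by (rule npoly_commute[OF T bounded_clinear_adjoint[OF b]]) (auto simp: normal_op_commute[OF N])
  ultimately show ?thesis
    by (intro npoly_commute[OF S npoly_bounded[OF b T], symmetric]) auto
qed

lemma npoly_adjoint: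
  assumes N: "bounded_clinear N" and S: "npoly N f S"
  shows "npoly N (\<lambda>z. cnj (f z)) (adjoint S)"
  using S
proof induction
  case (const c)
  have "adjoint (\<lambda>x::'a. c *\<^sub>C x) = (\<lambda>x. cnj c *\<^sub>C x)"
    by (rule adjoint_unique) (auto simp: bounded_clinear_scaleC_op cinner_scaleC_left cinner_scaleC_right)
  then show ?case using npoly.const[of N "cnj c"] by simp
next
  case ident
  show ?case by (simp add: npoly.conj)
next
  case conj
  show ?case using npoly.ident by (simp add: adjoint_adjoint[OF N])
next
  case (add f S g T)
  note b = npoly_bounded[OF N add.hyps(1)] npoly_bounded[OF N add.hyps(2)]
  have "adjoint (\<lambda>x. S x + T x) = (\<lambda>x. adjoint S x + adjoint T x)"
    by (rule adjoint_unique)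
       (auto simp: b bounded_clinear_plus cinner_add_left cinner_add_right adjoint_eq)
  then show ?case using npoly.add[OF add.IH] by simp
next
  case (mult f S g T)
  note b = npoly_bounded[OF N mult.hyps(1)] npoly_bounded[OF N mult.hyps(2)]
  have "adjoint (\<lambda>x. S (T x)) = (\<lambda>x. adjoint T (adjoint S x))"
    by (rule adjoint_unique) (auto simp: b bounded_clinear_compose adjoint_eq)
  then show ?case using npoly.mult[OF mult.IH(2,1)] by (simp add: mult.commute)
qed

lemma npoly_in_von_neumann_algebra:
  assumes A: "von_neumann_algebra A" "N \<in> A" and S: "npoly N f S"
  shows "S \<in> A"
  using S
proof induction
  case (const c)
  have "(\<lambda>x. c *\<^sub>C id x) \<in> A" using A(1) unfolding von_neumann_algebra_def by blast
  then show ?case by simp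
next
  case (mult f S g T)
  then have "S \<circ> T \<in> A" using A(1) unfolding von_neumann_algebra_def by blast
  then show ?case by (simp add: o_def)
qed (use A in \<open>auto simp: von_neumann_algebra_def\<close>)

lemma npoly_diff:
  assumes "npoly N f S" "npoly N g T"
  shows "npoly N (\<lambda>z. f z - g z) (\<lambda>x. S x - T x)"
  using npoly.add[OF assms(1) npoly.mult[OF npoly.const[of N "-1"] assms(2)]]
  by (simp add: scaleC_minus1)

subsection \<open>Joint approximate eigenvectors\<close>

text \<open>The eigenvalue is the limit, as \<open>q\<close> tends to 0, of the supremum \<open>\<alpha>\<close> of the numerical range
  over unit vectors with small \<open>q\<close>. There \<open>\<alpha> - A\<close> is almost positive, and testing positivity
  at \<open>x - t (\<alpha> - A) x\<close> bounds the norm of \<open>(\<alpha> - A) x\<close> by its quadratic form.\<close>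

lemma approx_eigenvector_exists:
  fixes A :: "'a::chilbert_space \<Rightarrow> 'a" and q :: "'a \<Rightarrow> real"
  assumes A: "bounded_clinear A" and sa: "\<And>x y. cinner (A x) y = cinner x (A y)"
    and q0: "\<And>x. 0 \<le> q x" and q_add: "\<And>x y. q (x + y) \<le> q x + q y"
    and q_scale: "\<And>c x. q (c *\<^sub>C x) = cmod c * q x" and qA: "\<And>x. q (A x) \<le> K * q x"
    and ex: "\<And>e. e > 0 \<Longrightarrow> \<exists>x. norm x = 1 \<and> q x \<le> e"
  shows "\<exists>s::real. (\<forall>e>0. \<exists>x. norm x = 1 \<and> q x \<le> e \<and> norm (A x - of_real s *\<^sub>C x) \<le> e) \<and>
    (\<forall>x. norm x = 1 \<and> q x = 0 \<longrightarrow> Re (cinner (A x) x) \<le> s)"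
proof -
  obtain B where B: "B > 0" "\<And>x. norm (A x) \<le> B * norm x"
    using bounded_clinear_bound[OF A] by blast
  define a where "a x = Re (cinner (A x) x)" for x
  have abound: "\<bar>a x\<bar> \<le> B" if "norm x = 1" for x
  proof -
    have "\<bar>a x\<bar> \<le> cmod (cinner (A x) x)" by (simp add: a_def abs_Re_le_cmod)
    also have "\<dots> \<le> norm (A x) * norm x" by (rule cinner_Cauchy_Schwarz)
    finally show ?thesis using B(2)[of x] that by simp
  qed
  define Q where "Q e = a ` {x. norm x = 1 \<and> q x \<le> e}" for e
  have Qne: "Q e \<noteq> {}" if "e > 0" for e using ex[OF that] by (auto simp: Q_def)
  have Qbdd: "bdd_above (Q e)" for e
    using abound by (intro bdd_aboveI[of _ B]) (force simp: Q_def)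
  define \<alpha> where "\<alpha> = Inf ((\<lambda>e. Sup (Q e)) ` {0<..})"
  have gbdd: "bdd_below ((\<lambda>e. Sup (Q e)) ` {0<..})"
  proof (intro bdd_belowI2)
    fix e :: real assume e: "e \<in> {0<..}"
    then obtain x where x: "norm x = 1" "q x \<le> e" using ex by auto
    then have "a x \<le> Sup (Q e)" by (intro cSup_upper Qbdd) (auto simp: Q_def)
    then show "-B \<le> Sup (Q e)" using abound[OF x(1)] by simp
  qed
  have low: "\<exists>x. norm x = 1 \<and> q x \<le> e \<and> \<alpha> - d < a x" if "e > 0" "d > 0" for e d
  proof -
    have "\<alpha> \<le> Sup (Q e)" unfolding \<alpha>_def by (intro cInf_lower gbdd) (use that in auto)
    then have "\<alpha> - d < Sup (Q e)" using that by simp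
    then show ?thesis using less_cSup_iff[OF Qne[OF that(1)] Qbdd] by (auto simp: Q_def)
  qed
  have up: "\<exists>e>0. \<forall>x. norm x = 1 \<and> q x \<le> e \<longrightarrow> a x \<le> \<alpha> + d" if "d > 0" for d
  proof -
    have "\<alpha> < \<alpha> + d" using that by simp
    then obtain e where e: "e > 0" "Sup (Q e) < \<alpha> + d"
      using cInf_less_iff[OF _ gbdd, of "\<alpha> + d"] unfolding \<alpha>_def by auto
    show ?thesis
    proof (intro exI[of _ e] conjI allI impI)
      fix x assume "norm x = 1 \<and> q x \<le> e"
      then have "a x \<le> Sup (Q e)" by (intro cSup_upper Qbdd) (auto simp: Q_def)
      then show "a x \<le> \<alpha> + d" using e by simp
    qed (rule e)
  qed
  have main: "\<exists>x. norm x = 1 \<and> q x \<le> e \<and> norm (A x - of_real \<alpha> *\<^sub>C x) \<le> e" if e: "e > 0" for e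
  proof -
    define C where "C = \<bar>\<alpha>\<bar> + 1 + B"
    have C: "C \<ge> 1" using B by (simp add: C_def)
    \<comment> \<open>The last bound on \<open>d\<close> turns the final estimate
      \<open>(norm (P x))\<^sup>2 * 3 \<le> 8 * (d * C)\<close> into
      \<open>norm (P x) \<le> e / 2\<close>; the bound \<open>e / 2\<close> pays for replacing
      \<open>\<alpha> + d\<close> by \<open>\<alpha>\<close>; the bound 1 lets \<open>C\<close>
      dominate the norm of \<open>P\<close>.\<close>
    define d where "d = min 1 (min (e/2) (e\<^sup>2 / (16 * C)))"
    have d: "0 < d" "d \<le> 1" "d \<le> e/2" "d \<le> e\<^sup>2 / (16 * C)" using e C by (auto simp: d_def)
    define P where "P x = of_real (\<alpha> + d) *\<^sub>C x - A x" for x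
    have P_diff: "P (x - y) = P x - P y" for x y
      by (simp add: P_def bounded_clinear_diff[OF A] scaleC_diff_right)
    have P_scale: "P (c *\<^sub>C x) = c *\<^sub>C P x" for c x
      by (simp add: P_def bounded_clinear_scaleC[OF A] scaleC_diff_right scaleC_scaleC mult.commute)
    have P_sa: "cinner (P x) y = cinner x (P y)" for x y
      by (simp add: P_def cinner_diff_left cinner_diff_right cinner_scaleC_left cinner_scaleC_right sa)
    have P_norm: "norm (P x) \<le> C * norm x" for x
    proof -
      have "norm (P x) \<le> \<bar>\<alpha> + d\<bar> * norm x + B * norm x"
        unfolding P_def using norm_triangle_ineq4[of "of_real (\<alpha> + d) *\<^sub>C x" "A x"] B(2)[of x]
        by (simp add: norm_scaleC del: of_real_add)
      also have "\<dots> = (\<bar>\<alpha> + d\<bar> + B) * norm x" by (simp add: algebra_simps)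
      also have "\<dots> \<le> C * norm x" unfolding C_def using d by (intro mult_right_mono) auto
      finally show ?thesis .
    qed
    have P_form: "Re (cinner (P x) x) = (\<alpha> + d) * (norm x)\<^sup>2 - a x" for x
      by (simp add: P_def cinner_diff_left cinner_scaleC_left cinner_self a_def del: of_real_add of_real_power)
    \<comment> \<open>\<open>C\<close> bounds the norm of \<open>P\<close>, so
      \<open>t * C = 1/2\<close> keeps \<open>norm y\<close> at least 1/2 and makes the term
      quadratic in \<open>t\<close> at most a quarter of the linear term
      \<open>2 * t * (norm (P x))\<^sup>2\<close>.\<close>
    define t where "t = 1 / (2 * C)"
    have t: "t > 0" "t * C = 1/2" using C by (auto simp: t_def)
    \<comment> \<open>Passing from \<open>x\<close> to \<open>y\<close> multiplies \<open>q\<close>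
      by at most \<open>C'\<close>, so \<open>q x \<le> e0 / (2 * C')\<close> gives
      \<open>q y \<le> e0 / 2\<close>, which is at most \<open>e0 * norm y\<close>.\<close>
    define C' where "C' = 1 + t * (\<bar>\<alpha>\<bar> + 1 + \<bar>K\<bar>)"
    have C': "C' \<ge> 1" using t by (simp add: C'_def)
    obtain e0 where e0: "e0 > 0" "\<And>x. norm x = 1 \<Longrightarrow> q x \<le> e0 \<Longrightarrow> a x \<le> \<alpha> + d"
      using up[OF d(1)] by blast
    have "min e (e0 / (2 * C')) > 0" using e e0 C' by simp
    from low[OF this d(1)] obtain x where x: "norm x = 1" "q x \<le> e" "q x \<le> e0 / (2 * C')" "\<alpha> - d < a x"
      by auto
    define y where "y = x - of_real t *\<^sub>C P x"
    have ny: "norm y \<ge> 1/2"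
    proof -
      have "norm (of_real t *\<^sub>C P x) \<le> t * C" using P_norm[of x] x t by (simp add: norm_scaleC)
      then show ?thesis using norm_triangle_ineq2[of x "of_real t *\<^sub>C P x"] x t by (simp add: y_def)
    qed
    have q_minus: "q (- v) = q v" for v using q_scale[of "-1" v] by (simp add: scaleC_minus1)
    have qP: "q (P x) \<le> (\<bar>\<alpha>\<bar> + 1 + \<bar>K\<bar>) * q x"
    proof -
      have "q (P x) \<le> q (of_real (\<alpha> + d) *\<^sub>C x) + q (- A x)" unfolding P_def using q_add[of _ "- A x"] by simp
      also have "\<dots> \<le> \<bar>\<alpha> + d\<bar> * q x + K * q x" using qA by (simp add: q_scale q_minus del: of_real_add)
      also have "\<dots> = (\<bar>\<alpha> + d\<bar> + K) * q x" by (simp add: algebra_simps)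
      also have "\<dots> \<le> (\<bar>\<alpha>\<bar> + 1 + \<bar>K\<bar>) * q x" using d q0 by (intro mult_right_mono) auto
      finally show ?thesis .
    qed
    have qy: "q y \<le> e0 * norm y"
    proof -
      have "q y \<le> q x + q (- (of_real t *\<^sub>C P x))" unfolding y_def using q_add[of x] by (metis diff_conv_add_uminus)
      also have "\<dots> = q x + t * q (P x)" using t by (simp add: q_minus q_scale)
      also have "\<dots> \<le> q x + t * ((\<bar>\<alpha>\<bar> + 1 + \<bar>K\<bar>) * q x)" using qP t by simp
      also have "\<dots> = C' * q x" by (simp add: C'_def algebra_simps)
      also have "\<dots> \<le> C' * (e0 / (2 * C'))" using x C' by (intro mult_left_mono) auto
      also have "\<dots> = e0 * (1/2)" using C' by simp
      also have "\<dots> \<le> e0 * norm y" using e0 ny by (intro mult_left_mono) auto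
      finally show ?thesis .
    qed
    have "Re (cinner (P y) y) \<ge> 0"
    proof -
      define c where "c = complex_of_real (1 / norm y)"
      have ny0: "norm y > 0" using ny by linarith
      have "norm (c *\<^sub>C y) = 1" using ny0 by (simp add: c_def norm_scaleC norm_divide)
      moreover have "q (c *\<^sub>C y) \<le> e0" using ny0 qy by (simp add: c_def q_scale norm_divide field_simps)
      ultimately have "a (c *\<^sub>C y) \<le> \<alpha> + d" by (rule e0)
      moreover have "a (c *\<^sub>C y) = (1 / norm y)\<^sup>2 * a y"
        by (simp add: a_def bounded_clinear_scaleC[OF A] cinner_scaleC_left cinner_scaleC_right c_def power2_eq_square)
      ultimately show ?thesis using ny0 unfolding P_form by (simp add: field_simps power2_eq_square)
    qed
    also have "cinner (P y) y = cinner (P x) x - 2 * of_real t * cinner (P x) (P x)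
        + (of_real t)\<^sup>2 * cinner (P (P x)) (P x)"
      by (simp add: y_def P_diff P_scale cinner_diff_left cinner_diff_right cinner_scaleC_left
          cinner_scaleC_right P_sa power2_eq_square algebra_simps)
    finally have "0 \<le> Re (cinner (P x) x) - 2 * t * (norm (P x))\<^sup>2 + t\<^sup>2 * Re (cinner (P (P x)) (P x))"
      by (simp add: cinner_self power2_eq_square)
    moreover have "Re (cinner (P (P x)) (P x)) \<le> C * (norm (P x))\<^sup>2"
    proof -
      have "Re (cinner (P (P x)) (P x)) \<le> norm (P (P x)) * norm (P x)"
        using complex_Re_le_cmod cinner_Cauchy_Schwarz by (rule order_trans)
      also have "\<dots> \<le> C * norm (P x) * norm (P x)" by (intro mult_right_mono P_norm) auto
      finally show ?thesis by (simp add: power2_eq_square mult.assoc)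
    qed
    moreover have "Re (cinner (P x) x) \<le> 2 * d" using x by (simp add: P_form)
    moreover from calculation(2)
    have "t\<^sup>2 * Re (cinner (P (P x)) (P x)) \<le> t\<^sup>2 * (C * (norm (P x))\<^sup>2)"
      by (intro mult_left_mono) auto
    ultimately have "0 \<le> 2 * d - 2 * t * (norm (P x))\<^sup>2 + t\<^sup>2 * (C * (norm (P x))\<^sup>2)"
      by linarith
    also have "t\<^sup>2 * (C * (norm (P x))\<^sup>2) = (t * C) * t * (norm (P x))\<^sup>2" by (simp add: power2_eq_square)
    also have "\<dots> = t * (norm (P x))\<^sup>2 / 2" by (simp add: t)
    finally have "3 * t * (norm (P x))\<^sup>2 \<le> 4 * d" by simp
    then have "3 * (t * C) * (norm (P x))\<^sup>2 \<le> 4 * (d * C)"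
      using C mult_left_mono[of "3 * t * (norm (P x))\<^sup>2" "4*d" C] by (simp add: algebra_simps)
    then have "(norm (P x))\<^sup>2 * 3 \<le> 8 * (d * C)" unfolding t(2) by linarith
    moreover have "d * C \<le> e\<^sup>2 / 16"
      using mult_right_mono[OF d(4), of C] C by simp
    moreover have "(e/2)\<^sup>2 = e\<^sup>2 / 4" by (simp add: power_divide)
    ultimately have "(norm (P x))\<^sup>2 \<le> (e/2)\<^sup>2"
      using zero_le_power2[of e] by linarith
    then have "norm (P x) \<le> e / 2" by (rule power2_le_imp_le) (use e in simp)
    moreover have "norm (A x - of_real \<alpha> *\<^sub>C x) \<le> norm (P x) + d"
    proof -
      have "A x - of_real \<alpha> *\<^sub>C x = of_real d *\<^sub>C x - P x"
        by (simp add: P_def scaleC_add_left algebra_simps)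
      then show ?thesis using norm_triangle_ineq4[of "of_real d *\<^sub>C x" "P x"] d x by (simp add: norm_scaleC)
    qed
    ultimately have "norm (A x - of_real \<alpha> *\<^sub>C x) \<le> e" using d by simp
    then show ?thesis using x by blast
  qed
  have "Re (cinner (A x) x) \<le> \<alpha>" if "norm x = 1" "q x = 0" for x
  proof (rule field_le_epsilon)
    fix d :: real assume "d > 0"
    from up[OF this] that show "Re (cinner (A x) x) \<le> \<alpha> + d" unfolding a_def by force
  qed
  with main show ?thesis by blast
qed

text \<open>Errors accumulate with constants that depend on \<open>f\<close> and \<open>l\<close>
  but not on \<open>x\<close>. For a product the error splits into \<open>S\<close> applied to the
  error of \<open>T\<close>, where \<open>S\<close> is bounded, and \<open>g l\<close> times the
  error of \<open>S\<close>.\<close>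

lemma npoly_approx_eigenvector:
  assumes N: "bounded_clinear N" and f: "npoly N f S"
  shows "\<exists>C\<ge>0. \<forall>x. norm (S x - f l *\<^sub>C x)
    \<le> C * (norm (N x - l *\<^sub>C x) + norm (adjoint N x - cnj l *\<^sub>C x))"
  using f
proof induction
  case (const c)
  show ?case by (rule exI[of _ 0]) simp
next
  case ident
  show ?case by (rule exI[of _ 1]) simp
next
  case conj
  show ?case by (rule exI[of _ 1]) simp
next
  case (add f S g T)
  define r where "r x = norm (N x - l *\<^sub>C x) + norm (adjoint N x - cnj l *\<^sub>C x)" for x
  obtain C D where C: "C \<ge> 0" "\<And>x. norm (S x - f l *\<^sub>C x) \<le> C * r x"
    and D: "D \<ge> 0" "\<And>x. norm (T x - g l *\<^sub>C x) \<le> D * r x" using add.IH unfolding r_def by blast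
  have "norm (S x + T x - (f l + g l) *\<^sub>C x) \<le> (C + D) * r x" for x
  proof -
    have "norm (S x + T x - (f l + g l) *\<^sub>C x) = norm ((S x - f l *\<^sub>C x) + (T x - g l *\<^sub>C x))"
      by (simp add: scaleC_add_left algebra_simps)
    also have "\<dots> \<le> norm (S x - f l *\<^sub>C x) + norm (T x - g l *\<^sub>C x)" by (rule norm_triangle_ineq)
    also have "\<dots> \<le> C * r x + D * r x" by (intro add_mono C D)
    finally show ?thesis by (simp add: distrib_right)
  qed
  then show ?case using C D unfolding r_def by (intro exI[of _ "C + D"]) auto
next
  case (mult f S g T)
  define r where "r x = norm (N x - l *\<^sub>C x) + norm (adjoint N x - cnj l *\<^sub>C x)" for x
  obtain C D where C: "C \<ge> 0" "\<And>x. norm (S x - f l *\<^sub>C x) \<le> C * r x"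
    and D: "D \<ge> 0" "\<And>x. norm (T x - g l *\<^sub>C x) \<le> D * r x" using mult.IH unfolding r_def by blast
  note bS = npoly_bounded[OF N mult.hyps(1)]
  obtain K where K: "K > 0" "\<And>x. norm (S x) \<le> K * norm x" using bounded_clinear_bound[OF bS] by blast
  have "norm (S (T x) - (f l * g l) *\<^sub>C x) \<le> (K * D + cmod (g l) * C) * r x" for x
  proof -
    have "S (T x) - (f l * g l) *\<^sub>C x = S (T x - g l *\<^sub>C x) + g l *\<^sub>C (S x - f l *\<^sub>C x)"
      by (simp add: bounded_clinear_diff[OF bS] bounded_clinear_scaleC[OF bS] scaleC_diff_right
          scaleC_scaleC mult.commute)
    then have "norm (S (T x) - (f l * g l) *\<^sub>C x)
        \<le> norm (S (T x - g l *\<^sub>C x)) + cmod (g l) * norm (S x - f l *\<^sub>C x)"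
      using norm_triangle_ineq[of "S (T x - g l *\<^sub>C x)" "g l *\<^sub>C (S x - f l *\<^sub>C x)"] by (simp add: norm_scaleC)
    also have "\<dots> \<le> K * (D * r x) + cmod (g l) * (C * r x)"
      using K D(2)[of x] C(2)[of x] order_trans[OF K(2)[of "T x - g l *\<^sub>C x"]]
      by (intro add_mono mult_left_mono) auto
    finally show ?thesis by (simp add: algebra_simps)
  qed
  then show ?case using C D K unfolding r_def by (intro exI[of _ "K * D + cmod (g l) * C"]) auto
qed

lemma seminorm_norm_op:
  assumes "bounded_clinear D"
  shows "norm (D (x + y)) \<le> norm (D x) + norm (D y)" "norm (D (c *\<^sub>C x)) = cmod c * norm (D x)"
  by (auto simp: bounded_clinear_add[OF assms] bounded_clinear_scaleC[OF assms] norm_scaleC norm_triangle_ineq)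

text \<open>Numerical ranges replace spectral theory here. If the bound failed, an upper bound
  \<open>s\<close> for the form of \<open>H\<close> with approximate eigenvectors would exceed
  \<open>M\<^sup>2\<close>. These vectors are refined to approximate eigenvectors of the real and
  then of the imaginary part of \<open>N\<close>, the earlier errors being measured by the seminorm
  \<open>q\<close>. The result is a point \<open>l\<close> of the disc at which the squared modulus
  of \<open>f\<close> is at least \<open>s\<close>, a contradiction.\<close>

lemma npoly_norm_bound:
  assumes N: "normal_op N" and R: "\<And>x. norm (N x) \<le> R * norm x"
    and f: "npoly N f S" and M: "\<And>z. z \<in> cball 0 R \<Longrightarrow> cmod (f z) \<le> M"
  shows "norm (S x) \<le> M * norm x"
proof (rule ccontr)
  assume contra: "\<not> ?thesis"
  note b = normal_op_bounded[OF N]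
  note bS = npoly_bounded[OF b f]
  have x0: "x \<noteq> 0" using contra bounded_clinear_zero[OF bS] by auto
  have R0: "R \<ge> 0" using R[of x] x0 by (smt (verit) norm_ge_zero zero_less_norm_iff mult_less_0_iff)
  have M0: "M \<ge> 0" using order_trans[OF norm_ge_zero M[of 0]] R0 by simp
  define H where "H x = adjoint S (S x)" for x
  have H: "npoly N (\<lambda>z. cnj (f z) * f z) H"
    unfolding H_def by (rule npoly.mult[OF npoly_adjoint[OF b f] f])
  define A where "A x = (1/2) *\<^sub>C (N x + adjoint N x)" for x
  define B where "B x = (-\<i>/2) *\<^sub>C (N x - adjoint N x)" for x
  have A: "npoly N (\<lambda>z. (1/2) * (z + cnj z)) A"
    unfolding A_def by (intro npoly.mult npoly.const npoly.add npoly.ident npoly.conj)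
  have B: "npoly N (\<lambda>z. (-\<i>/2) * (z - cnj z)) B"
    unfolding B_def by (intro npoly.mult npoly.const npoly_diff npoly.ident npoly.conj)
  have Hsa: "cinner (H x) y = cinner x (H y)" for x y
    by (simp add: H_def adjoint_eq'[OF bS] adjoint_eq[OF bS])
  have Asa: "cinner (A x) y = cinner x (A y)" for x y
    by (simp add: A_def cinner_scaleC_left cinner_scaleC_right cinner_add_left cinner_add_right
        adjoint_eq[OF b] adjoint_eq'[OF b])
  have Bsa: "cinner (B x) y = cinner x (B y)" for x y
    by (simp add: B_def cinner_scaleC_left cinner_scaleC_right cinner_diff_left cinner_diff_right
        adjoint_eq[OF b] adjoint_eq'[OF b] algebra_simps)
  note bd = npoly_bounded[OF b H] npoly_bounded[OF b A] npoly_bounded[OF b B]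
  define u where "u = complex_of_real (1 / norm x) *\<^sub>C x"
  have u: "norm u = 1" using x0 by (simp add: u_def norm_scaleC norm_divide)
  have Su: "norm (S u) > M"
    using contra x0 by (simp add: u_def bounded_clinear_scaleC[OF bS] norm_scaleC norm_divide field_simps)
  have "\<exists>s. (\<forall>e>0. \<exists>x. norm x = 1 \<and> (0::real) \<le> e \<and> norm (H x - of_real s *\<^sub>C x) \<le> e) \<and>
      (\<forall>x. norm x = 1 \<and> (0::real) = 0 \<longrightarrow> Re (cinner (H x) x) \<le> s)"
    by (rule approx_eigenvector_exists[where q="\<lambda>_. 0" and K=0]) (use Hsa bd u in auto)
  then obtain s where s: "\<And>e. e > 0 \<Longrightarrow> \<exists>x. norm x = 1 \<and> norm (H x - of_real s *\<^sub>C x) \<le> e"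
    "Re (cinner (H u) u) \<le> s" using u by auto
  have "M\<^sup>2 < (norm (S u))\<^sup>2" using Su M0 by (simp add: power_strict_mono)
  also have "\<dots> \<le> s" using s(2) by (simp add: H_def adjoint_eq'[OF bS] norm_sq_cinner)
  finally have Ms: "M\<^sup>2 < s" .
  define D1 where "D1 x = H x - of_real s *\<^sub>C x" for x
  have D1: "npoly N (\<lambda>z. cnj (f z) * f z - of_real s) D1"
    unfolding D1_def by (intro npoly_diff H npoly.const)
  obtain KA where KA: "\<And>x. norm (A x) \<le> KA * norm x" using bounded_clinear_bound[OF bd(2)] by blast
  \<comment> \<open>The error of the first stage becomes the seminorm. Polynomials of
    \<open>N\<close> commute, so \<open>A\<close> enlarges this seminorm by at most the factor
    \<open>KA\<close>; the next stage repeats this with the sum of two errors.\<close>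
  have "\<exists>s2. (\<forall>e>0. \<exists>x. norm x = 1 \<and> norm (D1 x) \<le> e \<and> norm (A x - of_real s2 *\<^sub>C x) \<le> e) \<and>
      (\<forall>x. norm x = 1 \<and> norm (D1 x) = 0 \<longrightarrow> Re (cinner (A x) x) \<le> s2)"
  proof (rule approx_eigenvector_exists[where q="\<lambda>x. norm (D1 x)" and K=KA])
    show "norm (D1 (A x)) \<le> KA * norm (D1 x)" for x
      using KA[of "D1 x"] by (simp add: npoly_commute_npoly[OF N D1 A])
    show "\<And>e. 0 < e \<Longrightarrow> \<exists>x. norm x = 1 \<and> norm (D1 x) \<le> e" using s(1) by (simp add: D1_def)
  qed (use Asa bd seminorm_norm_op[OF npoly_bounded[OF b D1]] in auto)
  then obtain s2 where s2: "\<And>e. e > 0 \<Longrightarrow> \<exists>x. norm x = 1 \<and> norm (D1 x) \<le> e \<and> norm (A x - of_real s2 *\<^sub>C x) \<le> e"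
    by blast
  define D2 where "D2 x = A x - of_real s2 *\<^sub>C x" for x
  have D2: "npoly N (\<lambda>z. (1/2) * (z + cnj z) - of_real s2) D2"
    unfolding D2_def by (intro npoly_diff A npoly.const)
  obtain KB where KB: "\<And>x. norm (B x) \<le> KB * norm x" using bounded_clinear_bound[OF bd(3)] by blast
  note sn = seminorm_norm_op[OF npoly_bounded[OF b D1]] seminorm_norm_op[OF npoly_bounded[OF b D2]]
  have "\<exists>s3. (\<forall>e>0. \<exists>x. norm x = 1 \<and> norm (D1 x) + norm (D2 x) \<le> e \<and> norm (B x - of_real s3 *\<^sub>C x) \<le> e) \<and>
      (\<forall>x. norm x = 1 \<and> norm (D1 x) + norm (D2 x) = 0 \<longrightarrow> Re (cinner (B x) x) \<le> s3)"
  proof (rule approx_eigenvector_exists[where q="\<lambda>x. norm (D1 x) + norm (D2 x)" and K=KB])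
    show "norm (D1 (B x)) + norm (D2 (B x)) \<le> KB * (norm (D1 x) + norm (D2 x))" for x
      using KB[of "D1 x"] KB[of "D2 x"]
      by (simp add: npoly_commute_npoly[OF N D1 B] npoly_commute_npoly[OF N D2 B] distrib_left)
    show "\<exists>x. norm x = 1 \<and> norm (D1 x) + norm (D2 x) \<le> e" if "0 < e" for e
      using s2[of "e/2"] that unfolding D2_def by force
    show "norm (D1 (x + y)) + norm (D2 (x + y)) \<le> norm (D1 x) + norm (D2 x) + (norm (D1 y) + norm (D2 y))" for x y
      using sn(1)[of x y] sn(3)[of x y] by simp
  qed (use Bsa bd sn in \<open>auto simp: distrib_left\<close>)
  then obtain s3 where s3: "\<And>e. e > 0 \<Longrightarrow> \<exists>x. norm x = 1 \<and> norm (D1 x) + norm (D2 x) \<le> e \<and> norm (B x - of_real s3 *\<^sub>C x) \<le> e"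
    by blast
  define l where "l = of_real s2 + \<i> * of_real s3"
  have Nl: "N x - l *\<^sub>C x = (A x - of_real s2 *\<^sub>C x) + \<i> *\<^sub>C (B x - of_real s3 *\<^sub>C x)" for x
    by (simp add: A_def B_def l_def scaleC_add_right scaleC_diff_right scaleC_scaleC scaleC_add_left)
       (simp add: scaleC_add_left[symmetric] flip: add.assoc)
  have Nl': "adjoint N x - cnj l *\<^sub>C x = (A x - of_real s2 *\<^sub>C x) - \<i> *\<^sub>C (B x - of_real s3 *\<^sub>C x)" for x
    by (simp add: A_def B_def l_def scaleC_add_right scaleC_diff_right scaleC_scaleC scaleC_add_left scaleC_diff_left)
       (simp add: scaleC_add_left[symmetric] scaleC_minus_left flip: add.assoc)
  have approx: "\<exists>x. norm x = 1 \<and> norm (H x - of_real s *\<^sub>C x) \<le> e \<and> norm (N x - l *\<^sub>C x) \<le> 2 * e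
      \<and> norm (adjoint N x - cnj l *\<^sub>C x) \<le> 2 * e" if e: "e > 0" for e
  proof -
    obtain x where x: "norm x = 1" "norm (D1 x) + norm (D2 x) \<le> e" "norm (B x - of_real s3 *\<^sub>C x) \<le> e"
      using s3[OF e] by blast
    have "norm (N x - l *\<^sub>C x) \<le> norm (D2 x) + norm (B x - of_real s3 *\<^sub>C x)"
      using norm_triangle_ineq[of "D2 x" "\<i> *\<^sub>C (B x - of_real s3 *\<^sub>C x)"] by (simp add: Nl D2_def norm_scaleC)
    moreover have "norm (adjoint N x - cnj l *\<^sub>C x) \<le> norm (D2 x) + norm (B x - of_real s3 *\<^sub>C x)"
      using norm_triangle_ineq4[of "D2 x" "\<i> *\<^sub>C (B x - of_real s3 *\<^sub>C x)"] by (simp add: Nl' D2_def norm_scaleC)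
    moreover have "norm (D1 x) \<le> e" "norm (D2 x) \<le> e"
      using x(2) norm_ge_zero[of "D1 x"] norm_ge_zero[of "D2 x"] by linarith+
    ultimately show ?thesis using x by (intro exI[of _ x]) (simp add: D1_def)
  qed
  have lR: "cmod l \<le> R"
  proof (rule field_le_epsilon)
    fix e :: real assume "e > 0"
    then have "e/2 > 0" by simp
    from approx[OF this] obtain x where x: "norm x = 1" "norm (N x - l *\<^sub>C x) \<le> e" by auto
    have "cmod l = norm (l *\<^sub>C x)" using x by (simp add: norm_scaleC)
    also have "\<dots> \<le> norm (N x) + norm (N x - l *\<^sub>C x)"
      using norm_triangle_ineq4[of "N x" "N x - l *\<^sub>C x"] by simp
    finally show "cmod l \<le> R + e" using x R[of x] by simp
  qed
  obtain C where C: "C \<ge> 0" "\<And>x. norm (H x - (cnj (f l) * f l) *\<^sub>C x)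
      \<le> C * (norm (N x - l *\<^sub>C x) + norm (adjoint N x - cnj l *\<^sub>C x))"
    using npoly_approx_eigenvector[OF b H, of l] by blast
  have "s - (cmod (f l))\<^sup>2 \<le> 0"
  proof (rule field_le_epsilon)
    fix e :: real assume e: "e > 0"
    define e' where "e' = e / (1 + 4 * C)"
    have e': "e' > 0" using e C by (simp add: e'_def)
    from approx[OF this] obtain x where x: "norm x = 1" "norm (H x - of_real s *\<^sub>C x) \<le> e'"
      "norm (N x - l *\<^sub>C x) \<le> 2 * e'" "norm (adjoint N x - cnj l *\<^sub>C x) \<le> 2 * e'" by blast
    have fl: "cnj (f l) * f l = of_real ((cmod (f l))\<^sup>2)"
      using complex_norm_square[of "f l"] by (simp add: mult.commute)
    have "\<bar>s - (cmod (f l))\<^sup>2\<bar> = norm (of_real (s - (cmod (f l))\<^sup>2) *\<^sub>C x)"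
      using x by (simp add: norm_scaleC del: of_real_diff)
    also have "of_real (s - (cmod (f l))\<^sup>2) *\<^sub>C x = (H x - (cnj (f l) * f l) *\<^sub>C x) - (H x - of_real s *\<^sub>C x)"
      unfolding fl by (simp add: scaleC_diff_left)
    also have "norm \<dots> \<le> norm (H x - (cnj (f l) * f l) *\<^sub>C x) + norm (H x - of_real s *\<^sub>C x)"
      by (rule norm_triangle_ineq4)
    also have "\<dots> \<le> C * (norm (N x - l *\<^sub>C x) + norm (adjoint N x - cnj l *\<^sub>C x)) + e'"
      by (rule add_mono[OF C(2) x(2)])
    also have "\<dots> \<le> C * (4 * e') + e'" using x C by (intro add_mono mult_left_mono) auto
    also have "\<dots> = e' * (1 + 4 * C)" by (simp add: algebra_simps)
    also have "\<dots> = e" using C by (simp add: e'_def)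
    finally show "s - (cmod (f l))\<^sup>2 \<le> 0 + e" by simp
  qed
  moreover have "(cmod (f l))\<^sup>2 \<le> M\<^sup>2" using M[of l] lR by (intro power_mono) auto
  ultimately show False using Ms by simp
qed

text \<open>A norm estimate becomes a form estimate after a shift: if \<open>p\<close> is bounded by
  \<open>M\<close>, then \<open>M - p\<close> lies between 0 and \<open>M - c\<close> on the disc,
  so the form of \<open>M - S\<close> is at most \<open>(M - c) * (norm x)\<^sup>2\<close>.\<close>

lemma npoly_form_lower_bound:
  assumes N: "normal_op N" and R: "\<And>x. norm (N x) \<le> R * norm x"
    and S: "npoly N (\<lambda>z. of_real (p z)) S" and c: "\<And>z. z \<in> cball 0 R \<Longrightarrow> c \<le> p z"
  shows "c * (norm x)\<^sup>2 \<le> Re (cinner (S x) x)"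
proof -
  have "continuous_on UNIV (\<lambda>z. Re (complex_of_real (p z)))"
    by (intro continuous_intros npoly_continuous[OF S])
  then have "continuous_on (cball 0 R) p" using continuous_on_subset[of UNIV p] by simp
  then have "bounded (p ` cball 0 R)"
    by (intro compact_imp_bounded compact_continuous_image compact_cball)
  then obtain M where "\<forall>y\<in>p ` cball 0 R. norm y \<le> M" unfolding bounded_iff by blast
  then have M: "\<bar>p z\<bar> \<le> M" if "z \<in> cball 0 R" for z :: complex using that by fastforce
  define T where "T x = of_real M *\<^sub>C x - S x" for x
  have T: "npoly N (\<lambda>z. of_real M - of_real (p z)) T"
    unfolding T_def by (intro npoly_diff npoly.const S)
  have "norm (T x) \<le> (M - c) * norm x"
  proof (rule npoly_norm_bound[OF N R T])
    fix z :: complex assume z: "z \<in> cball 0 R"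
    have "cmod (of_real M - of_real (p z)) = \<bar>M - p z\<bar>" by (metis norm_of_real of_real_diff)
    then show "cmod (of_real M - of_real (p z)) \<le> M - c" using M[OF z] c[OF z] by auto
  qed
  then have "norm (T x) * norm x \<le> (M - c) * norm x * norm x" by (intro mult_right_mono) auto
  moreover have "Re (cinner (T x) x) \<le> norm (T x) * norm x"
    using complex_Re_le_cmod cinner_Cauchy_Schwarz by (rule order_trans)
  moreover have "Re (cinner (T x) x) = M * (norm x)\<^sup>2 - Re (cinner (S x) x)"
    by (simp add: T_def cinner_diff_left cinner_scaleC_left cinner_self del: of_real_power)
  ultimately show ?thesis by (simp add: power2_eq_square algebra_simps)
qed

section \<open>Positive functionals and measures\<close>

text \<open>The functions live on the whole space while positivity is tested on \<open>S\<close>, so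
  \<open>L\<close> depends only on values on \<open>S\<close>. The representing measure is likewise
  built on the whole space and turns out to vanish off \<open>S\<close>.\<close>

locale positive_functional =
  fixes S :: "'a::metric_space set" and L :: "('a \<Rightarrow> real) \<Rightarrow> real"
  assumes compact: "compact S"
    and add: "continuous_on UNIV f \<Longrightarrow> continuous_on UNIV g \<Longrightarrow> L (\<lambda>x. f x + g x) = L f + L g"
    and scale: "continuous_on UNIV f \<Longrightarrow> L (\<lambda>x. c * f x) = c * L f"
    and pos: "continuous_on UNIV f \<Longrightarrow> (\<And>x. x \<in> S \<Longrightarrow> 0 \<le> f x) \<Longrightarrow> 0 \<le> L f"
begin

lemma mono:
  assumes "continuous_on UNIV f" "continuous_on UNIV g" "\<And>x. x \<in> S \<Longrightarrow> f x \<le> g x"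
  shows "L f \<le> L g"
proof -
  have "0 \<le> L (\<lambda>x. g x + (-1) * f x)" using assms by (intro pos continuous_intros) auto
  also have "\<dots> = L g + L (\<lambda>x. (-1) * f x)" using assms by (intro add continuous_intros)
  also have "L (\<lambda>x. (-1) * f x) = (-1) * L f" by (rule scale) (rule assms)
  finally show ?thesis by simp
qed

lemma cong:
  assumes "continuous_on UNIV f" "continuous_on UNIV g" "\<And>x. x \<in> S \<Longrightarrow> f x = g x"
  shows "L f = L g"
  using mono[of f g] mono[of g f] assms by (simp add: antisym)

lemma zero: "L (\<lambda>x. 0) = 0"
  using scale[of "\<lambda>x. 0" 0] by simp

lemma sum:
  assumes "finite I" "\<And>i. i \<in> I \<Longrightarrow> continuous_on UNIV (f i)"
  shows "L (\<lambda>x. \<Sum>i\<in>I. f i x) = (\<Sum>i\<in>I. L (f i))"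
  using assms
proof (induction rule: finite_induct)
  case (insert i I)
  then show ?case by (simp add: add continuous_on_sum)
qed (simp add: zero)

lemma const: "L (\<lambda>x. c) = c * L (\<lambda>x. 1)"
  using scale[of "\<lambda>x. 1" c] by simp

lemma L1_nonneg: "0 \<le> L (\<lambda>x. 1)"
  by (rule pos) auto

text \<open>The outer measure of \<open>A\<close> is the Daniell upper integral of its indicator function: the
  infimum of \<open>sup\<^sub>n L (f n)\<close> over increasing sequences \<open>f\<close> whose limit is at least 1 on \<open>A\<close>.\<close>

definition covers :: "'a set \<Rightarrow> (nat \<Rightarrow> 'a \<Rightarrow> real) \<Rightarrow> bool" where
  "covers A f \<longleftrightarrow> (\<forall>n. continuous_on UNIV (f n)) \<and> (\<forall>n x. 0 \<le> f n x) \<and>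
     (\<forall>n x. f n x \<le> f (Suc n) x) \<and> (\<forall>x\<in>A \<inter> S. \<forall>c<1. \<exists>n. c < f n x)"

definition upper :: "(nat \<Rightarrow> 'a \<Rightarrow> real) \<Rightarrow> ennreal" where
  "upper f = (SUP n. ennreal (L (f n)))"

definition outer :: "'a set \<Rightarrow> ennreal" where
  "outer A = (INF f\<in>{f. covers A f}. upper f)"

lemma covers_mono: "covers A f \<Longrightarrow> m \<le> n \<Longrightarrow> f m x \<le> f n x"
  by (rule lift_Suc_mono_le[of "\<lambda>n. f n x"]) (auto simp: covers_def)

lemma coversD: "covers A f \<Longrightarrow> x \<in> A \<Longrightarrow> x \<in> S \<Longrightarrow> c < 1 \<Longrightarrow> \<exists>n. c < f n x"
  unfolding covers_def by blast

lemma outer_le: "covers A f \<Longrightarrow> outer A \<le> upper f"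
  unfolding outer_def by (intro INF_lower) auto

lemma outer_greatest: "(\<And>f. covers A f \<Longrightarrow> c \<le> upper f) \<Longrightarrow> c \<le> outer A"
  unfolding outer_def by (intro INF_greatest) auto

lemma covers_one: "covers A (\<lambda>n x. 1)"
  by (auto simp: covers_def)

lemma outer_le_one: "outer A \<le> ennreal (L (\<lambda>x. 1))"
  using outer_le[OF covers_one] by (simp add: upper_def)

text \<open>Dini's argument: the open sets where \<open>f n\<close> exceeds \<open>g - d\<close>
  increase with \<open>n\<close> and cover the compact set \<open>S\<close>, so one of them contains
  it.\<close>

lemma dini:
  assumes f: "covers A f" and g: "continuous_on UNIV g" "\<And>x. g x \<le> 1" "\<And>x. x \<notin> A \<Longrightarrow> g x \<le> 0"
  shows "ennreal (L g) \<le> upper f"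
proof (rule ennreal_le_epsilon)
  fix e :: real assume e: "e > 0"
  \<comment> \<open>The summand 1 covers the case that \<open>L\<close> vanishes on
    constants.\<close>
  define d where "d = e / (1 + L (\<lambda>x. 1))"
  have d: "d > 0" "d * L (\<lambda>x. 1) \<le> e"
    using e L1_nonneg by (auto simp: d_def field_simps)
  have fc: "continuous_on UNIV (f n)" for n using f by (simp add: covers_def)
  have cover: "S \<subseteq> (\<Union>n. {x. g x - d < f n x})"
  proof
    fix x assume x: "x \<in> S"
    show "x \<in> (\<Union>n. {x. g x - d < f n x})"
    proof (cases "x \<in> A")
      case True
      then obtain n where "1 - d < f n x" using coversD[OF f _ x, of "1 - d"] d by auto
      then show ?thesis using g(2)[of x] by (intro UN_I[of n]) auto
    next
      case False
      moreover have "f 0 x \<ge> 0" using f by (simp add: covers_def)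
      ultimately show ?thesis using g(3)[of x] d by (intro UN_I[of 0]) auto
    qed
  qed
  have op: "open {x. g x - d < f n x}" for n
    by (intro open_Collect_less continuous_intros g fc)
  obtain F where F: "finite F" "S \<subseteq> (\<Union>n\<in>F. {x. g x - d < f n x})"
    using compactE_image[OF compact, of UNIV "\<lambda>n. {x. g x - d < f n x}"] op cover by metis
  define n where "n = Max (insert 0 F)"
  have le: "g x \<le> f n x + d" if x: "x \<in> S" for x
  proof -
    obtain k where k: "k \<in> F" "g x - d < f k x" using F x by auto
    have "f k x \<le> f n x" using k F by (intro covers_mono[OF f]) (simp add: n_def)
    then show ?thesis using k by simp
  qed
  have "L g \<le> L (\<lambda>x. f n x + d)" using le by (intro mono g continuous_intros fc)
  also have "\<dots> = L (f n) + d * L (\<lambda>x. 1)" by (subst add) (auto simp: fc const[of d])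
  also have "\<dots> \<le> L (f n) + e" using d by simp
  finally have "ennreal (L g) \<le> ennreal (L (f n) + e)" by (rule ennreal_leI)
  also have "\<dots> = ennreal (L (f n)) + ennreal e"
    using f e by (intro ennreal_plus pos) (auto simp: covers_def)
  also have "\<dots> \<le> upper f + ennreal e"
    unfolding upper_def by (intro add_right_mono SUP_upper) auto
  finally show "ennreal (L g) \<le> upper f + ennreal e" .
qed

lemma outer_empty: "outer {} = 0"
proof -
  have "covers {} (\<lambda>n x. 0)" by (auto simp: covers_def)
  from outer_le[OF this] show ?thesis by (simp add: upper_def zero)
qed

lemma outer_compl: "outer (- S) = 0"
proof -
  have "covers (- S) (\<lambda>n x. 0)" by (auto simp: covers_def)
  from outer_le[OF this] show ?thesis by (simp add: upper_def zero)
qed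

lemma outer_mono: "A \<subseteq> B \<Longrightarrow> outer A \<le> outer B"
  by (intro outer_greatest outer_le) (auto simp: covers_def)

lemma outer_UN: "outer (\<Union>i. A i) \<le> (\<Sum>i. outer (A i))"
proof (rule ennreal_le_epsilon)
  fix e :: real assume e: "e > 0"
  have "\<exists>f. covers (A i) f \<and> upper f \<le> outer (A i) + ennreal (e * (1/2)^Suc i)" for i
  proof -
    have "outer (A i) < outer (A i) + ennreal (e * (1/2)^Suc i)"
    proof -
      have "outer (A i) < top" by (rule le_less_trans[OF outer_le_one ennreal_less_top])
      moreover have "0 < ennreal (e * (1/2)^Suc i)" using e by simp
      ultimately show ?thesis
        using ennreal_add_left_cancel_less[of "outer (A i)" 0 "ennreal (e * (1/2)^Suc i)"] by auto
    qed
    then show ?thesis unfolding outer_def INF_less_iff by (auto intro: less_imp_le)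
  qed
  then obtain f where f: "\<And>i. covers (A i) (f i)"
    "\<And>i. upper (f i) \<le> outer (A i) + ennreal (e * (1/2)^Suc i)" by metis
  have fc: "continuous_on UNIV (f i n)" and f0: "0 \<le> f i n x" for i n x
    using f(1)[of i] by (auto simp: covers_def)
  \<comment> \<open>A diagonal choice: the sum of the first \<open>n\<close> covers, all at stage
    \<open>n\<close>. It increases because all stages are nonnegative and increasing, and
    \<open>L\<close> sees only a finite sum.\<close>
  define h where "h n x = (\<Sum>i<n. f i n x)" for n x
  have "covers (\<Union>i. A i) h"
    unfolding covers_def
  proof (intro conjI allI ballI impI)
    show "continuous_on UNIV (h n)" for n unfolding h_def by (intro continuous_intros fc)
    show "0 \<le> h n x" for n x unfolding h_def by (intro sum_nonneg f0)
    show "h n x \<le> h (Suc n) x" for n x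
    proof -
      have "h n x \<le> (\<Sum>i<n. f i (Suc n) x)"
        unfolding h_def by (intro sum_mono covers_mono[OF f(1)]) auto
      also have "\<dots> \<le> h (Suc n) x" unfolding h_def using f0 by simp
      finally show ?thesis .
    qed
    fix x and c :: real assume x: "x \<in> (\<Union>i. A i) \<inter> S" and c: "c < 1"
    then obtain i where i: "x \<in> A i" "x \<in> S" by auto
    obtain n where n: "c < f i n x" using coversD[OF f(1) i c] by blast
    define k where "k = max n (Suc i)"
    have "c < f i k x" using n covers_mono[OF f(1), of n k i x] by (simp add: k_def)
    also have "\<dots> \<le> h k x" unfolding h_def
      by (rule member_le_sum[of i]) (auto simp: k_def f0)
    finally show "\<exists>n. c < h n x" by blast
  qed
  then have "outer (\<Union>i. A i) \<le> upper h" by (rule outer_le)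
  also have "\<dots> \<le> (\<Sum>i. upper (f i))"
    unfolding upper_def[of h]
  proof (rule SUP_least)
    fix n
    have "ennreal (L (h n)) = (\<Sum>i<n. ennreal (L (f i n)))"
      unfolding h_def by (subst sum) (auto intro!: fc sum_ennreal[symmetric] pos f0)
    also have "\<dots> \<le> (\<Sum>i<n. upper (f i))"
      unfolding upper_def by (intro sum_mono SUP_upper) auto
    also have "\<dots> \<le> (\<Sum>i. upper (f i))" by (intro sum_le_suminf) auto
    finally show "ennreal (L (h n)) \<le> (\<Sum>i. upper (f i))" .
  qed
  also have "\<dots> \<le> (\<Sum>i. outer (A i) + ennreal (e * (1/2)^Suc i))"
    by (intro suminf_le f) auto
  also have "\<dots> = (\<Sum>i. outer (A i)) + (\<Sum>i. ennreal (e * (1/2)^Suc i))"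
    by (intro suminf_add[symmetric]) auto
  also have "(\<Sum>i. ennreal (e * (1/2)^Suc i)) = ennreal e"
    using e sums_mult[OF power_half_series, of e]
    by (intro suminf_ennreal_eq) auto
  finally show "outer (\<Union>i. A i) \<le> (\<Sum>i. outer (A i)) + ennreal e" .
qed

lemma outer_measure: "outer_measure_space (Pow UNIV) outer"
  unfolding outer_measure_space_def positive_def increasing_def countably_subadditive_def
  using outer_empty outer_mono outer_UN by auto

lemma outer_Un: "outer (A \<union> B) \<le> outer A + outer B"
proof -
  have "outer (\<Union>i. binaryset A B i) \<le> (\<Sum>i. outer (binaryset A B i))" by (rule outer_UN)
  also have "\<dots> = outer A + outer B"
    by (rule suminf_binaryset_eq[where f=outer, OF outer_empty])
  finally show ?thesis by (simp add: UN_binaryset_eq)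
qed

text \<open>Caratheodory's condition for open sets. Functions \<open>g n\<close> increasing to the
  indicator of \<open>U\<close> split \<open>f\<close>: the products \<open>f n * g n\<close> cover
  the part inside \<open>U\<close>, and for each fixed \<open>k\<close> what remains of
  \<open>f\<close> after subtracting \<open>p k\<close> covers the part outside, where
  \<open>g k\<close> is 0. \<open>U\<close> is proper because \<open>infdist\<close> to the empty
  set is 0.\<close>

lemma outer_open_split:
  assumes U: "open U" "U \<noteq> UNIV" and f: "covers T f"
  shows "outer (U \<inter> T) + outer (T - U) \<le> upper f"
proof -
  define g where "g k x = min 1 (real k * infdist x (- U))" for k x
  define p where "p n x = f n x * g n x" for n x
  have fc: "continuous_on UNIV (f n)" and f0: "0 \<le> f n x" and fS: "f n x \<le> f (Suc n) x" for n x
    using f by (auto simp: covers_def)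
  have gc: "continuous_on UNIV (g n)" for n unfolding g_def by (intro continuous_intros)
  have g0: "0 \<le> g n x" "g n x \<le> 1" for n x by (auto simp: g_def infdist_nonneg)
  have gS: "g n x \<le> g (Suc n) x" for n x
    unfolding g_def by (intro min.mono mult_right_mono) (auto simp: infdist_nonneg)
  have pc: "continuous_on UNIV (p n)" for n unfolding p_def by (intro continuous_intros fc gc)
  have p0: "0 \<le> p n x" for n x by (simp add: p_def f0 g0)
  have pf: "p n x \<le> f n x" for n x using mult_left_mono[OF g0(2) f0] by (simp add: p_def)
  have covp: "covers (U \<inter> T) p"
    unfolding covers_def
  proof (intro conjI allI ballI impI pc p0)
    show "p n x \<le> p (Suc n) x" for n x
      unfolding p_def by (intro mult_mono fS gS f0 g0)
    fix x and c :: real assume x: "x \<in> U \<inter> T \<inter> S" and c: "c < 1"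
    obtain n where n: "c < f n x" using coversD[OF f _ _ c, of x] x by blast
    have "x \<notin> closure (- U)" using x U by (simp add: closed_Compl)
    then have d: "infdist x (- U) > 0"
      using U infdist_nonneg[of x "- U"] in_closure_iff_infdist_zero[of "- U" x] by force
    obtain k where "1 / infdist x (- U) < real k" using reals_Archimedean2 by blast
    then have k: "1 \<le> real k * infdist x (- U)" using d by (simp add: field_simps)
    define j where "j = max n k"
    have "real k * infdist x (- U) \<le> real j * infdist x (- U)"
      using d by (intro mult_right_mono) (auto simp: j_def)
    then have "g j x = 1" using k by (simp add: g_def)
    moreover have "c < f j x" using n covers_mono[OF f, of n j x] by (simp add: j_def)
    ultimately show "\<exists>n. c < p n x" by (intro exI[of _ j]) (simp add: p_def)
  qed
  have *: "ennreal (L (p k)) + outer (T - U) \<le> upper f" for k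
  proof -
    \<comment> \<open>The shift by \<open>k\<close> keeps \<open>p k\<close> below
      \<open>f (n + k)\<close>, so the differences are nonnegative from the start.\<close>
    define q where "q n x = f (n + k) x - p k x" for n x
    have qc: "continuous_on UNIV (q n)" for n unfolding q_def by (intro continuous_intros fc pc)
    have q0: "0 \<le> q n x" for n x
      using covers_mono[OF f, of k "n + k" x] pf[of k x] by (simp add: q_def)
    have "covers (T - U) q"
      unfolding covers_def
    proof (intro conjI allI ballI impI qc q0)
      show "q n x \<le> q (Suc n) x" for n x using fS by (simp add: q_def)
      fix x and c :: real assume x: "x \<in> (T - U) \<inter> S" and c: "c < 1"
      obtain n where n: "c < f n x" using coversD[OF f _ _ c, of x] x by blast
      have "g k x = 0" using x by (simp add: g_def)
      then have "q n x = f (n + k) x" by (simp add: q_def p_def)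
      then show "\<exists>n. c < q n x" using n covers_mono[OF f, of n "n + k" x] by (intro exI[of _ n]) simp
    qed
    then have "ennreal (L (p k)) + outer (T - U) \<le> ennreal (L (p k)) + upper q"
      by (intro add_left_mono outer_le)
    also have "\<dots> = (SUP n. ennreal (L (p k)) + ennreal (L (q n)))"
      unfolding upper_def by (rule ennreal_SUP_add_right) auto
    also have "\<dots> \<le> upper f"
    proof (rule SUP_least)
      fix n
      have "ennreal (L (p k)) + ennreal (L (q n)) = ennreal (L (p k) + L (q n))"
        by (intro ennreal_plus[symmetric] pos pc qc p0 q0)
      also have "L (p k) + L (q n) = L (f (n + k))"
        using add[of "p k" "q n", OF pc qc] by (simp add: q_def)
      also have "ennreal (L (f (n + k))) \<le> upper f" unfolding upper_def by (intro SUP_upper) auto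
      finally show "ennreal (L (p k)) + ennreal (L (q n)) \<le> upper f" .
    qed
    finally show ?thesis .
  qed
  have "outer (U \<inter> T) + outer (T - U) \<le> upper p + outer (T - U)"
    by (intro add_right_mono outer_le covp)
  also have "\<dots> = (SUP k. ennreal (L (p k)) + outer (T - U))"
    unfolding upper_def by (rule ennreal_SUP_add_left[symmetric]) auto
  also have "\<dots> \<le> upper f" by (intro SUP_least *)
  finally show ?thesis .
qed

lemma open_in_lambda_system:
  assumes "open U"
  shows "U \<in> lambda_system UNIV (Pow UNIV) outer"
  unfolding lambda_system_def
proof (intro CollectI conjI ballI)
  fix T :: "'a set"
  show "outer (U \<inter> T) + outer ((UNIV - U) \<inter> T) = outer T"
  proof (rule antisym)
    show "outer (U \<inter> T) + outer ((UNIV - U) \<inter> T) \<le> outer T"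
    proof (cases "U = UNIV")
      case False
      have eq: "(UNIV - U) \<inter> T = T - U" by auto
      show ?thesis unfolding eq
        by (intro outer_greatest outer_open_split[OF assms False])
    qed (simp add: outer_empty)
    have "outer T = outer ((U \<inter> T) \<union> ((UNIV - U) \<inter> T))" by (rule arg_cong[where f=outer]) auto
    also have "\<dots> \<le> outer (U \<inter> T) + outer ((UNIV - U) \<inter> T)" by (rule outer_Un)
    finally show "outer T \<le> outer (U \<inter> T) + outer ((UNIV - U) \<inter> T)" .
  qed
qed auto

section \<open>The representing measure and its integral\<close>

definition rep_measure :: "'a measure" where
  "rep_measure = measure_of UNIV (Collect open) outer"

lemma sets_rep_measure [simp, measurable_cong]: "sets rep_measure = sets borel"
  by (simp add: rep_measure_def borel_def)

lemma space_rep_measure [simp]: "space rep_measure = UNIV"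
  by (simp add: rep_measure_def space_measure_of)

lemma emeasure_rep_measure:
  assumes "A \<in> sets borel"
  shows "emeasure rep_measure A = outer A"
proof -
  interpret sigma_algebra UNIV "Pow UNIV :: 'a set set" by (rule sigma_algebra_Pow)
  have ms: "measure_space UNIV (lambda_system UNIV (Pow UNIV) outer) outer"
    by (rule caratheodory_lemma[OF outer_measure])
  then have sa: "sigma_algebra UNIV (lambda_system UNIV (Pow UNIV) outer)"
    and ca: "countably_additive (lambda_system UNIV (Pow UNIV) outer) outer"
    by (auto simp: measure_space_def)
  have sub: "sigma_sets UNIV (Collect open) \<subseteq> lambda_system UNIV (Pow UNIV) outer"
    by (rule sigma_algebra.sigma_sets_subset[OF sa]) (use open_in_lambda_system in blast)
  show ?thesis
  proof (rule emeasure_measure_of[OF rep_measure_def])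
    show "positive (sets rep_measure) outer" by (simp add: positive_def outer_empty)
    show "countably_additive (sets rep_measure) outer"
      using ca sub unfolding countably_additive_def sets_rep_measure borel_def by (simp add: subset_iff)
  qed (use assms in auto)
qed

lemma finite_rep_measure: "finite_measure rep_measure"
  using outer_le_one[of UNIV]
  by (intro finite_measureI) (auto simp: emeasure_rep_measure top_unique)

lemma L_le_measure_open:
  assumes "open U" "continuous_on UNIV g" "\<And>x. g x \<le> 1" "\<And>x. x \<notin> U \<Longrightarrow> g x \<le> 0"
  shows "L g \<le> measure rep_measure U"
proof -
  interpret finite_measure rep_measure by (rule finite_rep_measure)
  have "ennreal (L g) \<le> outer U" by (rule outer_greatest) (rule dini, use assms in auto)
  also have "\<dots> = ennreal (measure rep_measure U)"
    using assms by (simp add: emeasure_rep_measure[symmetric] emeasure_eq_measure)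
  finally show ?thesis by simp
qed

lemma measure_rep_measure_UNIV: "measure rep_measure UNIV = L (\<lambda>x. 1)"
proof (rule antisym)
  show "L (\<lambda>x. 1) \<le> measure rep_measure UNIV" by (rule L_le_measure_open) auto
  interpret finite_measure rep_measure by (rule finite_rep_measure)
  show "measure rep_measure UNIV \<le> L (\<lambda>x. 1)"
    using outer_le_one[of UNIV] L1_nonneg
    by (simp add: emeasure_rep_measure[symmetric] emeasure_eq_measure)
qed

lemma emeasure_rep_measure_compl: "emeasure rep_measure (- S) = 0"
  using compact_imp_closed[OF compact] by (simp add: emeasure_rep_measure outer_compl)

lemma sum_slices:
  fixes t :: real
  assumes "0 \<le> t"
  shows "(\<Sum>i<n. max 0 (min 1 (t - real i))) = min t (real n)"
proof (induction n)
  case (Suc n)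
  then show ?case by (simp add: min_def max_def)
qed (use assms in simp)

text \<open>A layer-cake argument. \<open>n * h\<close> is cut into \<open>n\<close> layers of
  height 1; layer \<open>i\<close> vanishes off \<open>U i\<close> and equals 1 on
  \<open>U (Suc i)\<close>. So \<open>L\<close> of it is at most the measure of \<open>U i\<close>,
  and its integral is at least the measure of \<open>U (Suc i)\<close>. After an index shift the two
  sums differ by the measure of \<open>U 0\<close>, which is negligible against
  \<open>n\<close>.\<close>

lemma L_le_integral:
  assumes h: "continuous_on UNIV h" and h01: "\<And>x. 0 \<le> h x" "\<And>x. h x \<le> 1"
  shows "L h \<le> (\<integral>x. h x \<partial>rep_measure)"
proof -
  interpret finite_measure rep_measure by (rule finite_rep_measure)
  have hb: "h \<in> borel_measurable borel" by (rule borel_measurable_continuous_onI[OF h])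
  have bound: "real n * L h \<le> L (\<lambda>x. 1) + real n * (\<integral>x. h x \<partial>rep_measure)" for n
  proof -
    define s where "s i x = max 0 (min 1 (real n * h x - real i))" for i x
    have sc: "continuous_on UNIV (s i)" for i unfolding s_def by (intro continuous_intros h)
    have s01: "0 \<le> s i x" "s i x \<le> 1" for i x by (auto simp: s_def)
    have sint: "integrable rep_measure (s i)" for i
      by (rule integrable_const_bound[where B=1])
         (use s01 borel_measurable_continuous_onI[OF sc] in auto)
    have ssum: "(\<Sum>i<n. s i x) = real n * h x" for x
      unfolding s_def using h01[of x] by (subst sum_slices) (auto simp: mult_left_le)
    define U where "U i = {x. real i < real n * h x}" for i
    have Uo: "open (U i)" for i unfolding U_def by (intro open_Collect_less continuous_intros h)
    have up: "L (s i) \<le> measure rep_measure (U i)" for i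
      by (rule L_le_measure_open[OF Uo sc]) (auto simp: s_def U_def)
    have low: "measure rep_measure (U (Suc i)) \<le> (\<integral>x. s i x \<partial>rep_measure)" for i
    proof -
      have "measure rep_measure (U (Suc i)) = (\<integral>x. indicator (U (Suc i)) x \<partial>rep_measure)"
        using Uo by simp
      also have "\<dots> \<le> (\<integral>x. s i x \<partial>rep_measure)"
      proof (rule integral_mono[OF integrable_real_indicator sint])
        show "U (Suc i) \<in> sets rep_measure" using Uo by simp
        show "indicator (U (Suc i)) x \<le> s i x" for x by (auto simp: s_def U_def indicator_def)
      qed (simp add: less_top[symmetric])
      finally show ?thesis .
    qed
    have "real n * L h = L (\<lambda>x. \<Sum>i<n. s i x)" unfolding ssum by (simp add: scale[OF h])
    also have "\<dots> = (\<Sum>i<n. L (s i))" by (intro sum sc) auto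
    also have "\<dots> \<le> (\<Sum>i<n. measure rep_measure (U i))" by (intro sum_mono up)
    also have "\<dots> \<le> (\<Sum>i<Suc n. measure rep_measure (U i))" by (intro sum_mono2) auto
    also have "\<dots> = measure rep_measure (U 0) + (\<Sum>i<n. measure rep_measure (U (Suc i)))"
      by (rule sum.lessThan_Suc_shift)
    also have "\<dots> \<le> L (\<lambda>x. 1) + (\<Sum>i<n. \<integral>x. s i x \<partial>rep_measure)"
      using bounded_measure[of "U 0"] by (intro add_mono sum_mono low) (simp add: measure_rep_measure_UNIV)
    also have "(\<Sum>i<n. \<integral>x. s i x \<partial>rep_measure) = real n * (\<integral>x. h x \<partial>rep_measure)"
      using sint by (simp add: ssum flip: Bochner_Integration.integral_sum)
    finally show ?thesis .
  qed
  show ?thesis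
  proof (rule ccontr)
    assume "\<not> ?thesis"
    then have d: "L h - (\<integral>x. h x \<partial>rep_measure) > 0" by simp
    obtain n where "L (\<lambda>x. 1) < real n * (L h - (\<integral>x. h x \<partial>rep_measure))"
      using ex_less_of_nat_mult[OF d] by blast
    then show False using bound[of n] by (simp add: algebra_simps)
  qed
qed

text \<open>Applied to both \<open>h\<close> and \<open>1 - h\<close>, the inequality of
  \<open>L_le_integral\<close> becomes an equality because the total masses agree. A general
  \<open>f\<close> is bounded on \<open>S\<close>, so it can be truncated and rescaled to values in
  \<open>[0, 1]\<close>; truncation changes it only off \<open>S\<close>, where neither side
  notices.\<close>

theorem integral_rep_measure:
  assumes f: "continuous_on UNIV f"
  shows "integrable rep_measure f \<and> (\<integral>x. f x \<partial>rep_measure) = L f"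
proof -
  interpret finite_measure rep_measure by (rule finite_rep_measure)
  have "bounded (f ` S)"
    by (intro compact_imp_bounded compact_continuous_image compact continuous_on_subset[OF f]) auto
  then obtain b where b: "b > 0" "\<And>x. x \<in> S \<Longrightarrow> \<bar>f x\<bar> \<le> b" by (auto simp: bounded_pos)
  define g where "g x = max (-b) (min b (f x))" for x
  define h where "h x = (g x + b) / (2 * b)" for x
  have gc: "continuous_on UNIV g" unfolding g_def by (intro continuous_intros f)
  have hc: "continuous_on UNIV h" unfolding h_def using b by (intro continuous_intros gc) auto
  have h01: "0 \<le> h x" "h x \<le> 1" for x using b by (auto simp: h_def g_def)
  have hint: "integrable rep_measure h"
    by (rule integrable_const_bound[where B=1])
       (use h01 borel_measurable_continuous_onI[OF hc] in auto)
  have "L (\<lambda>x. 1 - h x) \<le> (\<integral>x. 1 - h x \<partial>rep_measure)"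
    by (rule L_le_integral) (use h01 in \<open>auto intro!: continuous_intros hc\<close>)
  also have "\<dots> = L (\<lambda>x. 1) - (\<integral>x. h x \<partial>rep_measure)"
    using hint by (simp add: measure_rep_measure_UNIV)
  also have "L (\<lambda>x. 1 - h x) = L (\<lambda>x. 1) - L h"
    using add[of "\<lambda>x. 1 - h x" h] hc by (simp add: continuous_intros)
  finally have Lh: "L h = (\<integral>x. h x \<partial>rep_measure)"
    using L_le_integral[OF hc h01] by simp
  have gh: "g x = 2 * b * h x + (- b)" for x using b by (simp add: h_def)
  have "L f = L g" by (rule cong[OF f gc]) (use b in \<open>force simp: g_def\<close>)
  also have "\<dots> = 2 * b * L h + (- b) * L (\<lambda>x. 1)"
    unfolding gh by (subst add) (auto intro!: continuous_intros hc simp: scale[OF hc] const[of "-b"])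
  also have "\<dots> = (\<integral>x. g x \<partial>rep_measure)"
    unfolding gh using hint by (simp add: Lh measure_rep_measure_UNIV)
  finally have "L f = (\<integral>x. g x \<partial>rep_measure)" .
  moreover have ae: "AE x in rep_measure. g x = f x"
  proof (rule AE_I)
    show "{x \<in> space rep_measure. g x \<noteq> f x} \<subseteq> - S" using b by (force simp: g_def)
    show "- S \<in> sets rep_measure" using compact_imp_closed[OF compact] by auto
  qed (rule emeasure_rep_measure_compl)
  moreover have "integrable rep_measure g"
    unfolding gh using hint by simp
  moreover have "f \<in> borel_measurable rep_measure" "g \<in> borel_measurable rep_measure"
    using borel_measurable_continuous_onI[OF f] borel_measurable_continuous_onI[OF gc] by auto
  ultimately show ?thesis
    using integrable_cong_AE[of g rep_measure f] integral_cong_AE[of g rep_measure f] by auto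
qed

end

section \<open>Countable sums of measures and square-integrable functions\<close>

lemma suminf_commute_ennreal: "(\<Sum>i. \<Sum>n. (a i n :: ennreal)) = (\<Sum>n. \<Sum>i. a i n)"
proof -
  have "(\<Sum>n. \<Sum>i. a i n) = (\<integral>\<^sup>+n. (\<Sum>i. a i n) \<partial>count_space UNIV)"
    by (simp add: nn_integral_count_space_nat)
  also have "\<dots> = (\<Sum>i. \<integral>\<^sup>+n. a i n \<partial>count_space UNIV)"
    by (rule nn_integral_suminf) simp
  finally show ?thesis by (simp add: nn_integral_count_space_nat)
qed

definition sum_measure :: "'a measure \<Rightarrow> (nat \<Rightarrow> 'a measure) \<Rightarrow> 'a measure" where
  "sum_measure N M = measure_of (space N) (sets N) (\<lambda>A. \<Sum>n. emeasure (M n) A)"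

lemma sets_sum_measure [simp, measurable_cong]: "sets (sum_measure N M) = sets N"
  by (simp add: sum_measure_def)

lemma space_sum_measure [simp]: "space (sum_measure N M) = space N"
  by (simp add: sum_measure_def)

lemma emeasure_sum_measure:
  assumes M: "\<And>n. sets (M n) = sets N" and A: "A \<in> sets N"
  shows "emeasure (sum_measure N M) A = (\<Sum>n. emeasure (M n) A)"
proof (rule emeasure_measure_of[OF sum_measure_def])
  show "sets N \<subseteq> Pow (space N)" by (rule sets.space_closed)
  show "positive (sets (sum_measure N M)) (\<lambda>A. \<Sum>n. emeasure (M n) A)"
    by (simp add: positive_def)
  show "countably_additive (sets (sum_measure N M)) (\<lambda>A. \<Sum>n. emeasure (M n) A)"
  proof (rule countably_additiveI)
    fix B :: "nat \<Rightarrow> 'a set" assume B: "range B \<subseteq> sets (sum_measure N M)" "disjoint_family B"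
    have "(\<Sum>i. \<Sum>n. emeasure (M n) (B i)) = (\<Sum>n. \<Sum>i. emeasure (M n) (B i))"
      by (rule suminf_commute_ennreal)
    also have "\<dots> = (\<Sum>n. emeasure (M n) (\<Union>i. B i))"
      using B by (intro suminf_cong suminf_emeasure) (auto simp: M)
    finally show "(\<Sum>i. \<Sum>n. emeasure (M n) (B i)) = (\<Sum>n. emeasure (M n) (\<Union>i. B i))" .
  qed
qed (use A in simp)

lemma nn_integral_sum_measure:
  assumes M: "\<And>n. sets (M n) = sets N" and f: "f \<in> borel_measurable N"
  shows "(\<integral>\<^sup>+x. f x \<partial>sum_measure N M) = (\<Sum>n. \<integral>\<^sup>+x. f x \<partial>M n)"
proof -
  have sp: "space (M n) = space N" for n using M sets_eq_imp_space_eq by blast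
  have mM: "borel_measurable (M n) = borel_measurable N" for n by (rule measurable_cong_sets[OF M refl])
  have mS: "borel_measurable (sum_measure N M) = borel_measurable N" by (rule measurable_cong_sets) auto
  show ?thesis using f
  proof (induction rule: borel_measurable_induct)
    case (cong f g)
    have "(\<integral>\<^sup>+x. f x \<partial>sum_measure N M) = (\<integral>\<^sup>+x. g x \<partial>sum_measure N M)"
      by (rule nn_integral_cong) (use cong in simp)
    moreover have "(\<integral>\<^sup>+x. f x \<partial>M n) = (\<integral>\<^sup>+x. g x \<partial>M n)" for n
      by (rule nn_integral_cong) (use cong sp in simp)
    ultimately show ?case using cong by simp
  next
    case (set A)
    then show ?case by (simp add: nn_integral_indicator emeasure_sum_measure[of M N] M)
  next
    case (mult u c)
    then show ?case by (simp add: nn_integral_cmult mM mS)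
  next
    case (add u v)
    then show ?case by (simp add: nn_integral_add mM mS suminf_add)
  next
    case (seq U)
    have "(\<integral>\<^sup>+x. (SUP i. U i) x \<partial>sum_measure N M) = (SUP i. \<integral>\<^sup>+x. U i x \<partial>sum_measure N M)"
      unfolding SUP_apply by (rule nn_integral_monotone_convergence_SUP) (use seq in \<open>auto simp: mS\<close>)
    also have "\<dots> = (SUP i. \<Sum>n. \<integral>\<^sup>+x. U i x \<partial>M n)" using seq by simp
    \<comment> \<open>The series is read as an integral for counting measure, so that monotone
      convergence exchanges it with the supremum.\<close>
    also have "\<dots> = (SUP i. \<integral>\<^sup>+n. (\<integral>\<^sup>+x. U i x \<partial>M n) \<partial>count_space UNIV)"
      by (simp add: nn_integral_count_space_nat)
    also have "\<dots> = (\<integral>\<^sup>+n. (SUP i. \<integral>\<^sup>+x. U i x \<partial>M n) \<partial>count_space UNIV)"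
      using \<open>incseq U\<close>
      by (intro nn_integral_monotone_convergence_SUP[symmetric])
         (auto simp: incseq_def le_fun_def intro!: nn_integral_mono)
    also have "\<dots> = (\<Sum>n. SUP i. \<integral>\<^sup>+x. U i x \<partial>M n)" by (simp add: nn_integral_count_space_nat)
    also have "\<dots> = (\<Sum>n. \<integral>\<^sup>+x. (SUP i. U i) x \<partial>M n)"
      unfolding SUP_apply
      by (intro suminf_cong nn_integral_monotone_convergence_SUP[symmetric]) (use seq in \<open>auto simp: mM\<close>)
    finally show ?case .
  qed
qed

section \<open>Squared norms and completeness of square-integrable functions\<close>

definition sqn :: "'a measure \<Rightarrow> ('a \<Rightarrow> complex) \<Rightarrow> ennreal" where
  "sqn M f = (\<integral>\<^sup>+x. ennreal ((cmod (f x))\<^sup>2) \<partial>M)"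

lemma sqn_cong: "(\<And>x. x \<in> space M \<Longrightarrow> f x = g x) \<Longrightarrow> sqn M f = sqn M g"
  unfolding sqn_def by (rule nn_integral_cong) simp

lemma sqn_zero [simp]: "sqn M (\<lambda>x. 0) = 0"
  by (simp add: sqn_def)

lemma sqn_eq_0_iff:
  assumes [measurable]: "f \<in> borel_measurable M"
  shows "sqn M f = 0 \<longleftrightarrow> (AE x in M. f x = 0)"
  unfolding sqn_def by (subst nn_integral_0_iff_AE) auto

lemma sqn_scale:
  assumes [measurable]: "f \<in> borel_measurable M"
  shows "sqn M (\<lambda>x. c * f x) = ennreal ((cmod c)\<^sup>2) * sqn M f"
  unfolding sqn_def by (subst nn_integral_cmult[symmetric]) (auto simp: norm_mult power_mult_distrib ennreal_mult)

lemma sqn_minus_commute: "sqn M (\<lambda>x. f x - g x) = sqn M (\<lambda>x. g x - f x)"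
  unfolding sqn_def by (simp add: norm_minus_commute)

lemma cmod_add_sq_le: "(cmod (a + b))\<^sup>2 \<le> 2 * (cmod a)\<^sup>2 + 2 * (cmod b)\<^sup>2"
proof -
  have "(cmod (a + b))\<^sup>2 \<le> (cmod a + cmod b)\<^sup>2" by (intro power_mono norm_triangle_ineq) auto
  also have "\<dots> \<le> 2 * (cmod a)\<^sup>2 + 2 * (cmod b)\<^sup>2"
    using zero_le_power2[of "cmod a - cmod b"] unfolding power2_sum power2_diff by linarith
  finally show ?thesis .
qed

lemma sqn_add_le:
  assumes [measurable]: "f \<in> borel_measurable M" "g \<in> borel_measurable M"
  shows "sqn M (\<lambda>x. f x + g x) \<le> 2 * sqn M f + 2 * sqn M g"
proof -
  have "sqn M (\<lambda>x. f x + g x) \<le> (\<integral>\<^sup>+x. 2 * ennreal ((cmod (f x))\<^sup>2) + 2 * ennreal ((cmod (g x))\<^sup>2) \<partial>M)"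
    unfolding sqn_def
  proof (rule nn_integral_mono)
    fix x
    have "ennreal ((cmod (f x + g x))\<^sup>2) \<le> ennreal (2 * (cmod (f x))\<^sup>2 + 2 * (cmod (g x))\<^sup>2)"
      by (intro ennreal_leI cmod_add_sq_le)
    then show "ennreal ((cmod (f x + g x))\<^sup>2) \<le> 2 * ennreal ((cmod (f x))\<^sup>2) + 2 * ennreal ((cmod (g x))\<^sup>2)"
      by (simp add: ennreal_mult)
  qed
  also have "\<dots> = 2 * sqn M f + 2 * sqn M g"
    unfolding sqn_def by (simp add: nn_integral_add nn_integral_cmult)
  finally show ?thesis .
qed

lemma sqn_triangle:
  assumes [measurable]: "f \<in> borel_measurable M" "g \<in> borel_measurable M" "h \<in> borel_measurable M"
  shows "sqn M (\<lambda>x. f x - h x) \<le> 2 * sqn M (\<lambda>x. f x - g x) + 2 * sqn M (\<lambda>x. g x - h x)"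
  using sqn_add_le[of "\<lambda>x. f x - g x" M "\<lambda>x. g x - h x"] by simp

lemma ennreal_tendsto_0_squeeze:
  assumes "(f \<longlongrightarrow> (0::ennreal)) F" "eventually (\<lambda>n. g n \<le> f n) F"
  shows "(g \<longlongrightarrow> 0) F"
  by (rule tendsto_sandwich[OF _ assms(2) tendsto_const assms(1)]) simp

lemma ennreal_tendsto_0_mult:
  assumes "(f \<longlongrightarrow> (0::ennreal)) F" "c < top"
  shows "((\<lambda>n. c * f n) \<longlongrightarrow> 0) F"
  using ennreal_tendsto_cmult[OF assms(2,1)] by simp

lemma sqn_dominated:
  assumes [measurable]: "\<And>n. f n \<in> borel_measurable M" "g \<in> borel_measurable M" "w \<in> borel_measurable M"
    and bound: "\<And>n. AE x in M. cmod (f n x) \<le> cmod (w x)" and w: "sqn M w < top"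
    and lim: "AE x in M. (\<lambda>n. f n x) \<longlonglongrightarrow> g x"
  shows "(\<lambda>n. sqn M (\<lambda>x. f n x - g x)) \<longlonglongrightarrow> 0"
proof -
  have "(\<lambda>n. \<integral>\<^sup>+x. ennreal ((cmod (f n x - g x))\<^sup>2) \<partial>M) \<longlonglongrightarrow> (\<integral>\<^sup>+x. 0 \<partial>M)"
  proof (rule nn_integral_dominated_convergence[where w="\<lambda>x. ennreal 4 * ennreal ((cmod (w x))\<^sup>2)"])
    have "AE x in M. \<forall>n. cmod (f n x) \<le> cmod (w x)" using bound by (simp add: AE_all_countable)
    then have gw: "AE x in M. cmod (g x) \<le> cmod (w x)"
      using lim
    proof eventually_elim
      case (elim x)
      show ?case by (rule tendsto_upperbound[OF tendsto_norm[OF elim(2)]]) (use elim in auto)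
    qed
    show "AE x in M. ennreal ((cmod (f n x - g x))\<^sup>2) \<le> ennreal 4 * ennreal ((cmod (w x))\<^sup>2)" for n
      using bound[of n] gw
    proof eventually_elim
      case (elim x)
      have "cmod (f n x - g x) \<le> 2 * cmod (w x)" using norm_triangle_ineq4[of "f n x" "g x"] elim by simp
      then have "(cmod (f n x - g x))\<^sup>2 \<le> (2 * cmod (w x))\<^sup>2" by (intro power_mono) auto
      then have "ennreal ((cmod (f n x - g x))\<^sup>2) \<le> ennreal (4 * (cmod (w x))\<^sup>2)"
        by (intro ennreal_leI) (simp add: power_mult_distrib)
      then show ?case by (simp add: ennreal_mult)
    qed
    show "(\<integral>\<^sup>+x. ennreal 4 * ennreal ((cmod (w x))\<^sup>2) \<partial>M) < \<infinity>"
      using w unfolding sqn_def by (simp add: nn_integral_cmult ennreal_mult_less_top)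
    show "AE x in M. (\<lambda>n. ennreal ((cmod (f n x - g x))\<^sup>2)) \<longlonglongrightarrow> 0"
      using lim
    proof eventually_elim
      case (elim x)
      have "(\<lambda>n. (cmod (f n x - g x))\<^sup>2) \<longlonglongrightarrow> (cmod (g x - g x))\<^sup>2" by (intro tendsto_intros elim)
      then show ?case using tendsto_ennrealI by fastforce
    qed
  qed auto
  then show ?thesis by (simp add: sqn_def)
qed

text \<open>Riesz-Fischer by a fast subsequence: gaps below \<open>(1/8)^k\<close> remain summable
  after weighting by \<open>4^k\<close>, so almost everywhere the increments are at most a constant
  times \<open>(1/2)^k\<close>. Fatou's lemma transfers the Cauchy estimate to the pointwise
  limit.\<close>

lemma L2_complete:
  assumes [measurable]: "\<And>n. f n \<in> borel_measurable M"
    and cauchy: "\<And>e. e > 0 \<Longrightarrow> \<exists>N. \<forall>m\<ge>N. \<forall>n\<ge>N. sqn M (\<lambda>x. f m x - f n x) \<le> ennreal e"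
  shows "\<exists>g\<in>borel_measurable M. (\<lambda>n. sqn M (\<lambda>x. f n x - g x)) \<longlonglongrightarrow> 0"
proof -
  have "\<exists>N. \<forall>m\<ge>N. \<forall>n\<ge>N. sqn M (\<lambda>x. f m x - f n x) \<le> ennreal ((1/8)^k)" for k
    by (rule cauchy) simp
  then obtain N where N: "\<And>k m n. N k \<le> m \<Longrightarrow> N k \<le> n \<Longrightarrow> sqn M (\<lambda>x. f m x - f n x) \<le> ennreal ((1/8)^k)"
    by metis
  \<comment> \<open>A partial sum is an index beyond all of \<open>N 0\<close> up to
    \<open>N k\<close>, so two consecutive terms both satisfy the estimate for
    \<open>k\<close>.\<close>
  define r where "r k = (\<Sum>i\<le>k. N i)" for k
  have rN: "N i \<le> r k" if "i \<le> k" for i k unfolding r_def by (rule member_le_sum) (use that in auto)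
  define u where "u k = f (r k)" for k
  have [measurable]: "u k \<in> borel_measurable M" for k by (simp add: u_def)
  define g where "g x = lim (\<lambda>k. u k x)" for x
  have g [measurable]: "g \<in> borel_measurable M" unfolding g_def by measurable
  have "(\<integral>\<^sup>+x. (\<Sum>k. ennreal (4^k * (cmod (u (Suc k) x - u k x))\<^sup>2)) \<partial>M)
      = (\<Sum>k. \<integral>\<^sup>+x. ennreal (4^k * (cmod (u (Suc k) x - u k x))\<^sup>2) \<partial>M)"
    by (rule nn_integral_suminf) measurable
  also have "\<dots> = (\<Sum>k. ennreal (4^k) * sqn M (\<lambda>x. u (Suc k) x - u k x))"
    unfolding sqn_def by (intro suminf_cong) (subst nn_integral_cmult[symmetric], auto simp: ennreal_mult)
  also have "\<dots> \<le> (\<Sum>k. ennreal ((1/2)^k))"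
  proof (rule suminf_le)
    fix k
    have "ennreal (4^k) * sqn M (\<lambda>x. u (Suc k) x - u k x) \<le> ennreal (4^k) * ennreal ((1/8)^k)"
      unfolding u_def by (intro mult_left_mono N rN) auto
    also have "\<dots> = ennreal ((1/2)^k)"
      by (subst ennreal_mult[symmetric]) (auto simp flip: power_mult_distrib)
    finally show "ennreal (4^k) * sqn M (\<lambda>x. u (Suc k) x - u k x) \<le> ennreal ((1/2)^k)" .
  qed auto
  also have "\<dots> < \<infinity>"
    by (subst suminf_ennreal2) (auto simp: summable_geometric)
  finally have "AE x in M. (\<Sum>k. ennreal (4^k * (cmod (u (Suc k) x - u k x))\<^sup>2)) \<noteq> \<infinity>"
    by (intro nn_integral_PInf_AE) auto
  then have conv: "AE x in M. (\<lambda>k. u k x) \<longlonglongrightarrow> g x"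
  proof eventually_elim
    case (elim x)
    define C where "C = enn2real (\<Sum>k. ennreal (4^k * (cmod (u (Suc k) x - u k x))\<^sup>2))"
    have C: "ennreal C = (\<Sum>k. ennreal (4^k * (cmod (u (Suc k) x - u k x))\<^sup>2))" "C \<ge> 0"
      using elim by (auto simp: C_def less_top)
    have "cmod (u (Suc k) x - u k x) \<le> sqrt C * (1/2)^k" for k
    proof -
      define a where "a k = 4^k * (cmod (u (Suc k) x - u k x))\<^sup>2" for k
      have "(\<Sum>k\<in>{k}. ennreal (a k)) \<le> (\<Sum>k. ennreal (a k))" by (rule sum_le_suminf) auto
      then have "ennreal (a k) \<le> ennreal C" unfolding C(1) a_def by simp
      then have "a k \<le> C" by (simp only: ennreal_le_iff[OF C(2)])
      then have "4^k * (cmod (u (Suc k) x - u k x))\<^sup>2 \<le> C" by (simp only: a_def)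
      moreover have "((2::real)^k)\<^sup>2 = 4^k" by (simp add: power2_eq_square flip: power_mult_distrib)
      ultimately have "(2^k * cmod (u (Suc k) x - u k x))\<^sup>2 \<le> (sqrt C)\<^sup>2"
        using C(2) by (simp add: power_mult_distrib)
      then have "2^k * cmod (u (Suc k) x - u k x) \<le> sqrt C" by (rule power2_le_imp_le) (use C in simp)
      then have "cmod (u (Suc k) x - u k x) \<le> sqrt C / 2^k" by (simp only: pos_le_divide_eq zero_less_power zero_less_numeral mult.commute)
      then show ?thesis by (simp only: power_one_over times_divide_eq_right mult_1_right)
    qed
    then have nb: "norm (u (Suc k) x - u k x) \<le> sqrt C * (1/2)^k" for k .
    have sm: "summable (\<lambda>k. sqrt C * (1/2)^k)" by (rule summable_mult, rule summable_geometric) simp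
    have "summable (\<lambda>k. u (Suc k) x - u k x)" by (rule summable_comparison_test'[OF sm nb])
    then have "convergent (\<lambda>n. \<Sum>k<n. u (Suc k) x - u k x)" by (simp add: summable_iff_convergent)
    then have "convergent (\<lambda>n. u n x - u 0 x)" by (simp add: sum_lessThan_telescope[of "\<lambda>n. u n x"])
    then obtain l where "(\<lambda>n. u n x - u 0 x) \<longlonglongrightarrow> l" by (auto simp: convergent_def)
    then have "(\<lambda>n. (u n x - u 0 x) + u 0 x) \<longlonglongrightarrow> l + u 0 x" by (intro tendsto_intros)
    then have "convergent (\<lambda>n. u n x)" by (auto simp: convergent_def)
    then show ?case by (simp add: g_def convergent_LIMSEQ_iff)
  qed
  have est: "sqn M (\<lambda>x. f m x - g x) \<le> ennreal ((1/8)^k)" if m: "N k \<le> m" for m k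
  proof -
    have "sqn M (\<lambda>x. f m x - g x) = (\<integral>\<^sup>+x. liminf (\<lambda>j. ennreal ((cmod (f m x - u j x))\<^sup>2)) \<partial>M)"
      unfolding sqn_def
    proof (rule nn_integral_cong_AE)
      show "AE x in M. ennreal ((cmod (f m x - g x))\<^sup>2) = liminf (\<lambda>j. ennreal ((cmod (f m x - u j x))\<^sup>2))"
        using conv
      proof eventually_elim
        case (elim x)
        have "(\<lambda>j. ennreal ((cmod (f m x - u j x))\<^sup>2)) \<longlonglongrightarrow> ennreal ((cmod (f m x - g x))\<^sup>2)"
          by (intro tendsto_ennrealI tendsto_intros elim)
        then show ?case by (intro lim_imp_Liminf[symmetric]) auto
      qed
    qed
    also have "\<dots> \<le> liminf (\<lambda>j. sqn M (\<lambda>x. f m x - u j x))"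
      unfolding sqn_def by (rule nn_integral_liminf) measurable
    also have "\<dots> \<le> ennreal ((1/8)^k)"
    proof (rule Liminf_le)
      show "\<forall>\<^sub>F j in sequentially. sqn M (\<lambda>x. f m x - u j x) \<le> ennreal ((1/8)^k)"
        using eventually_ge_at_top[of k]
        by eventually_elim (use N[OF m] rN in \<open>auto simp: u_def\<close>)
    qed simp
    finally show ?thesis .
  qed
  have "(\<lambda>n. sqn M (\<lambda>x. f n x - g x)) \<longlonglongrightarrow> 0"
  proof (rule order_tendstoI)
    fix a :: ennreal assume a: "0 < a"
    have "(\<lambda>k. ennreal ((1/8)^k)) \<longlonglongrightarrow> ennreal 0" by (intro tendsto_ennrealI LIMSEQ_realpow_zero) auto
    then have "eventually (\<lambda>k. ennreal ((1/8)^k) < a) sequentially" using a by (auto dest: order_tendstoD)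
    then obtain k where k: "ennreal ((1/8)^k) < a" by (auto simp: eventually_sequentially)
    show "\<forall>\<^sub>F n in sequentially. sqn M (\<lambda>x. f n x - g x) < a"
      using eventually_ge_at_top[of "N k"] by eventually_elim (use est k in \<open>auto intro: le_less_trans\<close>)
  qed simp
  then show ?thesis using g by blast
qed

section \<open>From polynomials to bounded Borel functions\<close>

text \<open>Stone-Weierstrass leads from polynomials to continuous functions, distance functions
  lead to indicators of open sets, a Dynkin class argument to Borel indicators, and simple functions
  to bounded Borel functions. Bounds and limits are demanded on \<open>K\<close> only, because the
  properties it is applied to do not see the complement of the disc.\<close>

lemma borel_bounded_induct:
  fixes K :: "'a::euclidean_space set" and P :: "('a \<Rightarrow> complex) \<Rightarrow> bool"
  assumes K: "compact K"
    and poly: "\<And>p. real_polynomial_function p \<Longrightarrow> P (\<lambda>z. complex_of_real (p z))"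
    and add: "\<And>f g. P f \<Longrightarrow> P g \<Longrightarrow> P (\<lambda>z. f z + g z)"
    and scale: "\<And>c f. P f \<Longrightarrow> P (\<lambda>z. c * f z)"
    and lim: "\<And>f g C. (\<And>n. P (f n)) \<Longrightarrow> g \<in> borel_measurable borel \<Longrightarrow>
      (\<And>n z. z \<in> K \<Longrightarrow> cmod (f n z) \<le> C) \<Longrightarrow> (\<And>z. z \<in> K \<Longrightarrow> (\<lambda>n. f n z) \<longlonglongrightarrow> g z) \<Longrightarrow> P g"
    and g: "g \<in> borel_measurable borel" "\<And>z. z \<in> K \<Longrightarrow> cmod (g z) \<le> C"
  shows "P g"
proof -
  have const: "P (\<lambda>z. c)" for c using scale[OF poly[OF real_polynomial_function.intros(2)[of 1]], of c] by simp
  have sum: "P (\<lambda>z. \<Sum>i\<in>I. f i z)" if "finite I" "\<And>i. i \<in> I \<Longrightarrow> P (f i)" for I :: "'i set" and f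
    using that by (induction rule: finite_induct) (auto intro: const add)
  have cont: "P (\<lambda>z. complex_of_real (f z))" if f: "continuous_on UNIV f" for f
  proof -
    have fK: "continuous_on K f" using f continuous_on_subset by blast
    have "bounded (f ` K)" by (intro compact_imp_bounded compact_continuous_image fK K)
    then obtain B where B: "\<And>z. z \<in> K \<Longrightarrow> \<bar>f z\<bar> \<le> B" unfolding bounded_iff by auto
    have "\<exists>p. real_polynomial_function p \<and> (\<forall>z\<in>K. \<bar>f z - p z\<bar> < inverse (real (Suc n)))" for n
      by (rule Stone_Weierstrass_real_polynomial_function[OF K fK, of "inverse (real (Suc n))"]) auto
    then obtain p where p: "\<And>n. real_polynomial_function (p n)"
      "\<And>n z. z \<in> K \<Longrightarrow> \<bar>f z - p n z\<bar> < inverse (real (Suc n))" by metis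
    show ?thesis
    proof (rule lim[where f="\<lambda>n z. complex_of_real (p n z)" and C="B + 1"])
      show "P (\<lambda>z. complex_of_real (p n z))" for n by (rule poly[OF p(1)])
      show "(\<lambda>z. complex_of_real (f z)) \<in> borel_measurable borel"
        by (intro borel_measurable_continuous_onI continuous_intros f)
      fix z assume z: "z \<in> K"
      show "cmod (complex_of_real (p n z)) \<le> B + 1" for n
      proof -
        have "inverse (real (Suc n)) \<le> 1" by (simp add: field_simps)
        then show ?thesis using B[OF z] p(2)[OF z, of n] by (simp add: norm_of_real)
      qed
      have "(\<lambda>n. p n z) \<longlonglongrightarrow> f z"
      proof (rule LIMSEQ_norm_0[of "\<lambda>n. p n z - f z", THEN LIM_zero_cancel])
        show "norm (p n z - f z) < 1 / real (Suc n)" for n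
          using p(2)[OF z, of n] by (simp add: abs_minus_commute inverse_eq_divide)
      qed
      then show "(\<lambda>n. complex_of_real (p n z)) \<longlonglongrightarrow> complex_of_real (f z)" by (rule tendsto_of_real)
    qed
  qed
  have opn: "P (\<lambda>z. indicator U z)" if U: "open U" for U
  \<comment> \<open>The whole space is treated apart because \<open>infdist\<close> to its empty
    complement is 0.\<close>
  proof (cases "U = UNIV")
    case False
    define h where "h k z = min 1 (real k * infdist z (- U))" for k z
    show ?thesis
    proof (rule lim[where f="\<lambda>k z. complex_of_real (h k z)" and C=1])
      show "P (\<lambda>z. complex_of_real (h n z))" for n
        unfolding h_def by (intro cont continuous_intros)
      show "(\<lambda>z. indicator U z :: complex) \<in> borel_measurable borel" using U by simp
      show "cmod (complex_of_real (h n z)) \<le> 1" for n z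
        by (simp add: h_def infdist_nonneg)
      fix z
      show "(\<lambda>n. complex_of_real (h n z)) \<longlonglongrightarrow> indicator U z"
      proof (cases "z \<in> U")
        case True
        then have "z \<notin> closure (- U)" using U by (simp add: closed_Compl)
        then have d: "infdist z (- U) > 0"
          using False infdist_nonneg[of z "- U"] in_closure_iff_infdist_zero[of "- U" z] by force
        obtain k where k: "1 / infdist z (- U) < real k" using reals_Archimedean2 by blast
        have "h j z = 1" if "k \<le> j" for j
        proof -
          have "1 \<le> real k * infdist z (- U)" using d k by (simp add: field_simps)
          also have "\<dots> \<le> real j * infdist z (- U)" using d that by (intro mult_right_mono) auto
          finally show ?thesis by (simp add: h_def)
        qed
        then have "\<forall>\<^sub>F j in sequentially. complex_of_real (h j z) = indicator U z"
          using True unfolding eventually_sequentially by (intro exI[of _ k]) auto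
        then show ?thesis by (rule tendsto_eventually)
      next
        case False
        then have "h j z = 0" for j by (simp add: h_def)
        then show ?thesis using False by simp
      qed
    qed
  qed (use const in simp)
  have ind: "P (\<lambda>z. indicator A z)" if A: "A \<in> sets borel" for A
  proof -
    have A': "A \<in> sigma_sets UNIV (Collect open)" using A by (simp add: borel_def)
    have stable: "Int_stable (Collect open :: 'a set set)" by (auto simp: Int_stable_def)
    show ?thesis
    proof (rule sigma_sets_induct_disjoint[OF stable _ A'])
      fix A :: "'a set" assume A: "P (\<lambda>z. indicator A z)"
      have "(\<lambda>z. indicator (UNIV - A) z :: complex) = (\<lambda>z. 1 + (-1) * indicator A z)"
        by (auto simp: indicator_def)
      then show "P (\<lambda>z. indicator (UNIV - A) z)" using add[OF const[of 1] scale[OF A, of "-1"]] by simp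
    next
      fix A :: "nat \<Rightarrow> 'a set"
      assume disj: "disjoint_family A" and "range A \<subseteq> sigma_sets UNIV (Collect open)"
        and PA: "\<And>i. P (\<lambda>z. indicator (A i) z)"
      then have Ab: "A i \<in> sets borel" for i by (auto simp: borel_def)
      have partial: "(\<Sum>i<n. indicator (A i) z) = (indicator (\<Union>i<n. A i) z :: complex)" for n z
        by (rule indicator_UN_disjoint[symmetric]) (use disj in \<open>auto intro: disjoint_family_on_mono\<close>)
      show "P (\<lambda>z. indicator (\<Union>i. A i) z)"
      proof (rule lim[where f="\<lambda>n z. \<Sum>i<n. indicator (A i) z" and C=1])
        show "P (\<lambda>z. \<Sum>i<n. indicator (A i) z)" for n by (intro sum PA) auto
        show "(\<lambda>z. indicator (\<Union>i. A i) z :: complex) \<in> borel_measurable borel" using Ab by simp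
        show "cmod (\<Sum>i<n. indicator (A i) z) \<le> 1" for n z unfolding partial by (simp add: indicator_def)
        show "(\<lambda>n. \<Sum>i<n. indicator (A i) z) \<longlonglongrightarrow> (indicator (\<Union>i. A i) z :: complex)" for z
          unfolding partial by (rule LIMSEQ_indicator_UN)
      qed
    qed (auto intro: opn simp: opn[of "{}", simplified])
  qed
  obtain F where F: "\<And>i. simple_function borel (F i)" "\<And>x. (\<lambda>i. F i x) \<longlonglongrightarrow> g x"
    "\<And>i x. dist (F i x) 0 \<le> 2 * dist (g x) 0"
    using borel_measurable_implies_sequence_metric[OF g(1), of 0] by auto
  have simple: "P (F i)" for i
  proof -
    have fin: "finite (range (F i))" and mr: "\<And>y. y \<in> range (F i) \<Longrightarrow> F i -` {y} \<in> sets borel"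
      using F(1)[of i] by (auto simp: simple_function_def)
    have m: "F i -` {y} \<in> sets borel" for y
    proof (cases "y \<in> range (F i)")
      case False
      then have "F i -` {y} = {}" by auto
      then show ?thesis by simp
    qed (rule mr)
    have "F i = (\<lambda>z. \<Sum>y\<in>range (F i). y * indicator (F i -` {y}) z)"
    proof
      fix z
      have "(\<Sum>y\<in>range (F i). y * indicator (F i -` {y}) z) = (\<Sum>y\<in>{F i z}. y * indicator (F i -` {y}) z)"
        by (rule sum.mono_neutral_right) (use fin in auto)
      then show "F i z = (\<Sum>y\<in>range (F i). y * indicator (F i -` {y}) z)" by simp
    qed
    moreover have "P (\<lambda>z. \<Sum>y\<in>range (F i). y * indicator (F i -` {y}) z)"
      by (intro sum fin scale ind m)
    ultimately show ?thesis by simp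
  qed
  show ?thesis
  \<comment> \<open>The approximating simple functions are bounded only by twice \<open>g\<close>,
    hence \<open>2 * C\<close>.\<close>
  proof (rule lim[where f=F and C="2 * C"])
    fix n z assume z: "z \<in> K"
    show "cmod (F n z) \<le> 2 * C" using F(3)[of n z] g(2)[OF z] by simp
  qed (use simple g F in auto)
qed

section \<open>Spectral representation on a countable sum of measures\<close>

lemma npoly_real_polynomial:
  assumes "real_polynomial_function p"
  shows "\<exists>T. npoly N (\<lambda>z. complex_of_real (p z)) T"
  using assms
proof induction
  case (linear h)
  then interpret bounded_linear h .
  \<comment> \<open>A real-linear functional on the plane is a combination of real and imaginary
    part, and these are polynomials in \<open>z\<close> and its conjugate.\<close>
  have eq: "complex_of_real (h z) = of_real (h 1) * ((1/2) * (z + cnj z)) + of_real (h \<i>) * ((-\<i>/2) * (z - cnj z))" for z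
  proof -
    have "h z = h (Re z *\<^sub>R 1 + Im z *\<^sub>R \<i>)"
      by (rule arg_cong[where f=h]) (simp add: complex_eq_iff)
    also have "\<dots> = Re z * h 1 + Im z * h \<i>" by (simp only: add scaleR real_scaleR_def)
    finally show ?thesis by (simp add: complex_eq_iff)
  qed
  have a: "npoly N (\<lambda>z. (1/2) * (z + cnj z)) (\<lambda>x. (1/2) *\<^sub>C (N x + adjoint N x))"
    by (intro npoly.mult npoly.const npoly.add npoly.ident npoly.conj)
  have b: "npoly N (\<lambda>z. (-\<i>/2) * (z - cnj z)) (\<lambda>x. (-\<i>/2) *\<^sub>C (N x - adjoint N x))"
    by (intro npoly.mult npoly.const npoly_diff npoly.ident npoly.conj)
  have c: "npoly N (\<lambda>z. of_real (h 1) * ((1/2) * (z + cnj z)) + of_real (h \<i>) * ((-\<i>/2) * (z - cnj z)))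
    (\<lambda>x. of_real (h 1) *\<^sub>C (1/2) *\<^sub>C (N x + adjoint N x) + of_real (h \<i>) *\<^sub>C (-\<i>/2) *\<^sub>C (N x - adjoint N x))"
    by (rule npoly.add[OF npoly.mult[OF npoly.const a] npoly.mult[OF npoly.const b]])
  show ?case unfolding ext[OF eq] by (rule exI, rule c)
next
  case (const c)
  show ?case using npoly.const by blast
next
  case (add f g)
  then obtain S T where "npoly N (\<lambda>z. complex_of_real (f z)) S" "npoly N (\<lambda>z. complex_of_real (g z)) T" by blast
  from npoly.add[OF this] show ?case by auto
next
  case (mult f g)
  then obtain S T where "npoly N (\<lambda>z. complex_of_real (f z)) S" "npoly N (\<lambda>z. complex_of_real (g z)) T" by blast
  from npoly.mult[OF this] show ?case by auto
qed

lemma le_zero_if_le_mult_eps: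
  fixes a C :: real
  assumes "\<And>e. e > 0 \<Longrightarrow> a \<le> C * e" "C \<ge> 0"
  shows "a \<le> 0"
proof (rule field_le_epsilon)
  fix e :: real assume e: "e > 0"
  have "a \<le> C * (e / (C + 1))" by (rule assms) (use e assms(2) in auto)
  also have "\<dots> \<le> e" using e assms(2) by (simp add: field_simps)
  finally show "a \<le> 0 + e" by simp
qed

locale normal_operator =
  fixes N :: "'a::chilbert_space \<Rightarrow> 'a" and R :: real
  assumes normal: "normal_op N" and bound: "\<And>x. norm (N x) \<le> R * norm x" and R_nonneg: "0 \<le> R"
begin

lemmas bounded = normal_op_bounded[OF normal]

text \<open>An infimum over polynomial majorants gives a value for every \<open>f\<close> at once,
  without choosing an approximating sequence or one of the operators related to a polynomial.
  \<open>lin_approx\<close> shows that approximating polynomials compute it.\<close>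

definition lin :: "'a \<Rightarrow> (complex \<Rightarrow> real) \<Rightarrow> real" where
  "lin x f = Inf {Re (cinner (T x) x) | p T. npoly N (\<lambda>z. complex_of_real (p z)) T \<and> (\<forall>z\<in>cball 0 R. f z \<le> p z)}"

text \<open>Adding the constant \<open>e\<close> to \<open>p\<close> gives a competitor in the
  infimum. Every competitor \<open>q\<close> satisfies \<open>q - p \<ge> - e\<close> on the disc,
  which \<open>npoly_form_lower_bound\<close> turns into the lower estimate.\<close>

lemma lin_approx:
  assumes T: "npoly N (\<lambda>z. complex_of_real (p z)) T" and e: "\<And>z. z \<in> cball 0 R \<Longrightarrow> \<bar>f z - p z\<bar> \<le> e"
  shows "\<bar>lin x f - Re (cinner (T x) x)\<bar> \<le> e * (norm x)\<^sup>2"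
proof -
  define A where "A = {Re (cinner (T x) x) | p T. npoly N (\<lambda>z. complex_of_real (p z)) T \<and> (\<forall>z\<in>cball 0 R. f z \<le> p z)}"
  have low: "Re (cinner (T x) x) - e * (norm x)\<^sup>2 \<le> a" if "a \<in> A" for a
  proof -
    obtain q S where S: "npoly N (\<lambda>z. complex_of_real (q z)) S" "\<And>z. z \<in> cball 0 R \<Longrightarrow> f z \<le> q z"
      "a = Re (cinner (S x) x)" using \<open>a \<in> A\<close> by (auto simp: A_def)
    have d: "npoly N (\<lambda>z. complex_of_real (q z - p z)) (\<lambda>x. S x - T x)"
      using npoly_diff[OF S(1) T] by simp
    have "(- e) * (norm x)\<^sup>2 \<le> Re (cinner (S x - T x) x)"
      by (rule npoly_form_lower_bound[OF normal bound d]) (use S(2) e in \<open>force simp: abs_le_iff\<close>)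
    then show ?thesis using S(3) by (simp add: cinner_diff_left)
  qed
  have mem: "Re (cinner (T x) x) + e * (norm x)\<^sup>2 \<in> A"
  proof -
    have n: "npoly N (\<lambda>z. complex_of_real (p z + e)) (\<lambda>x. T x + of_real e *\<^sub>C x)"
      using npoly.add[OF T npoly.const[of N "of_real e"]] by simp
    have le: "\<forall>z\<in>cball 0 R. f z \<le> p z + e" using e by (force simp: abs_le_iff)
    have eq: "Re (cinner (T x) x) + e * (norm x)\<^sup>2 = Re (cinner (T x + of_real e *\<^sub>C x) x)"
      by (simp add: cinner_add_left cinner_scaleC_left cinner_self del: of_real_power)
    show ?thesis unfolding A_def eq mem_Collect_eq
      by (rule exI[of _ "\<lambda>z. p z + e"], rule exI[of _ "\<lambda>x. T x + of_real e *\<^sub>C x"]) (use n le in simp)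
  qed
  have "lin x f \<le> Re (cinner (T x) x) + e * (norm x)\<^sup>2"
    unfolding lin_def A_def[symmetric] by (rule cInf_lower[OF mem]) (rule bdd_belowI[OF low])
  moreover have "Re (cinner (T x) x) - e * (norm x)\<^sup>2 \<le> lin x f"
    unfolding lin_def A_def[symmetric] by (rule cInf_greatest) (use mem low in auto)
  ultimately show ?thesis by (simp add: abs_le_iff)
qed

lemma npoly_approx:
  assumes f: "continuous_on UNIV f" and e: "e > (0::real)"
  obtains p T where "npoly N (\<lambda>z. complex_of_real (p z)) T" "\<And>z. z \<in> cball 0 R \<Longrightarrow> \<bar>f z - p z\<bar> \<le> e"
proof -
  have "continuous_on (cball 0 R) f" using f continuous_on_subset by blast
  then obtain p where p: "real_polynomial_function p" "\<And>z. z \<in> cball 0 R \<Longrightarrow> \<bar>f z - p z\<bar> < e"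
    using Stone_Weierstrass_real_polynomial_function[OF compact_cball _ e, of 0 R f] by blast
  obtain T where "npoly N (\<lambda>z. complex_of_real (p z)) T" using npoly_real_polynomial[OF p(1)] by blast
  then show thesis using p(2) by (intro that) (auto intro: less_imp_le)
qed

lemma positive_functional_lin: "positive_functional (cball 0 R) (lin x)"
proof
  show "compact (cball 0 R :: complex set)" by simp
next
  fix f g :: "complex \<Rightarrow> real" assume f: "continuous_on UNIV f" and g: "continuous_on UNIV g"
  have "\<bar>lin x (\<lambda>z. f z + g z) - (lin x f + lin x g)\<bar> \<le> 0"
  proof (rule le_zero_if_le_mult_eps)
    fix e :: real assume e: "e > 0"
    obtain p S where S: "npoly N (\<lambda>z. complex_of_real (p z)) S" "\<And>z. z \<in> cball 0 R \<Longrightarrow> \<bar>f z - p z\<bar> \<le> e"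
      using npoly_approx[OF f e] by blast
    obtain q T where T: "npoly N (\<lambda>z. complex_of_real (q z)) T" "\<And>z. z \<in> cball 0 R \<Longrightarrow> \<bar>g z - q z\<bar> \<le> e"
      using npoly_approx[OF g e] by blast
    have n: "npoly N (\<lambda>z. complex_of_real (p z + q z)) (\<lambda>x. S x + T x)" using npoly.add[OF S(1) T(1)] by simp
    have "\<bar>lin x (\<lambda>z. f z + g z) - Re (cinner (S x + T x) x)\<bar> \<le> (2 * e) * (norm x)\<^sup>2"
    proof (rule lin_approx[OF n])
      fix z :: complex assume z: "z \<in> cball 0 R"
      show "\<bar>f z + g z - (p z + q z)\<bar> \<le> 2 * e" using S(2)[OF z] T(2)[OF z] by linarith
    qed
    moreover have "\<bar>lin x f - Re (cinner (S x) x)\<bar> \<le> e * (norm x)\<^sup>2" by (rule lin_approx[OF S])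
    moreover have "\<bar>lin x g - Re (cinner (T x) x)\<bar> \<le> e * (norm x)\<^sup>2" by (rule lin_approx[OF T])
    ultimately show "\<bar>lin x (\<lambda>z. f z + g z) - (lin x f + lin x g)\<bar> \<le> 4 * (norm x)\<^sup>2 * e"
      by (simp add: cinner_add_left algebra_simps)
  qed simp
  then show "lin x (\<lambda>z. f z + g z) = lin x f + lin x g" by simp
next
  fix f :: "complex \<Rightarrow> real" and c :: real assume f: "continuous_on UNIV f"
  have "\<bar>lin x (\<lambda>z. c * f z) - c * lin x f\<bar> \<le> 0"
  proof (rule le_zero_if_le_mult_eps)
    fix e :: real assume e: "e > 0"
    obtain p S where S: "npoly N (\<lambda>z. complex_of_real (p z)) S" "\<And>z. z \<in> cball 0 R \<Longrightarrow> \<bar>f z - p z\<bar> \<le> e"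
      using npoly_approx[OF f e] by blast
    have n: "npoly N (\<lambda>z. complex_of_real (c * p z)) (\<lambda>x. of_real c *\<^sub>C S x)"
      using npoly.mult[OF npoly.const[of N "of_real c"] S(1)] by simp
    have 1: "\<bar>lin x (\<lambda>z. c * f z) - Re (cinner (of_real c *\<^sub>C S x) x)\<bar> \<le> (\<bar>c\<bar> * e) * (norm x)\<^sup>2"
    proof (rule lin_approx[OF n])
      fix z :: complex assume z: "z \<in> cball 0 R"
      show "\<bar>c * f z - c * p z\<bar> \<le> \<bar>c\<bar> * e"
        using mult_left_mono[OF S(2)[OF z], of "\<bar>c\<bar>"] by (simp add: abs_mult right_diff_distrib[symmetric])
    qed
    have "\<bar>lin x f - Re (cinner (S x) x)\<bar> \<le> e * (norm x)\<^sup>2" by (rule lin_approx[OF S])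
    from mult_left_mono[OF this, of "\<bar>c\<bar>"]
    have 2: "\<bar>c * lin x f - Re (cinner (of_real c *\<^sub>C S x) x)\<bar> \<le> (\<bar>c\<bar> * e) * (norm x)\<^sup>2"
      by (simp add: abs_mult[symmetric] cinner_scaleC_left right_diff_distrib)
    show "\<bar>lin x (\<lambda>z. c * f z) - c * lin x f\<bar> \<le> 2 * \<bar>c\<bar> * (norm x)\<^sup>2 * e"
      using 1 2 by (simp add: algebra_simps)
  qed simp
  then show "lin x (\<lambda>z. c * f z) = c * lin x f" by simp
next
  fix f :: "complex \<Rightarrow> real" assume f: "continuous_on UNIV f" and f0: "\<And>z. z \<in> cball 0 R \<Longrightarrow> 0 \<le> f z"
  have "- lin x f \<le> 0"
  proof (rule le_zero_if_le_mult_eps)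
    fix e :: real assume e: "e > 0"
    obtain p S where S: "npoly N (\<lambda>z. complex_of_real (p z)) S" "\<And>z. z \<in> cball 0 R \<Longrightarrow> \<bar>f z - p z\<bar> \<le> e"
      using npoly_approx[OF f e] by blast
    have "(- e) * (norm x)\<^sup>2 \<le> Re (cinner (S x) x)"
      by (rule npoly_form_lower_bound[OF normal bound S(1)]) (use f0 S(2) in \<open>force simp: abs_le_iff\<close>)
    moreover have "\<bar>lin x f - Re (cinner (S x) x)\<bar> \<le> e * (norm x)\<^sup>2" by (rule lin_approx[OF S])
    ultimately show "- lin x f \<le> 2 * (norm x)\<^sup>2 * e" by (simp add: algebra_simps)
  qed simp
  then show "0 \<le> lin x f" by simp
qed

definition vmeasure :: "'a \<Rightarrow> complex measure" where
  "vmeasure x = positive_functional.rep_measure (cball 0 R) (lin x)"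

lemma sets_vmeasure [simp, measurable_cong]: "sets (vmeasure x) = sets borel"
  unfolding vmeasure_def by (rule positive_functional.sets_rep_measure[OF positive_functional_lin])

lemma space_vmeasure [simp]: "space (vmeasure x) = UNIV"
  unfolding vmeasure_def by (rule positive_functional.space_rep_measure[OF positive_functional_lin])

lemma finite_vmeasure: "finite_measure (vmeasure x)"
  unfolding vmeasure_def by (rule positive_functional.finite_rep_measure[OF positive_functional_lin])

lemma AE_vmeasure: "AE z in vmeasure x. z \<in> cball 0 R"
  using positive_functional.emeasure_rep_measure_compl[OF positive_functional_lin, of x]
  by (intro AE_I[where N="- cball 0 R"]) (auto simp: vmeasure_def[symmetric])

text \<open>The squared modulus of \<open>f\<close> is again a polynomial, with operator
  \<open>adjoint T\<close> after \<open>T\<close>, so \<open>lin\<close> is exact on it. This is the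
  isometry from which the representation is built.\<close>

lemma sqn_vmeasure:
  assumes T: "npoly N f T"
  shows "sqn (vmeasure x) f = ennreal ((norm (T x))\<^sup>2)"
proof -
  interpret positive_functional "cball 0 R :: complex set" "lin x" by (rule positive_functional_lin)
  have fc: "continuous_on UNIV (\<lambda>z. (cmod (f z))\<^sup>2)"
    by (intro continuous_intros npoly_continuous[OF T])
  have n: "npoly N (\<lambda>z. complex_of_real ((cmod (f z))\<^sup>2)) (\<lambda>x. adjoint T (T x))"
    using npoly.mult[OF npoly_adjoint[OF bounded T] T]
    by (simp only: complex_norm_square mult.commute)
  have "\<bar>lin x (\<lambda>z. (cmod (f z))\<^sup>2) - Re (cinner (adjoint T (T x)) x)\<bar> \<le> 0 * (norm x)\<^sup>2"
    by (rule lin_approx[OF n]) simp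
  then have l: "lin x (\<lambda>z. (cmod (f z))\<^sup>2) = (norm (T x))\<^sup>2"
    by (simp add: adjoint_eq'[OF npoly_bounded[OF bounded T]] norm_sq_cinner)
  have "integrable (vmeasure x) (\<lambda>z. (cmod (f z))\<^sup>2)" "(\<integral>z. (cmod (f z))\<^sup>2 \<partial>vmeasure x) = (norm (T x))\<^sup>2"
    using integral_rep_measure[OF fc] l unfolding vmeasure_def by auto
  then show ?thesis unfolding sqn_def by (simp add: nn_integral_eq_integral)
qed

end

subsection \<open>Extending isometries to closures\<close>

text \<open>Expand \<open>0 \<le> (d * cmod a - cmod b)\<^sup>2\<close>. The first factor tends to 1
  with \<open>d\<close>, which lets norms pass exactly to limits, whereas factors 2 would give only
  bounds.\<close>

lemma cmod_add_sq_le_eps: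
  assumes "d > 0"
  shows "(cmod (a + b))\<^sup>2 \<le> (1 + d) * (cmod a)\<^sup>2 + (1 + 1/d) * (cmod b)\<^sup>2"
proof -
  have "0 \<le> (d * cmod a - cmod b)\<^sup>2 / d" using assms by simp
  also have "\<dots> = d * (cmod a)\<^sup>2 - 2 * cmod a * cmod b + (cmod b)\<^sup>2 / d"
    using assms by (simp add: power2_diff power_mult_distrib diff_divide_distrib add_divide_distrib) (simp add: power2_eq_square)
  finally have *: "2 * cmod a * cmod b \<le> d * (cmod a)\<^sup>2 + (cmod b)\<^sup>2 / d" by simp
  have "(cmod (a + b))\<^sup>2 \<le> (cmod a + cmod b)\<^sup>2" by (intro power_mono norm_triangle_ineq) auto
  also have "\<dots> = (cmod a)\<^sup>2 + (cmod b)\<^sup>2 + 2 * cmod a * cmod b" by (rule power2_sum)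
  finally show ?thesis using * by (simp add: distrib_right)
qed

lemma sqn_add_le_eps:
  assumes [measurable]: "f \<in> borel_measurable M" "g \<in> borel_measurable M" and d: "d > 0"
  shows "sqn M (\<lambda>x. f x + g x) \<le> ennreal (1 + d) * sqn M f + ennreal (1 + 1/d) * sqn M g"
proof -
  have "sqn M (\<lambda>x. f x + g x)
      \<le> (\<integral>\<^sup>+x. ennreal (1 + d) * ennreal ((cmod (f x))\<^sup>2) + ennreal (1 + 1/d) * ennreal ((cmod (g x))\<^sup>2) \<partial>M)"
    unfolding sqn_def
  proof (rule nn_integral_mono)
    fix x
    have "ennreal ((cmod (f x + g x))\<^sup>2) \<le> ennreal ((1 + d) * (cmod (f x))\<^sup>2 + (1 + 1/d) * (cmod (g x))\<^sup>2)"
      by (intro ennreal_leI cmod_add_sq_le_eps d)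
    also have "\<dots> = ennreal (1 + d) * ennreal ((cmod (f x))\<^sup>2) + ennreal (1 + 1/d) * ennreal ((cmod (g x))\<^sup>2)"
      using d by (subst ennreal_plus) (auto simp: ennreal_mult)
    finally show "ennreal ((cmod (f x + g x))\<^sup>2)
      \<le> ennreal (1 + d) * ennreal ((cmod (f x))\<^sup>2) + ennreal (1 + 1/d) * ennreal ((cmod (g x))\<^sup>2)" .
  qed
  also have "\<dots> = ennreal (1 + d) * sqn M f + ennreal (1 + 1/d) * sqn M g"
    unfolding sqn_def by (simp add: nn_integral_add nn_integral_cmult)
  finally show ?thesis .
qed

lemma ennreal_le_if_le_mult_eps:
  assumes "\<And>d. d > 0 \<Longrightarrow> (a::ennreal) \<le> ennreal (1 + d) * b"
  shows "a \<le> b"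
proof (cases "b = top")
  case False
  have "(\<lambda>n. ennreal (1 + 1 / real (Suc n)) * b) \<longlonglongrightarrow> ennreal (1 + 0) * b"
    using False by (intro tendsto_mult_ennreal tendsto_ennrealI tendsto_intros LIMSEQ_Suc[OF lim_1_over_n]) auto
  then have "(\<lambda>n. ennreal (1 + 1 / real (Suc n)) * b) \<longlonglongrightarrow> b" by simp
  then show ?thesis by (rule LIMSEQ_le_const) (use assms in auto)
qed simp

lemma sqn_limit:
  assumes [measurable]: "\<And>n. g n \<in> borel_measurable M" "f \<in> borel_measurable M"
    and gf: "(\<lambda>n. sqn M (\<lambda>x. g n x - f x)) \<longlonglongrightarrow> 0" and L: "(\<lambda>n. sqn M (g n)) \<longlonglongrightarrow> L"
  shows "sqn M f = L"
proof (rule antisym; rule ennreal_le_if_le_mult_eps)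
  fix d :: real assume d: "d > 0"
  have "sqn M f \<le> ennreal (1 + d) * sqn M (g n) + ennreal (1 + 1/d) * sqn M (\<lambda>x. g n x - f x)" for n
    using sqn_add_le_eps[OF _ _ d, of "g n" M "\<lambda>x. f x - g n x"]
    by (simp add: sqn_minus_commute[of M f])
  moreover have "(\<lambda>n. ennreal (1 + d) * sqn M (g n) + ennreal (1 + 1/d) * sqn M (\<lambda>x. g n x - f x))
      \<longlonglongrightarrow> ennreal (1 + d) * L + ennreal (1 + 1/d) * 0"
    by (intro tendsto_add ennreal_tendsto_cmult L gf) auto
  ultimately show "sqn M f \<le> ennreal (1 + d) * L" by (intro LIMSEQ_le_const) auto
next
  fix d :: real assume d: "d > 0"
  have "sqn M (g n) \<le> ennreal (1 + d) * sqn M f + ennreal (1 + 1/d) * sqn M (\<lambda>x. g n x - f x)" for n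
    using sqn_add_le_eps[OF _ _ d, of f M "\<lambda>x. g n x - f x"] by simp
  moreover have "(\<lambda>n. ennreal (1 + d) * sqn M f + ennreal (1 + 1/d) * sqn M (\<lambda>x. g n x - f x))
      \<longlonglongrightarrow> ennreal (1 + d) * sqn M f + ennreal (1 + 1/d) * 0"
    by (intro tendsto_add ennreal_tendsto_cmult gf tendsto_const) auto
  ultimately show "L \<le> ennreal (1 + d) * sqn M f" by (intro LIMSEQ_le[OF L]) auto
qed

text \<open>A relation stands in for an isometric map because neither side is yet a function of the
  other: functions matter up to null sets, and an operator is only related to its polynomial.
  Linearity and the norm identity make it single-valued in both directions.\<close>

locale l2_isometry =
  fixes M :: "'b measure" and \<R> :: "(('b \<Rightarrow> complex) \<times> 'a::chilbert_space) set"
  assumes meas: "(f, v) \<in> \<R> \<Longrightarrow> f \<in> borel_measurable M"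
    and iso: "(f, v) \<in> \<R> \<Longrightarrow> sqn M f = ennreal ((norm v)\<^sup>2)"
    and add: "(f, v) \<in> \<R> \<Longrightarrow> (g, w) \<in> \<R> \<Longrightarrow> (\<lambda>x. f x + g x, v + w) \<in> \<R>"
    and scale: "(f, v) \<in> \<R> \<Longrightarrow> (\<lambda>x. c * f x, c *\<^sub>C v) \<in> \<R>"
begin

definition cl :: "(('b \<Rightarrow> complex) \<times> 'a) set" where
  "cl = {(f, v). f \<in> borel_measurable M \<and> (\<exists>g w. (\<forall>n. (g n, w n) \<in> \<R>) \<and>
     (\<lambda>n. sqn M (\<lambda>x. g n x - f x)) \<longlonglongrightarrow> 0 \<and> w \<longlonglongrightarrow> v)}"

lemma clE:
  assumes "(f, v) \<in> cl"
  obtains g w where "\<And>n. (g n, w n) \<in> \<R>" "(\<lambda>n. sqn M (\<lambda>x. g n x - f x)) \<longlonglongrightarrow> 0" "w \<longlonglongrightarrow> v"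
    "f \<in> borel_measurable M" "\<And>n. g n \<in> borel_measurable M"
proof -
  obtain g w where "\<And>n. (g n, w n) \<in> \<R>" "(\<lambda>n. sqn M (\<lambda>x. g n x - f x)) \<longlonglongrightarrow> 0" "w \<longlonglongrightarrow> v"
    "f \<in> borel_measurable M"
    using assms unfolding cl_def by blast
  then show thesis using meas by (intro that[of g w]) auto
qed

lemma clI:
  assumes "f \<in> borel_measurable M" "\<And>n. (g n, w n) \<in> \<R>" "(\<lambda>n. sqn M (\<lambda>x. g n x - f x)) \<longlonglongrightarrow> 0" "w \<longlonglongrightarrow> v"
  shows "(f, v) \<in> cl"
  using assms unfolding cl_def by blast

lemma cl_meas: "(f, v) \<in> cl \<Longrightarrow> f \<in> borel_measurable M"
  unfolding cl_def by blast

lemma cl_base: "(f, v) \<in> \<R> \<Longrightarrow> (f, v) \<in> cl"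
  by (rule clI[where g="\<lambda>_. f" and w="\<lambda>_. v"]) (auto simp: meas)

lemma cl_add:
  assumes "(f, v) \<in> cl" "(f', v') \<in> cl"
  shows "(\<lambda>x. f x + f' x, v + v') \<in> cl"
proof -
  obtain g w where g: "\<And>n. (g n, w n) \<in> \<R>" "(\<lambda>n. sqn M (\<lambda>x. g n x - f x)) \<longlonglongrightarrow> 0" "w \<longlonglongrightarrow> v"
    and [measurable]: "f \<in> borel_measurable M" "\<And>n. g n \<in> borel_measurable M"
    using clE[OF assms(1)] by blast
  obtain g' w' where g': "\<And>n. (g' n, w' n) \<in> \<R>" "(\<lambda>n. sqn M (\<lambda>x. g' n x - f' x)) \<longlonglongrightarrow> 0" "w' \<longlonglongrightarrow> v'"
    and [measurable]: "f' \<in> borel_measurable M" "\<And>n. g' n \<in> borel_measurable M"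
    using clE[OF assms(2)] by blast
  show ?thesis
  proof (rule clI)
    show "(\<lambda>x. g n x + g' n x, w n + w' n) \<in> \<R>" for n by (intro add g g')
    show "(\<lambda>n. w n + w' n) \<longlonglongrightarrow> v + v'" by (intro tendsto_intros g g')
    have "(\<lambda>n. 2 * sqn M (\<lambda>x. g n x - f x) + 2 * sqn M (\<lambda>x. g' n x - f' x)) \<longlonglongrightarrow> 2 * 0 + 2 * 0"
      by (intro tendsto_add ennreal_tendsto_cmult g g') auto
    then have lim0: "(\<lambda>n. 2 * sqn M (\<lambda>x. g n x - f x) + 2 * sqn M (\<lambda>x. g' n x - f' x)) \<longlonglongrightarrow> 0"
      by simp
    show "(\<lambda>n. sqn M (\<lambda>x. g n x + g' n x - (f x + f' x))) \<longlonglongrightarrow> 0"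
    proof (rule ennreal_tendsto_0_squeeze[OF lim0 always_eventually], intro allI)
      fix n
      have "sqn M (\<lambda>x. g n x + g' n x - (f x + f' x)) = sqn M (\<lambda>x. (g n x - f x) + (g' n x - f' x))"
        by (rule sqn_cong) (simp add: algebra_simps)
      also have "\<dots> \<le> 2 * sqn M (\<lambda>x. g n x - f x) + 2 * sqn M (\<lambda>x. g' n x - f' x)"
        by (rule sqn_add_le) measurable
      finally show "sqn M (\<lambda>x. g n x + g' n x - (f x + f' x))
        \<le> 2 * sqn M (\<lambda>x. g n x - f x) + 2 * sqn M (\<lambda>x. g' n x - f' x)" .
    qed
  qed measurable
qed

lemma cl_scale:
  assumes "(f, v) \<in> cl"
  shows "(\<lambda>x. c * f x, c *\<^sub>C v) \<in> cl"
proof -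
  obtain g w where g: "\<And>n. (g n, w n) \<in> \<R>" "(\<lambda>n. sqn M (\<lambda>x. g n x - f x)) \<longlonglongrightarrow> 0" "w \<longlonglongrightarrow> v"
    and [measurable]: "f \<in> borel_measurable M" "\<And>n. g n \<in> borel_measurable M"
    using clE[OF assms(1)] by blast
  show ?thesis
  proof (rule clI)
    show "(\<lambda>x. c * g n x, c *\<^sub>C w n) \<in> \<R>" for n by (intro scale g)
    show "(\<lambda>n. c *\<^sub>C w n) \<longlonglongrightarrow> c *\<^sub>C v" by (intro tendsto_intros g)
    have "sqn M (\<lambda>x. c * g n x - c * f x) = ennreal ((cmod c)\<^sup>2) * sqn M (\<lambda>x. g n x - f x)" for n
      by (subst sqn_scale[symmetric]) (auto simp: right_diff_distrib)
    then show "(\<lambda>n. sqn M (\<lambda>x. c * g n x - c * f x)) \<longlonglongrightarrow> 0"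
      using ennreal_tendsto_0_mult[OF g(2), of "ennreal ((cmod c)\<^sup>2)"] by simp
  qed measurable
qed

lemma cl_diff:
  assumes "(f, v) \<in> cl" "(f', v') \<in> cl"
  shows "(\<lambda>x. f x - f' x, v - v') \<in> cl"
  using cl_add[OF assms(1) cl_scale[OF assms(2), of "-1"]] by (simp add: scaleC_minus1)

lemma cl_iso:
  assumes "(f, v) \<in> cl"
  shows "sqn M f = ennreal ((norm v)\<^sup>2)"
proof -
  obtain g w where g: "\<And>n. (g n, w n) \<in> \<R>" "(\<lambda>n. sqn M (\<lambda>x. g n x - f x)) \<longlonglongrightarrow> 0" "w \<longlonglongrightarrow> v"
    "f \<in> borel_measurable M" "\<And>n. g n \<in> borel_measurable M"
    using clE[OF assms(1)] by blast
  have "(\<lambda>n. sqn M (g n)) \<longlonglongrightarrow> ennreal ((norm v)\<^sup>2)"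
    unfolding iso[OF g(1)] by (intro tendsto_ennrealI tendsto_intros g)
  then show ?thesis by (rule sqn_limit[OF g(5,4,2)])
qed

text \<open>A diagonal argument: each pair is replaced by a member of \<open>\<R>\<close> within
  \<open>1 / Suc n\<close> in both components.\<close>

lemma cl_closed:
  assumes f: "\<And>n. (f n, v n) \<in> cl" and g [measurable]: "g \<in> borel_measurable M"
    and fg: "(\<lambda>n. sqn M (\<lambda>x. f n x - g x)) \<longlonglongrightarrow> 0" and v: "v \<longlonglongrightarrow> w"
  shows "(g, w) \<in> cl"
proof -
  note [measurable] = cl_meas[OF f]
  have "\<exists>h u. (h, u) \<in> \<R> \<and> sqn M (\<lambda>x. h x - f n x) < ennreal (1 / Suc n) \<and> norm (u - v n) < 1 / Suc n" for n
  proof -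
    obtain h u where h: "\<And>k. (h k, u k) \<in> \<R>" "(\<lambda>k. sqn M (\<lambda>x. h k x - f n x)) \<longlonglongrightarrow> 0" "u \<longlonglongrightarrow> v n"
      by (rule clE[OF f[of n]], rule that)
    have "\<forall>\<^sub>F k in sequentially. sqn M (\<lambda>x. h k x - f n x) < ennreal (1 / Suc n)"
      by (rule order_tendstoD(2)[OF h(2)]) simp
    moreover have "\<forall>\<^sub>F k in sequentially. dist (u k) (v n) < 1 / Suc n"
      by (rule tendstoD[OF h(3)]) simp
    ultimately have "\<forall>\<^sub>F k in sequentially. sqn M (\<lambda>x. h k x - f n x) < ennreal (1 / Suc n) \<and> dist (u k) (v n) < 1 / Suc n"
      by (rule eventually_conj)
    then obtain k where "sqn M (\<lambda>x. h k x - f n x) < ennreal (1 / Suc n)" "dist (u k) (v n) < 1 / Suc n"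
      unfolding eventually_sequentially by blast
    then show ?thesis using h(1) by (intro exI[of _ "h k"] exI[of _ "u k"]) (simp add: dist_norm)
  qed
  then obtain h u where h: "\<And>n. (h n, u n) \<in> \<R>" "\<And>n. sqn M (\<lambda>x. h n x - f n x) < ennreal (1 / Suc n)"
    "\<And>n. norm (u n - v n) < 1 / Suc n" by metis
  note [measurable] = meas[OF h(1)]
  show ?thesis
  proof (rule clI[OF g h(1)])
    have "(\<lambda>n. 2 * sqn M (\<lambda>x. h n x - f n x) + 2 * sqn M (\<lambda>x. f n x - g x)) \<longlonglongrightarrow> 2 * 0 + 2 * 0"
    proof (intro tendsto_add ennreal_tendsto_cmult fg)
      have "(\<lambda>n. ennreal (1 / real (Suc n))) \<longlonglongrightarrow> ennreal 0"
        by (intro tendsto_ennrealI LIMSEQ_Suc[OF lim_1_over_n])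
      then have z: "(\<lambda>n. ennreal (1 / real (Suc n))) \<longlonglongrightarrow> 0" by (simp only: ennreal_0)
      show "(\<lambda>n. sqn M (\<lambda>x. h n x - f n x)) \<longlonglongrightarrow> 0"
        by (intro ennreal_tendsto_0_squeeze[OF z always_eventually] allI less_imp_le h(2))
    qed auto
    then have lim0: "(\<lambda>n. 2 * sqn M (\<lambda>x. h n x - f n x) + 2 * sqn M (\<lambda>x. f n x - g x)) \<longlonglongrightarrow> 0" by simp
    have "sqn M (\<lambda>x. h n x - g x) \<le> 2 * sqn M (\<lambda>x. h n x - f n x) + 2 * sqn M (\<lambda>x. f n x - g x)" for n
      by (rule sqn_triangle) measurable
    then show "(\<lambda>n. sqn M (\<lambda>x. h n x - g x)) \<longlonglongrightarrow> 0"
      by (intro ennreal_tendsto_0_squeeze[OF lim0 always_eventually] allI)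
    have "(\<lambda>n. u n - v n) \<longlonglongrightarrow> 0" by (rule LIMSEQ_norm_0[OF h(3)])
    from tendsto_add[OF this v] show "u \<longlonglongrightarrow> w" by simp
  qed
qed

lemma cl_diff_norm:
  assumes "(f, v) \<in> cl" "(f', v') \<in> cl"
  shows "sqn M (\<lambda>x. f x - f' x) = ennreal ((norm (v - v'))\<^sup>2)"
  by (rule cl_iso[OF cl_diff[OF assms]])

text \<open>The isometry makes the vectors Cauchy, and completeness of the Hilbert space supplies
  their limit.\<close>

lemma cl_limit_fun:
  assumes f: "\<And>n. (f n, v n) \<in> cl" and g [measurable]: "g \<in> borel_measurable M"
    and fg: "(\<lambda>n. sqn M (\<lambda>x. f n x - g x)) \<longlonglongrightarrow> 0"
  shows "\<exists>w. (g, w) \<in> cl"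
proof -
  note [measurable] = cl_meas[OF f]
  have "Cauchy v"
  proof (rule metric_CauchyI)
    fix e :: real assume e: "e > 0"
    have "\<forall>\<^sub>F n in sequentially. sqn M (\<lambda>x. f n x - g x) < ennreal (e\<^sup>2 / 8)"
      by (rule order_tendstoD(2)[OF fg]) (use e in simp)
    then obtain n0 where n0: "\<And>n. n \<ge> n0 \<Longrightarrow> sqn M (\<lambda>x. f n x - g x) < ennreal (e\<^sup>2 / 8)"
      unfolding eventually_sequentially by blast
    show "\<exists>n0. \<forall>m\<ge>n0. \<forall>n\<ge>n0. dist (v m) (v n) < e"
    proof (intro exI allI impI)
      fix m n assume mn: "n0 \<le> m" "n0 \<le> n"
      have "ennreal ((norm (v m - v n))\<^sup>2) = sqn M (\<lambda>x. f m x - f n x)"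
        by (rule cl_diff_norm[OF f f, symmetric])
      also have "\<dots> \<le> 2 * sqn M (\<lambda>x. f m x - g x) + 2 * sqn M (\<lambda>x. g x - f n x)"
        by (rule sqn_triangle) measurable
      also have "\<dots> = 2 * sqn M (\<lambda>x. f m x - g x) + 2 * sqn M (\<lambda>x. f n x - g x)"
        by (simp add: sqn_minus_commute[of M g])
      also have "\<dots> \<le> 2 * ennreal (e\<^sup>2 / 8) + 2 * ennreal (e\<^sup>2 / 8)"
        using n0[OF mn(1)] n0[OF mn(2)] by (intro add_mono mult_left_mono less_imp_le) auto
      also have "\<dots> = ennreal 2 * ennreal (e\<^sup>2 / 8) + ennreal 2 * ennreal (e\<^sup>2 / 8)" by simp
      also have "\<dots> = ennreal (2 * (e\<^sup>2 / 8) + 2 * (e\<^sup>2 / 8))"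
        by (subst (1 2) ennreal_mult[symmetric]) (auto simp: ennreal_plus[symmetric] simp del: ennreal_plus)
      finally have "(norm (v m - v n))\<^sup>2 \<le> e\<^sup>2 / 2" by (subst (asm) ennreal_le_iff) (auto simp: field_simps)
      also have "\<dots> < e\<^sup>2" using e by simp
      finally have "(norm (v m - v n))\<^sup>2 < e\<^sup>2" .
      then show "dist (v m) (v n) < e" using e by (simp add: dist_norm power2_less_imp_less)
    qed
  qed
  then obtain w where "v \<longlonglongrightarrow> w" using Cauchy_convergent convergent_def by blast
  then show ?thesis using cl_closed[OF f g fg] by blast
qed

text \<open>The mirror image of \<open>cl_limit_fun\<close>, resting on
  \<open>L2_complete\<close>.\<close>

lemma cl_limit_vec:
  assumes f: "\<And>n. (f n, v n) \<in> cl" and v: "v \<longlonglongrightarrow> w"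
  shows "\<exists>g. (g, w) \<in> cl"
proof -
  have "\<exists>g\<in>borel_measurable M. (\<lambda>n. sqn M (\<lambda>x. f n x - g x)) \<longlonglongrightarrow> 0"
  proof (rule L2_complete)
    show "f n \<in> borel_measurable M" for n by (rule cl_meas[OF f])
    fix e :: real assume e: "e > 0"
    have "Cauchy v" using v LIMSEQ_imp_Cauchy by blast
    then obtain n0 where n0: "\<And>m n. m \<ge> n0 \<Longrightarrow> n \<ge> n0 \<Longrightarrow> dist (v m) (v n) < sqrt e"
      using metric_CauchyD[of v "sqrt e"] e by auto
    have "sqn M (\<lambda>x. f m x - f n x) \<le> ennreal e" if "m \<ge> n0" "n \<ge> n0" for m n
    proof -
      have "(norm (v m - v n))\<^sup>2 \<le> (sqrt e)\<^sup>2" using n0[OF that] by (intro power_mono) (auto simp: dist_norm)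
      then show ?thesis unfolding cl_diff_norm[OF f f] using e by (intro ennreal_leI) simp
    qed
    then show "\<exists>n0. \<forall>m\<ge>n0. \<forall>n\<ge>n0. sqn M (\<lambda>x. f m x - f n x) \<le> ennreal e" by blast
  qed
  then show ?thesis using cl_closed[OF f _ _ v] by blast
qed

lemma cl_total:
  assumes "closure (snd ` \<R>) = UNIV"
  shows "\<exists>f. (f, v) \<in> cl"
proof -
  have "v \<in> closure (snd ` \<R>)" using assms by simp
  then obtain w where w: "\<And>n. w n \<in> snd ` \<R>" "w \<longlonglongrightarrow> v" unfolding closure_sequential by blast
  then have "\<exists>f. (f, w n) \<in> \<R>" for n by (force simp: image_iff)
  then obtain f where "\<And>n. (f n, w n) \<in> cl" using cl_base by metis
  then show ?thesis using cl_limit_vec w(2) by blast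
qed

end

subsection \<open>Orthogonal cyclic subspaces\<close>

text \<open>Distinct members have distance \<open>sqrt 2\<close>, so a point of \<open>D\<close>
  lies within 1/2 of at most one of them.\<close>

lemma countable_orthonormal:
  fixes X :: "'a::complex_inner set"
  assumes D: "countable D" "closure D = (UNIV :: 'a set)"
    and norm: "\<And>u. u \<in> X \<Longrightarrow> norm u = 1" and orth: "\<And>u v. u \<in> X \<Longrightarrow> v \<in> X \<Longrightarrow> u \<noteq> v \<Longrightarrow> cinner u v = 0"
  shows "countable X"
proof -
  have "\<exists>d\<in>D. dist d u < 1/2" for u
    using closure_approachable[of u D] D(2) by (metis UNIV_I zero_less_divide_1_iff zero_less_numeral)
  then obtain d where d: "\<And>u. d u \<in> D" "\<And>u. dist (d u) u < 1/2" by metis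
  have "inj_on d X"
  proof (rule inj_onI)
    fix u v assume uv: "u \<in> X" "v \<in> X" "d u = d v"
    show "u = v"
    proof (rule ccontr)
      assume "u \<noteq> v"
      then have "(norm (u - v))\<^sup>2 = 2" by (simp add: norm_diff_sq norm uv orth)
      moreover have "dist u v < 1"
        using d(2)[of u] d(2)[of v] uv(3) dist_triangle_half_r[of "d u" u 1 v] by (simp add: dist_commute)
      then have "(norm (u - v))\<^sup>2 \<le> 1" by (simp add: dist_norm power_le_one)
      ultimately show False by simp
    qed
  qed
  moreover have "countable (d ` X)" by (rule countable_subset[OF _ D(1)]) (use d in auto)
  ultimately show ?thesis by (rule countable_image_inj_on[rotated])
qed

context normal_operator
begin

text \<open>Testing against \<open>v\<close> alone makes the whole cyclic subspaces orthogonal,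
  because an operator applied to \<open>v\<close> moves to the other side as its adjoint, which is
  again a polynomial of \<open>N\<close>.\<close>

definition orthonormal_cyclic :: "'a set \<Rightarrow> bool" where
  "orthonormal_cyclic X \<longleftrightarrow> (\<forall>u\<in>X. norm u = 1) \<and>
     (\<forall>u\<in>X. \<forall>v\<in>X. u \<noteq> v \<longrightarrow> (\<forall>f S. npoly N f S \<longrightarrow> cinner (S u) v = 0))"

lemma maximal_orthonormal_cyclic:
  "\<exists>X. orthonormal_cyclic X \<and> (\<forall>Y. orthonormal_cyclic Y \<longrightarrow> X \<subseteq> Y \<longrightarrow> Y = X)"
proof -
  have "\<exists>M\<in>Collect orthonormal_cyclic. \<forall>X\<in>Collect orthonormal_cyclic. M \<subseteq> X \<longrightarrow> X = M"
  proof (rule subset_Zorn_nonempty)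
    show "Collect orthonormal_cyclic \<noteq> {}" by (auto simp: orthonormal_cyclic_def intro!: exI[of _ "{}"])
    fix \<C> assume \<C>: "subset.chain (Collect orthonormal_cyclic) \<C>"
    then have mem: "X \<in> \<C> \<Longrightarrow> orthonormal_cyclic X" for X by (auto simp: subset.chain_def)
    have tot: "X \<subseteq> Y \<or> Y \<subseteq> X" if "X \<in> \<C>" "Y \<in> \<C>" for X Y
      using \<C> that by (auto simp: subset.chain_def)
    have "orthonormal_cyclic (\<Union>\<C>)"
      unfolding orthonormal_cyclic_def
    proof (intro conjI ballI impI allI)
      fix u assume "u \<in> \<Union>\<C>" then show "norm u = 1" using mem by (auto simp: orthonormal_cyclic_def)
    next
      fix u v f S assume u: "u \<in> \<Union>\<C>" "v \<in> \<Union>\<C>" "u \<noteq> v" "npoly N f S"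
      then obtain X Y where XY: "X \<in> \<C>" "u \<in> X" "Y \<in> \<C>" "v \<in> Y" by blast
      then obtain Z where "Z \<in> \<C>" "u \<in> Z" "v \<in> Z" using tot[of X Y] by blast
      then show "cinner (S u) v = 0" using mem[of Z] u unfolding orthonormal_cyclic_def by blast
    qed
    then show "\<Union>\<C> \<in> Collect orthonormal_cyclic" by simp
  qed
  then show ?thesis by auto
qed

definition cyclic_span :: "(nat \<Rightarrow> 'a) \<Rightarrow> 'a set" where
  "cyclic_span x = {(\<Sum>n<m. T n (x n)) | m T P. \<forall>n. npoly N (P n) (T n)}"

lemma cyclic_spanI: "(\<And>n. npoly N (P n) (T n)) \<Longrightarrow> (\<Sum>n<m. T n (x n)) \<in> cyclic_span x"
  unfolding cyclic_span_def by blast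

lemma cyclic_span_base:
  assumes "npoly N f S"
  shows "S (x k) \<in> cyclic_span x"
proof -
  define T where "T n = (if n = k then S else (\<lambda>v. 0 *\<^sub>C v))" for n
  have "(\<Sum>n<Suc k. T n (x n)) \<in> cyclic_span x"
    by (rule cyclic_spanI[where P="\<lambda>n. if n = k then f else (\<lambda>z. 0)"])
       (use assms npoly.const[of N 0] in \<open>auto simp: T_def simp del: scaleC_zero_left\<close>)
  moreover have "(\<Sum>n<Suc k. T n (x n)) = (\<Sum>n\<in>{k}. T n (x n))"
    by (rule sum.mono_neutral_right) (auto simp: T_def)
  ultimately show ?thesis by (simp add: T_def)
qed

text \<open>Zero operators beyond \<open>m\<close> let sums of different lengths be added termwise
  and let the coefficients define a function in every slot.\<close>

lemma cyclic_span_pad: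
  assumes "v \<in> cyclic_span x"
  obtains m T P where "\<And>n. npoly N (P n) (T n)" "\<And>n. n \<ge> m \<Longrightarrow> P n = (\<lambda>z. 0)"
    "\<And>n. n \<ge> m \<Longrightarrow> T n = (\<lambda>v. 0)" "v = (\<Sum>n<m. T n (x n))"
proof -
  obtain m T P where T: "\<And>n. npoly N (P n) (T n)" and v: "v = (\<Sum>n<m. T n (x n))"
    using assms by (auto simp: cyclic_span_def)
  have "npoly N (if n < m then P n else (\<lambda>z. 0)) (if n < m then T n else (\<lambda>v. 0))" for n
    using T[of n] npoly.const[of N 0] by simp
  then show thesis by (rule that[where m=m and P="\<lambda>n. if n < m then P n else (\<lambda>z. 0)"
        and T="\<lambda>n. if n < m then T n else (\<lambda>v. 0)"]) (auto simp: v)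
qed

lemma csubspace_cyclic_span: "csubspace (cyclic_span x)"
  unfolding csubspace_def
proof (intro conjI ballI allI)
  show "0 \<in> cyclic_span x"
    using cyclic_span_base[OF npoly.const[of N 0], of x 0] by simp
next
  fix u v assume "u \<in> cyclic_span x" "v \<in> cyclic_span x"
  note uv = this
  obtain m T P where
    T: "\<And>n. npoly N (P n) (T n)" "\<And>n. n \<ge> m \<Longrightarrow> T n = (\<lambda>v. 0)" "u = (\<Sum>n<m. T n (x n))"
    by (rule cyclic_span_pad[OF uv(1)], rule that)
  obtain m' T' P' where
    T': "\<And>n. npoly N (P' n) (T' n)" "\<And>n. n \<ge> m' \<Longrightarrow> T' n = (\<lambda>v. 0)" "v = (\<Sum>n<m'. T' n (x n))"
    by (rule cyclic_span_pad[OF uv(2)], rule that)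
  have "(\<Sum>n<m. T n (x n)) = (\<Sum>n<max m m'. T n (x n))"
    by (rule sum.mono_neutral_left) (auto simp: T(2))
  moreover have "(\<Sum>n<m'. T' n (x n)) = (\<Sum>n<max m m'. T' n (x n))"
    by (rule sum.mono_neutral_left) (auto simp: T'(2))
  ultimately have "u + v = (\<Sum>n<max m m'. T n (x n) + T' n (x n))"
    by (simp add: T(3) T'(3) sum.distrib)
  also have "\<dots> \<in> cyclic_span x"
    using cyclic_spanI[OF npoly.add[OF T(1) T'(1)]] by simp
  finally show "u + v \<in> cyclic_span x" .
next
  fix c u assume "u \<in> cyclic_span x"
  then obtain m T P where T: "\<And>n. npoly N (P n) (T n)" "u = (\<Sum>n<m. T n (x n))"
    by (auto simp: cyclic_span_def)
  have "c *\<^sub>C u = (\<Sum>n<m. c *\<^sub>C T n (x n))" by (simp add: T(2) scaleC_sum_right)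
  also have "\<dots> \<in> cyclic_span x" using cyclic_spanI[OF npoly.mult[OF npoly.const T(1)]] by simp
  finally show "c *\<^sub>C u \<in> cyclic_span x" .
qed

lemma cyclic_decomposition:
  assumes sep: "separable_hspace TYPE('a)"
  obtains x :: "nat \<Rightarrow> 'a" where
    "\<And>m n f S g T. m \<noteq> n \<Longrightarrow> npoly N f S \<Longrightarrow> npoly N g T \<Longrightarrow> cinner (S (x m)) (T (x n)) = 0"
    "closure (cyclic_span x) = UNIV" "\<And>n. (norm (x n))\<^sup>2 \<le> (1/2)^n"
proof -
  obtain D :: "'a set" where D: "countable D" "closure D = UNIV"
    using sep by (auto simp: separable_hspace_def)
  obtain X where X: "orthonormal_cyclic X" and max: "\<And>Y. orthonormal_cyclic Y \<Longrightarrow> X \<subseteq> Y \<Longrightarrow> Y = X"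
    using maximal_orthonormal_cyclic by blast
  have X1: "norm u = 1" if "u \<in> X" for u using X that by (simp add: orthonormal_cyclic_def)
  have X2: "cinner (S u) v = 0" if "u \<in> X" "v \<in> X" "u \<noteq> v" "npoly N f S" for u v f S
    using X that unfolding orthonormal_cyclic_def by blast
  have "cinner u v = 0" if "u \<in> X" "v \<in> X" "u \<noteq> v" for u v
    using X2[OF that npoly.const[of N 1]] by simp
  with countable_orthonormal[OF D X1] have "countable X" by blast
  then have inj: "inj_on (to_nat_on X) X" by (rule inj_on_to_nat_on)
  \<comment> \<open>A member of \<open>X\<close> sits at its number in an enumeration and other
    numbers get 0, so finite and infinite \<open>X\<close> are treated alike. The mass of a vector
    measure is the squared norm of its vector; the factor \<open>(1/2)^n\<close> makes these masses
    summable.\<close>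
  define x where "x n = (if \<exists>u\<in>X. to_nat_on X u = n
    then of_real ((1/2)^n) *\<^sub>C (THE u. u \<in> X \<and> to_nat_on X u = n) else 0)" for n
  have x_eq: "x (to_nat_on X u) = of_real ((1/2)^to_nat_on X u) *\<^sub>C u" if "u \<in> X" for u
  proof -
    have "(THE v. v \<in> X \<and> to_nat_on X v = to_nat_on X u) = u"
      by (rule the_equality) (use that inj in \<open>auto dest: inj_onD\<close>)
    then show ?thesis using that by (auto simp: x_def)
  qed
  have x_cases: "x n = 0 \<or> (\<exists>u\<in>X. n = to_nat_on X u \<and> x n = of_real ((1/2)^n) *\<^sub>C u)" for n
    using x_eq x_def by metis
  show thesis
  proof (rule that)
    fix m n :: nat and f S g T assume mn: "m \<noteq> n" and S: "npoly N f S" and T: "npoly N g T"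
    note bS = npoly_bounded[OF bounded S] and bT = npoly_bounded[OF bounded T]
    have TS: "npoly N (\<lambda>z. cnj (g z) * f z) (\<lambda>x. adjoint T (S x))"
      by (rule npoly.mult[OF npoly_adjoint[OF bounded T] S])
    consider "x m = 0" | "x n = 0" | u v where "u \<in> X" "v \<in> X" "u \<noteq> v"
      "x m = of_real ((1/2)^m) *\<^sub>C u" "x n = of_real ((1/2)^n) *\<^sub>C v"
      using x_cases[of m] x_cases[of n] mn by blast
    then show "cinner (S (x m)) (T (x n)) = 0"
    proof cases
      case 3
      then have "cinner (S u) (T v) = 0"
        using X2[OF 3(1-3) TS] by (simp add: adjoint_eq'[OF bT])
      then show ?thesis
        by (simp add: 3 bounded_clinear_scaleC[OF bS] bounded_clinear_scaleC[OF bT]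
            cinner_scaleC_left cinner_scaleC_right)
    qed (auto simp: bounded_clinear_zero[OF bS] bounded_clinear_zero[OF bT])
  next
    show "closure (cyclic_span x) = UNIV"
    proof (rule closed_csubspace_eq_UNIV)
      show "csubspace (closure (cyclic_span x))" by (intro csubspace_closure csubspace_cyclic_span)
      fix v assume v: "\<And>y. y \<in> closure (cyclic_span x) \<Longrightarrow> cinner v y = 0"
      show "v = 0"
      proof (rule ccontr)
        assume v0: "v \<noteq> 0"
        define w where "w = of_real (1 / norm v) *\<^sub>C v"
        have w1: "norm w = 1" using v0 by (simp add: w_def norm_scaleC norm_divide)
        have perp: "cinner v (S u) = 0" if u: "u \<in> X" and S: "npoly N f S" for u f S
        proof -
          have "S (x (to_nat_on X u)) \<in> closure (cyclic_span x)"
            using cyclic_span_base[OF S] closure_subset by blast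
          then have "cinner v (S (x (to_nat_on X u))) = 0" by (rule v)
          then show ?thesis
            by (simp add: x_eq[OF u] bounded_clinear_scaleC[OF npoly_bounded[OF bounded S]] cinner_scaleC_right)
        qed
        have perp1: "cinner (S u) w = 0" if "u \<in> X" "npoly N f S" for u f S
          using perp[OF that] by (simp add: w_def cinner_scaleC_right cinner_conj[of "S u" v])
        have perp2: "cinner (S w) u = 0" if u: "u \<in> X" and S: "npoly N f S" for u f S
          using perp[OF u npoly_adjoint[OF bounded S]]
          by (simp add: w_def bounded_clinear_scaleC[OF npoly_bounded[OF bounded S]] cinner_scaleC_left
              adjoint_eq[OF npoly_bounded[OF bounded S]])
        have "orthonormal_cyclic (insert w X)"
          unfolding orthonormal_cyclic_def using w1 X1 X2 perp1 perp2 by blast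
        then have "w \<in> X" using max by blast
        from perp1[OF this npoly.const[of N 1]] have "cinner w w = 0" by simp
        then show False using w1 by (simp add: cinner_self)
      qed
    qed simp
  next
    fix n
    show "(norm (x n))\<^sup>2 \<le> (1/2)^n"
      using x_cases[of n] power_le_one[of "(1/2)::real" n]
      by (auto simp: norm_scaleC X1 power2_eq_square norm_power norm_divide mult_left_le)
  qed
qed

end

subsection \<open>The representation\<close>

text \<open>The disjoint union of countably many planes. On it a direct sum of square-integrable
  function spaces is a single such space, to which \<open>L2_complete\<close> and
  \<open>l2_isometry\<close> apply.\<close>

definition slot_space :: "(nat \<times> complex) measure" where
  "slot_space = count_space UNIV \<Otimes>\<^sub>M borel"

definition slot_measure :: "(nat \<Rightarrow> complex measure) \<Rightarrow> (nat \<times> complex) measure" where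
  "slot_measure \<nu> = sum_measure slot_space (\<lambda>n. distr (\<nu> n) slot_space (Pair n))"

lemma sets_slot_measure [simp, measurable_cong]: "sets (slot_measure \<nu>) = sets slot_space"
  by (simp add: slot_measure_def)

lemma Pair_slot_measurable: "Pair n \<in> measurable borel slot_space"
  unfolding slot_space_def by measurable

lemma slot_space_measurable_iff:
  "f \<in> borel_measurable slot_space \<longleftrightarrow> (\<forall>n. (\<lambda>z. f (n, z)) \<in> borel_measurable borel)"
proof
  assume "f \<in> borel_measurable slot_space"
  then show "\<forall>n. (\<lambda>z. f (n, z)) \<in> borel_measurable borel"
    using measurable_compose[OF Pair_slot_measurable] by blast
next
  assume "\<forall>n. (\<lambda>z. f (n, z)) \<in> borel_measurable borel"
  then show "f \<in> borel_measurable slot_space"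
    unfolding slot_space_def by (intro measurable_pair_measure_countable1) auto
qed

lemma nn_integral_slot_measure:
  assumes \<nu>: "\<And>n. sets (\<nu> n) = sets borel" and f: "f \<in> borel_measurable slot_space"
  shows "(\<integral>\<^sup>+p. f p \<partial>slot_measure \<nu>) = (\<Sum>n. \<integral>\<^sup>+z. f (n, z) \<partial>\<nu> n)"
proof -
  have "Pair n \<in> measurable (\<nu> n) slot_space" for n
    using Pair_slot_measurable measurable_cong_sets[OF \<nu> refl] by blast
  then have "(\<integral>\<^sup>+p. f p \<partial>distr (\<nu> n) slot_space (Pair n)) = (\<integral>\<^sup>+z. f (n, z) \<partial>\<nu> n)" for n
    using f by (simp add: nn_integral_distr)
  then show ?thesis unfolding slot_measure_def by (subst nn_integral_sum_measure) (auto simp: f)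
qed

lemma sqn_slot_measure:
  assumes \<nu>: "\<And>n. sets (\<nu> n) = sets borel" and f: "f \<in> borel_measurable slot_space"
  shows "sqn (slot_measure \<nu>) f = (\<Sum>n. sqn (\<nu> n) (\<lambda>z. f (n, z)))"
  unfolding sqn_def using f by (intro nn_integral_slot_measure \<nu>) measurable

lemma suminf_ennreal_eq_0_iff: "(\<Sum>n. (f n :: ennreal)) = 0 \<longleftrightarrow> (\<forall>n. f n = 0)"
  by (subst suminf_eq_zero_iff) auto

lemma norm_sum_orthogonal:
  fixes f :: "'i \<Rightarrow> 'a::complex_inner"
  assumes "finite I" "\<And>i j. i \<in> I \<Longrightarrow> j \<in> I \<Longrightarrow> i \<noteq> j \<Longrightarrow> cinner (f i) (f j) = 0"
  shows "(norm (\<Sum>i\<in>I. f i))\<^sup>2 = (\<Sum>i\<in>I. (norm (f i))\<^sup>2)"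
  using assms
proof (induction rule: finite_induct)
  case (insert i I)
  have "cinner (f i) (\<Sum>i\<in>I. f i) = 0" unfolding cinner_sum_right using insert by (intro sum.neutral) auto
  then show ?case using insert by (simp add: norm_add_sq)
qed simp

text \<open>Polynomial combinations of the cyclic vectors correspond to families of polynomials,
  isometrically because the cyclic subspaces are orthogonal. The closure of this relation reaches
  every vector by density, and every square-integrable family by bounded Borel induction and
  truncation; \<open>V\<close> chooses one function for each vector.\<close>

theorem (in normal_operator) spectral_representation:
  assumes sep: "separable_hspace TYPE('a)"
  obtains \<nu> :: "nat \<Rightarrow> complex measure" and V :: "'a \<Rightarrow> nat \<Rightarrow> complex \<Rightarrow> complex" where
    "\<And>n. sets (\<nu> n) = sets borel" "\<And>n. finite_measure (\<nu> n)" "\<And>n. AE z in \<nu> n. z \<in> cball 0 R"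
    "\<And>n. emeasure (\<nu> n) UNIV \<le> ennreal ((1/2)^n)"
    "\<And>x n. V x n \<in> borel_measurable borel"
    "\<And>x. ennreal ((norm x)\<^sup>2) = (\<Sum>n. sqn (\<nu> n) (V x n))"
    "\<And>x y n. AE z in \<nu> n. V (x + y) n z = V x n z + V y n z"
    "\<And>c x n. AE z in \<nu> n. V (c *\<^sub>C x) n z = c * V x n z"
    "\<And>x n. AE z in \<nu> n. V (N x) n z = z * V x n z"
    "\<forall>g. (\<forall>n. g n \<in> borel_measurable borel) \<longrightarrow> (\<Sum>n. sqn (\<nu> n) (g n)) < \<infinity> \<longrightarrow>
       (\<exists>x. \<forall>n. AE z in \<nu> n. V x n z = g n z)"
proof -
  obtain x :: "nat \<Rightarrow> 'a" where
    orth: "\<And>m n f S g T. m \<noteq> n \<Longrightarrow> npoly N f S \<Longrightarrow> npoly N g T \<Longrightarrow> cinner (S (x m)) (T (x n)) = 0" and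
    total: "closure (cyclic_span x) = UNIV" and small: "\<And>n. (norm (x n))\<^sup>2 \<le> (1/2)^n"
    using cyclic_decomposition[OF sep] by blast
  define \<nu> where "\<nu> n = vmeasure (x n)" for n
  have sets_\<nu> [simp, measurable_cong]: "sets (\<nu> n) = sets borel" for n by (simp add: \<nu>_def)
  have m\<nu>: "borel_measurable (\<nu> n) = (borel_measurable borel :: (complex \<Rightarrow> complex) set)" for n
    by (rule measurable_cong_sets) auto
  define \<Lambda> where "\<Lambda> = slot_measure \<nu>"
  have m\<Lambda>: "borel_measurable \<Lambda> = (borel_measurable slot_space :: (nat \<times> complex \<Rightarrow> complex) set)"
    unfolding \<Lambda>_def by (rule measurable_cong_sets) auto
  have sqn_\<Lambda>: "sqn \<Lambda> f = (\<Sum>n. sqn (\<nu> n) (\<lambda>z. f (n, z)))" if "f \<in> borel_measurable slot_space" for f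
    unfolding \<Lambda>_def by (rule sqn_slot_measure[OF sets_\<nu> that])
  define \<R> where "\<R> = {(\<lambda>(n, z). P n z, \<Sum>n<m. T n (x n)) | P T m.
    (\<forall>n. npoly N (P n) (T n)) \<and> (\<forall>n\<ge>m. P n = (\<lambda>z. 0) \<and> T n = (\<lambda>v. 0))}"
  have \<R>I: "(f, v) \<in> \<R>" if "\<And>n. npoly N (P n) (T n)" "\<And>n. n \<ge> m \<Longrightarrow> P n = (\<lambda>z. 0)" "\<And>n. n \<ge> m \<Longrightarrow> T n = (\<lambda>v. 0)"
    "f = (\<lambda>(n, z). P n z)" "v = (\<Sum>n<m. T n (x n))" for P T m f v
    unfolding \<R>_def using that by blast
  have \<R>E: thesis if fv: "(f, v) \<in> \<R>" and K: "\<And>P T m. (\<And>n. npoly N (P n) (T n)) \<Longrightarrow> (\<And>n. n \<ge> m \<Longrightarrow> P n = (\<lambda>z. 0)) \<Longrightarrow>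
    (\<And>n. n \<ge> m \<Longrightarrow> T n = (\<lambda>v. 0)) \<Longrightarrow> f = (\<lambda>(n, z). P n z) \<Longrightarrow> v = (\<Sum>n<m. T n (x n)) \<Longrightarrow> thesis" for f v thesis
  proof -
    obtain P T m where "\<forall>n. npoly N (P n) (T n)" "\<forall>n\<ge>m. P n = (\<lambda>z. 0) \<and> T n = (\<lambda>v. 0)"
      "f = (\<lambda>(n, z). P n z)" "v = (\<Sum>n<m. T n (x n))"
      using fv unfolding \<R>_def by blast
    then show thesis by (intro K[of P T m]) auto
  qed
  have pmeas: "P \<in> borel_measurable borel" if "npoly N P T" for P T
    by (rule borel_measurable_continuous_onI[OF npoly_continuous[OF that]])
  have extend: "(\<Sum>n<m. T n (x n)) = (\<Sum>n<k. T n (x n))"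
    if "\<And>n. n \<ge> m \<Longrightarrow> T n = (\<lambda>v. 0)" "m \<le> k" for T :: "nat \<Rightarrow> 'a \<Rightarrow> 'a" and m k
    by (rule sum.mono_neutral_left) (use that in auto)
  interpret l2_isometry \<Lambda> \<R>
  proof
    fix f v assume fv: "(f, v) \<in> \<R>"
    obtain P T m where P: "\<And>n. npoly N (P n) (T n)" "\<And>n. n \<ge> m \<Longrightarrow> P n = (\<lambda>z. 0)" "\<And>n. n \<ge> m \<Longrightarrow> T n = (\<lambda>v. 0)"
      and f: "f = (\<lambda>(n, z). P n z)" and v: "v = (\<Sum>n<m. T n (x n))" by (rule \<R>E[OF fv], rule that)
    have fm: "f \<in> borel_measurable slot_space" using pmeas[OF P(1)] by (simp add: f slot_space_measurable_iff)
    then show "f \<in> borel_measurable \<Lambda>" by (simp add: m\<Lambda>)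
    have "sqn \<Lambda> f = (\<Sum>n. ennreal ((norm (T n (x n)))\<^sup>2))"
      unfolding sqn_\<Lambda>[OF fm] by (simp add: f \<nu>_def sqn_vmeasure[OF P(1)])
    also have "\<dots> = (\<Sum>n<m. ennreal ((norm (T n (x n)))\<^sup>2))"
      by (rule suminf_finite) (use P in auto)
    also have "\<dots> = ennreal (\<Sum>n<m. (norm (T n (x n)))\<^sup>2)" by (rule sum_ennreal) simp
    also have "(\<Sum>n<m. (norm (T n (x n)))\<^sup>2) = (norm v)\<^sup>2"
      unfolding v by (rule norm_sum_orthogonal[symmetric]) (auto intro: orth P(1))
    finally show "sqn \<Lambda> f = ennreal ((norm v)\<^sup>2)" .
  next
    fix f v g w assume fv: "(f, v) \<in> \<R>" and gw: "(g, w) \<in> \<R>"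
    obtain P T m where
      P: "\<And>n. npoly N (P n) (T n)" "\<And>n. n \<ge> m \<Longrightarrow> P n = (\<lambda>z. 0)" "\<And>n. n \<ge> m \<Longrightarrow> T n = (\<lambda>v. 0)"
        "f = (\<lambda>(n, z). P n z)" "v = (\<Sum>n<m. T n (x n))" by (rule \<R>E[OF fv], rule that)
    obtain P' T' m' where
      P': "\<And>n. npoly N (P' n) (T' n)" "\<And>n. n \<ge> m' \<Longrightarrow> P' n = (\<lambda>z. 0)" "\<And>n. n \<ge> m' \<Longrightarrow> T' n = (\<lambda>v. 0)"
        "g = (\<lambda>(n, z). P' n z)" "w = (\<Sum>n<m'. T' n (x n))" by (rule \<R>E[OF gw], rule that)
    show "(\<lambda>p. f p + g p, v + w) \<in> \<R>"
    proof (rule \<R>I[where m="max m m'"])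
      show "npoly N ((\<lambda>n z. P n z + P' n z) n) ((\<lambda>n v. T n v + T' n v) n)" for n
        using npoly.add[OF P(1) P'(1)] by simp
      show "v + w = (\<Sum>n<max m m'. T n (x n) + T' n (x n))"
        using extend[of m T "max m m'"] extend[of m' T' "max m m'"] P(3,5) P'(3,5) by (simp add: sum.distrib)
    qed (use P P' in auto)
  next
    fix f v and c :: complex assume fv: "(f, v) \<in> \<R>"
    obtain P T m where
      P: "\<And>n. npoly N (P n) (T n)" "\<And>n. n \<ge> m \<Longrightarrow> P n = (\<lambda>z. 0)" "\<And>n. n \<ge> m \<Longrightarrow> T n = (\<lambda>v. 0)"
        "f = (\<lambda>(n, z). P n z)" "v = (\<Sum>n<m. T n (x n))" by (rule \<R>E[OF fv], rule that)
    show "(\<lambda>p. c * f p, c *\<^sub>C v) \<in> \<R>"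
    proof (rule \<R>I[where m=m])
      show "npoly N ((\<lambda>n z. c * P n z) n) ((\<lambda>n v. c *\<^sub>C T n v) n)" for n
        using npoly.mult[OF npoly.const P(1)] by simp
    qed (use P in \<open>auto simp: scaleC_sum_right\<close>)
  qed
  \<comment> \<open>Multiplication by \<open>z\<close> is bounded by \<open>R\<close> on the disc
    that carries every \<open>\<nu> n\<close>, so the intertwining with \<open>N\<close> passes from
    polynomials to the closure.\<close>
  have cl_mult: "(\<lambda>(n, z). z * f (n, z), N v) \<in> cl" if fv: "(f, v) \<in> cl" for f v
  proof -
    obtain g w where g: "\<And>n. (g n, w n) \<in> \<R>" "(\<lambda>n. sqn \<Lambda> (\<lambda>x. g n x - f x)) \<longlonglongrightarrow> 0" "w \<longlonglongrightarrow> v"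
      and fm: "f \<in> borel_measurable \<Lambda>" and gm: "\<And>n. g n \<in> borel_measurable \<Lambda>"
      by (rule clE[OF fv], rule that)
    show ?thesis
    proof (rule clI)
      have fn: "(\<lambda>z. f (n, z)) \<in> borel_measurable borel" for n
        using fm by (simp add: m\<Lambda> slot_space_measurable_iff)
      have gn: "(\<lambda>z. g k (n, z)) \<in> borel_measurable borel" for n k
        using gm[of k] by (simp add: m\<Lambda> slot_space_measurable_iff)
      show "(\<lambda>(n, z). z * f (n, z)) \<in> borel_measurable \<Lambda>"
        using fn by (simp add: m\<Lambda> slot_space_measurable_iff)
      show "(\<lambda>k. N (w k)) \<longlonglongrightarrow> N v" by (rule bounded_clinear_tendsto[OF bounded g(3)])
      show "(\<lambda>(n, z). z * g k (n, z), N (w k)) \<in> \<R>" for k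
      proof -
        obtain P T m where
          P: "\<And>n. npoly N (P n) (T n)" "\<And>n. n \<ge> m \<Longrightarrow> P n = (\<lambda>z. 0)" "\<And>n. n \<ge> m \<Longrightarrow> T n = (\<lambda>v. 0)"
            "g k = (\<lambda>(n, z). P n z)" "w k = (\<Sum>n<m. T n (x n))" by (rule \<R>E[OF g(1)[of k]], rule that)
        show ?thesis
        proof (rule \<R>I[where m=m])
          show "npoly N ((\<lambda>n z. z * P n z) n) ((\<lambda>n v. N (T n v)) n)" for n
            using npoly.mult[OF npoly.ident P(1)] by simp
        qed (use P in \<open>auto simp: bounded_clinear_sum[OF bounded] bounded_clinear_zero[OF bounded]\<close>)
      qed
      show "(\<lambda>k. sqn \<Lambda> (\<lambda>p. (case p of (n, z) \<Rightarrow> z * g k (n, z)) - (case p of (n, z) \<Rightarrow> z * f (n, z)))) \<longlonglongrightarrow> 0"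
      proof (rule ennreal_tendsto_0_squeeze[OF ennreal_tendsto_0_mult[OF g(2), of "ennreal (R\<^sup>2)"] always_eventually], simp, intro allI)
        fix k
        have "sqn \<Lambda> (\<lambda>p. (case p of (n, z) \<Rightarrow> z * g k (n, z)) - (case p of (n, z) \<Rightarrow> z * f (n, z)))
            = (\<Sum>n. sqn (\<nu> n) (\<lambda>z. z * g k (n, z) - z * f (n, z)))"
          by (subst sqn_\<Lambda>) (use fn gn in \<open>auto simp: slot_space_measurable_iff\<close>)
        also have "\<dots> \<le> (\<Sum>n. ennreal (R\<^sup>2) * sqn (\<nu> n) (\<lambda>z. g k (n, z) - f (n, z)))"
        proof (intro suminf_le allI)
          fix n
          have "sqn (\<nu> n) (\<lambda>z. z * g k (n, z) - z * f (n, z))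
              \<le> (\<integral>\<^sup>+z. ennreal (R\<^sup>2) * ennreal ((cmod (g k (n, z) - f (n, z)))\<^sup>2) \<partial>\<nu> n)"
            unfolding sqn_def
          proof (rule nn_integral_mono_AE)
            show "AE z in \<nu> n. ennreal ((cmod (z * g k (n, z) - z * f (n, z)))\<^sup>2)
                \<le> ennreal (R\<^sup>2) * ennreal ((cmod (g k (n, z) - f (n, z)))\<^sup>2)"
              using AE_vmeasure[of "x n"] unfolding \<nu>_def
            proof eventually_elim
              case (elim z)
              have "(cmod (z * g k (n, z) - z * f (n, z)))\<^sup>2 = (cmod z)\<^sup>2 * (cmod (g k (n, z) - f (n, z)))\<^sup>2"
                by (simp add: norm_mult power_mult_distrib right_diff_distrib[symmetric])
              also have "\<dots> \<le> R\<^sup>2 * (cmod (g k (n, z) - f (n, z)))\<^sup>2"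
                using elim by (intro mult_right_mono power_mono) auto
              finally show ?case by (subst ennreal_mult[symmetric]) (auto intro: ennreal_leI)
            qed
          qed
          also have "\<dots> = ennreal (R\<^sup>2) * sqn (\<nu> n) (\<lambda>z. g k (n, z) - f (n, z))"
          proof -
            have [measurable]: "(\<lambda>z. f (n, z)) \<in> borel_measurable (\<nu> n)" "(\<lambda>z. g k (n, z)) \<in> borel_measurable (\<nu> n)"
              using fn gn by (simp_all add: m\<nu>)
            show ?thesis unfolding sqn_def by (intro nn_integral_cmult) measurable
          qed
          finally show "sqn (\<nu> n) (\<lambda>z. z * g k (n, z) - z * f (n, z))
            \<le> ennreal (R\<^sup>2) * sqn (\<nu> n) (\<lambda>z. g k (n, z) - f (n, z))" .
        qed auto
        also have "\<dots> = ennreal (R\<^sup>2) * sqn \<Lambda> (\<lambda>p. g k p - f p)"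
          by (subst sqn_\<Lambda>) (use fm gm in \<open>auto simp: m\<Lambda>\<close>)
        finally show "sqn \<Lambda> (\<lambda>p. (case p of (n, z) \<Rightarrow> z * g k (n, z)) - (case p of (n, z) \<Rightarrow> z * f (n, z)))
          \<le> ennreal (R\<^sup>2) * sqn \<Lambda> (\<lambda>p. g k p - f p)" .
      qed
    qed
  qed
  have slot: "\<exists>v. (\<lambda>(n, z). if n = k then f z else 0, v) \<in> cl"
    if f: "f \<in> borel_measurable borel" "\<And>z. z \<in> cball 0 R \<Longrightarrow> cmod (f z) \<le> C" for k f C
  proof (rule borel_bounded_induct[where K="cball 0 R" and g=f and C=C])
    fix p :: "complex \<Rightarrow> real" assume "real_polynomial_function p"
    then obtain T where T: "npoly N (\<lambda>z. complex_of_real (p z)) T" using npoly_real_polynomial by blast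
    have "(\<lambda>(n, z). if n = k then complex_of_real (p z) else 0,
        \<Sum>n<Suc k. (if n = k then T else (\<lambda>v. 0)) (x n)) \<in> \<R>"
    proof (rule \<R>I[where m="Suc k"])
      show "npoly N ((\<lambda>n. if n = k then (\<lambda>z. complex_of_real (p z)) else (\<lambda>z. 0)) n)
        ((\<lambda>n. if n = k then T else (\<lambda>v. 0)) n)" for n
        using T npoly.const[of N 0] by simp
    qed (auto simp: fun_eq_iff)
    then show "\<exists>v. (\<lambda>(n, z). if n = k then complex_of_real (p z) else 0, v) \<in> cl" using cl_base by blast
  next
    fix f g assume "\<exists>v. (\<lambda>(n, z). if n = k then f z else 0, v) \<in> cl" "\<exists>v. (\<lambda>(n, z). if n = k then g z else 0, v) \<in> cl"
    then obtain v w where "(\<lambda>(n, z). if n = k then f z else 0, v) \<in> cl" "(\<lambda>(n, z). if n = k then g z else 0, w) \<in> cl" by blast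
    from cl_add[OF this] show "\<exists>v. (\<lambda>(n, z). if n = k then f z + g z else 0, v) \<in> cl"
      by (intro exI) (erule back_subst[where P="\<lambda>h. (h, v + w) \<in> cl"], auto simp: fun_eq_iff)
  next
    fix c f assume "\<exists>v. (\<lambda>(n, z). if n = k then f z else 0, v) \<in> cl"
    then obtain v where "(\<lambda>(n, z). if n = k then f z else 0, v) \<in> cl" by blast
    from cl_scale[OF this, of c] show "\<exists>v. (\<lambda>(n, z). if n = k then c * f z else 0, v) \<in> cl"
      by (intro exI) (erule back_subst[where P="\<lambda>h. (h, c *\<^sub>C v) \<in> cl"], auto simp: fun_eq_iff)
  next
    fix f :: "nat \<Rightarrow> complex \<Rightarrow> complex" and g C
    assume ex: "\<And>i. \<exists>v. (\<lambda>(n, z). if n = k then f i z else 0, v) \<in> cl" and g: "g \<in> borel_measurable borel"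
      and b: "\<And>i z. z \<in> cball 0 R \<Longrightarrow> cmod (f i z) \<le> C" and l: "\<And>z. z \<in> cball 0 R \<Longrightarrow> (\<lambda>i. f i z) \<longlonglongrightarrow> g z"
    obtain v where v: "\<And>i. (\<lambda>(n, z). if n = k then f i z else 0, v i) \<in> cl" using ex by metis
    have fm: "f i \<in> borel_measurable borel" for i
      using cl_meas[OF v[of i]] by (auto simp: m\<Lambda> slot_space_measurable_iff dest: spec[of _ k])
    have gm: "(\<lambda>(n, z). if n = k then g z else 0) \<in> borel_measurable slot_space"
      unfolding slot_space_measurable_iff
    proof
      fix n show "(\<lambda>z. case (n, z) of (n, z) \<Rightarrow> if n = k then g z else 0) \<in> borel_measurable borel"
        using g by (cases "n = k") auto
    qed
    show "\<exists>v. (\<lambda>(n, z). if n = k then g z else 0, v) \<in> cl"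
    proof (rule cl_limit_fun[OF v])
      show "(\<lambda>(n, z). if n = k then g z else 0) \<in> borel_measurable \<Lambda>" using gm by (simp add: m\<Lambda>)
      have eq: "sqn \<Lambda> (\<lambda>p. (case p of (n, z) \<Rightarrow> if n = k then f i z else 0) - (case p of (n, z) \<Rightarrow> if n = k then g z else 0))
          = sqn (\<nu> k) (\<lambda>z. f i z - g z)" for i
      proof -
        have "sqn \<Lambda> (\<lambda>p. (case p of (n, z) \<Rightarrow> if n = k then f i z else 0) - (case p of (n, z) \<Rightarrow> if n = k then g z else 0))
          = (\<Sum>n. sqn (\<nu> n) (\<lambda>z. (if n = k then f i z else 0) - (if n = k then g z else 0)))"
        proof -
          have "(\<lambda>p. (case p of (n, z) \<Rightarrow> if n = k then f i z else 0) - (case p of (n, z) \<Rightarrow> if n = k then g z else 0))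
            \<in> borel_measurable slot_space"
            by (rule borel_measurable_diff[OF _ gm]) (use cl_meas[OF v[of i]] in \<open>simp only: m\<Lambda>\<close>)
          from sqn_\<Lambda>[OF this] show ?thesis by simp
        qed
        also have "\<dots> = (\<Sum>n\<in>{k}. sqn (\<nu> n) (\<lambda>z. (if n = k then f i z else 0) - (if n = k then g z else 0)))"
          by (rule suminf_finite) auto
        finally show ?thesis by simp
      qed
      have "(\<lambda>i. sqn (\<nu> k) (\<lambda>z. f i z - g z)) \<longlonglongrightarrow> 0"
      proof (rule sqn_dominated[where w="\<lambda>z. complex_of_real C"])
        show "sqn (\<nu> k) (\<lambda>z. complex_of_real C) < top"
          unfolding sqn_def using finite_measure.emeasure_finite[OF finite_vmeasure]
          by (simp add: \<nu>_def ennreal_mult_less_top less_top)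
        show "AE z in \<nu> k. cmod (f i z) \<le> cmod (complex_of_real C)" for i
          using AE_vmeasure[of "x k"] unfolding \<nu>_def by eventually_elim (use b[of _ i] abs_ge_self[of C] order_trans in \<open>simp only: norm_of_real, blast\<close>)
        show "AE z in \<nu> k. (\<lambda>i. f i z) \<longlonglongrightarrow> g z"
          using AE_vmeasure[of "x k"] unfolding \<nu>_def by eventually_elim (use l in auto)
      qed (use fm g in \<open>auto simp: m\<nu>\<close>)
      then show "(\<lambda>i. sqn \<Lambda> (\<lambda>p. (case p of (n, z) \<Rightarrow> if n = k then f i z else 0)
        - (case p of (n, z) \<Rightarrow> if n = k then g z else 0))) \<longlonglongrightarrow> 0" by (simp only: eq)
    qed
  qed (use f in auto)
  have all: "\<exists>v. (g, v) \<in> cl" if g: "g \<in> borel_measurable slot_space" and fin: "sqn \<Lambda> g < \<infinity>" for g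
  proof -
    have gn: "(\<lambda>z. g (n, z)) \<in> borel_measurable borel" for n using g by (simp add: slot_space_measurable_iff)
    \<comment> \<open>Truncating both slots and values leaves finitely many bounded pieces, each
      reached by \<open>slot\<close>; \<open>h m\<close> is dominated by \<open>g\<close> and agrees
      with it at each point from some \<open>m\<close> on.\<close>
    define h where "h m = (\<lambda>(n, z). if n < m \<and> cmod (g (n, z)) \<le> real m then g (n, z) else 0)" for m
    have hn: "(\<lambda>z. if cmod (g (n, z)) \<le> real m then g (n, z) else 0) \<in> borel_measurable borel" for n m
      using gn[of n] by measurable
    have partial: "\<exists>v. (\<lambda>(n, z). if n < j \<and> cmod (g (n, z)) \<le> real m then g (n, z) else 0, v) \<in> cl" for j m
    proof (induction j)
      case 0
      show ?case using slot[of "\<lambda>z. 0" 0 0] by (simp add: case_prod_unfold)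
    next
      case (Suc j)
      then obtain v where v: "(\<lambda>(n, z). if n < j \<and> cmod (g (n, z)) \<le> real m then g (n, z) else 0, v) \<in> cl" by blast
      obtain w where w: "(\<lambda>(n, z). if n = j then (if cmod (g (j, z)) \<le> real m then g (j, z) else 0) else 0, w) \<in> cl"
      proof -
        have "cmod (if cmod (g (j, z)) \<le> real m then g (j, z) else 0) \<le> real m" for z by simp
        from slot[OF hn this, of j] show ?thesis using that by blast
      qed
      have "(\<lambda>p. (case p of (n, z) \<Rightarrow> if n < j \<and> cmod (g (n, z)) \<le> real m then g (n, z) else 0) +
          (case p of (n, z) \<Rightarrow> if n = j then (if cmod (g (j, z)) \<le> real m then g (j, z) else 0) else 0))
        = (\<lambda>(n, z). if n < Suc j \<and> cmod (g (n, z)) \<le> real m then g (n, z) else 0)"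
        by (auto simp: fun_eq_iff less_Suc_eq)
      with cl_add[OF v w] show ?case by auto
    qed
    have "\<forall>m. \<exists>v. (h m, v) \<in> cl" unfolding h_def by (rule allI, rule partial)
    from choice[OF this] obtain v where v: "\<And>m. (h m, v m) \<in> cl" by blast
    show ?thesis
    proof (rule cl_limit_fun[OF v])
      show "g \<in> borel_measurable \<Lambda>" using g by (simp add: m\<Lambda>)
      show "(\<lambda>m. sqn \<Lambda> (\<lambda>p. h m p - g p)) \<longlonglongrightarrow> 0"
      proof (rule sqn_dominated[where w=g])
        show "AE p in \<Lambda>. cmod (h m p) \<le> cmod (g p)" for m by (auto simp: h_def)
        have "(\<lambda>m. h m p) \<longlonglongrightarrow> g p" for p
        proof (rule tendsto_eventually)
          obtain k where k: "cmod (g p) \<le> real k" using real_arch_simple by blast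
          show "\<forall>\<^sub>F m in sequentially. h m p = g p"
            using eventually_ge_at_top[of "max k (Suc (fst p))"]
            by eventually_elim (use k in \<open>auto simp: h_def split: prod.splits\<close>)
        qed
        then show "AE p in \<Lambda>. (\<lambda>m. h m p) \<longlonglongrightarrow> g p" by simp
      qed (use fin g cl_meas[OF v] in \<open>auto simp: m\<Lambda>\<close>)
    qed
  qed
  have "closure (snd ` \<R>) = UNIV"
  proof -
    have "cyclic_span x \<subseteq> snd ` \<R>"
    proof
      fix v assume v: "v \<in> cyclic_span x"
      obtain m T P where "\<And>n. npoly N (P n) (T n)" "\<And>n. n \<ge> m \<Longrightarrow> P n = (\<lambda>z. 0)"
        "\<And>n. n \<ge> m \<Longrightarrow> T n = (\<lambda>v. 0)" "v = (\<Sum>n<m. T n (x n))" by (rule cyclic_span_pad[OF v], rule that)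
      then have "((\<lambda>(n, z). P n z), v) \<in> \<R>" by (intro \<R>I[of P T m]) auto
      then show "v \<in> snd ` \<R>" by (rule image_eqI[rotated]) simp
    qed
    then show ?thesis using closure_mono[of "cyclic_span x" "snd ` \<R>"] total by auto
  qed
  then have "\<forall>v. \<exists>f. (f, v) \<in> cl" using cl_total by blast
  from choice[OF this] obtain F where F: "\<And>v. (F v, v) \<in> cl" by blast
  define V where "V v n z = F v (n, z)" for v n z
  have Fm: "F v \<in> borel_measurable slot_space" for v using cl_meas[OF F] by (simp add: m\<Lambda>)
  \<comment> \<open>\<open>V\<close> was chosen arbitrarily, so each of its algebraic properties is
    obtained by comparison with another function paired with the same vector.\<close>
  have unique: "AE z in \<nu> n. V v n z = g (n, z)" if gv: "(g, v) \<in> cl" for g v n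
  proof -
    have gm: "g \<in> borel_measurable slot_space" using cl_meas[OF gv] by (simp add: m\<Lambda>)
    have "sqn \<Lambda> (\<lambda>p. F v p - g p) = 0" using cl_diff_norm[OF F gv] by simp
    then have "(\<Sum>n. sqn (\<nu> n) (\<lambda>z. F v (n, z) - g (n, z))) = 0"
      by (subst (asm) sqn_\<Lambda>) (use Fm gm in auto)
    then have "sqn (\<nu> n) (\<lambda>z. F v (n, z) - g (n, z)) = 0" by (simp add: suminf_ennreal_eq_0_iff)
    then have "AE z in \<nu> n. F v (n, z) - g (n, z) = 0"
      by (subst (asm) sqn_eq_0_iff)
         (use Fm[of v] gm in \<open>auto simp: m\<nu> slot_space_measurable_iff intro!: borel_measurable_diff\<close>)
    then show ?thesis by (simp add: V_def)
  qed
  show thesis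
  proof (rule that)
    show "sets (\<nu> n) = sets borel" "finite_measure (\<nu> n)" "AE z in \<nu> n. z \<in> cball 0 R" for n
      unfolding \<nu>_def by (rule sets_vmeasure finite_vmeasure AE_vmeasure)+
    show "emeasure (\<nu> n) UNIV \<le> ennreal ((1/2)^n)" for n
    proof -
      have "emeasure (\<nu> n) UNIV = sqn (vmeasure (x n)) (\<lambda>z. 1)" by (simp add: sqn_def \<nu>_def)
      also have "\<dots> = ennreal ((norm (x n))\<^sup>2)" using sqn_vmeasure[OF npoly.const[of N 1], of "x n"] by simp
      also have "\<dots> \<le> ennreal ((1/2)^n)" by (rule ennreal_leI[OF small])
      finally show ?thesis .
    qed
    show "V v n \<in> borel_measurable borel" for v n
      using Fm[of v] by (simp add: V_def[abs_def] slot_space_measurable_iff)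
    show "ennreal ((norm v)\<^sup>2) = (\<Sum>n. sqn (\<nu> n) (V v n))" for v
      using cl_iso[OF F[of v]] sqn_\<Lambda>[OF Fm] by (simp add: V_def[abs_def])
    show "AE z in \<nu> n. V (v + w) n z = V v n z + V w n z" for v w n
      using unique[OF cl_add[OF F[of v] F[of w]], of n] by (simp add: V_def)
    show "AE z in \<nu> n. V (c *\<^sub>C v) n z = c * V v n z" for c v n
      using unique[OF cl_scale[OF F[of v], of c], of n] by (simp add: V_def)
    show "AE z in \<nu> n. V (N v) n z = z * V v n z" for v n
      using unique[OF cl_mult[OF F[of v]], of n] by (simp add: V_def)
    show "\<forall>g. (\<forall>n. g n \<in> borel_measurable borel) \<longrightarrow> (\<Sum>n. sqn (\<nu> n) (g n)) < \<infinity> \<longrightarrow>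
       (\<exists>x. \<forall>n. AE z in \<nu> n. V x n z = g n z)"
    proof (intro allI impI)
      fix g :: "nat \<Rightarrow> complex \<Rightarrow> complex"
      assume g: "\<forall>n. g n \<in> borel_measurable borel" and fin: "(\<Sum>n. sqn (\<nu> n) (g n)) < \<infinity>"
      have gm: "(\<lambda>(n, z). g n z) \<in> borel_measurable slot_space" using g by (simp add: slot_space_measurable_iff)
      obtain v where "(\<lambda>(n, z). g n z, v) \<in> cl" using all[OF gm] fin by (auto simp: sqn_\<Lambda>[OF gm])
      from unique[OF this] show "\<exists>x. \<forall>n. AE z in \<nu> n. V x n z = g n z" by auto
    qed
  qed
qed

section \<open>The multiplicity decomposition\<close>

text \<open>Raising the bound by 1 raises the count by at most 1, so no value is skipped.\<close>

lemma rank_surj: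
  fixes A :: "nat set"
  assumes "j < card {i\<in>A. i < m}"
  shows "\<exists>n\<in>A. card {i\<in>A. i < n} = j"
  using assms
proof (induction m)
  case (Suc m)
  have "{i\<in>A. i < Suc m} = (if m \<in> A then insert m {i\<in>A. i < m} else {i\<in>A. i < m})"
    by (auto simp: less_Suc_eq)
  then have card: "card {i\<in>A. i < Suc m} = (if m \<in> A then Suc (card {i\<in>A. i < m}) else card {i\<in>A. i < m})"
    by simp
  show ?case
  proof (cases "j < card {i\<in>A. i < m}")
    case False
    then have "m \<in> A" "card {i\<in>A. i < m} = j" using Suc.prems card by (auto split: if_splits)
    then show ?thesis by blast
  qed (rule Suc.IH)
qed simp

text \<open>The rank enumerates \<open>A\<close> in increasing order. An infinite \<open>A\<close>
  has \<open>card\<close> 0 and \<open>copies 0\<close> is the set of all naturals, so one formula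
  serves both cases; the empty set has \<open>card\<close> 0 as well and is excluded.\<close>

lemma rank_bij_copies:
  fixes A :: "nat set"
  assumes ne: "A \<noteq> {}"
  shows "bij_betw (\<lambda>n. card {i\<in>A. i < n}) A (copies (card A))"
  unfolding bij_betw_def
proof
  show inj: "inj_on (\<lambda>n. card {i\<in>A. i < n}) A"
  proof (rule linorder_inj_onI)
    fix m n assume "m < n" "m \<in> A" "n \<in> A"
    then have "{i\<in>A. i < m} \<subset> {i\<in>A. i < n}" by auto
    then have "card {i\<in>A. i < m} < card {i\<in>A. i < n}" by (rule psubset_card_mono[rotated]) simp
    then show "card {i\<in>A. i < m} \<noteq> card {i\<in>A. i < n}" by simp
  qed auto
  show "(\<lambda>n. card {i\<in>A. i < n}) ` A = copies (card A)"
  proof (intro equalityI subsetI)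
    fix j assume "j \<in> (\<lambda>n. card {i\<in>A. i < n}) ` A"
    then obtain n where n: "n \<in> A" "j = card {i\<in>A. i < n}" by auto
    show "j \<in> copies (card A)"
    proof (cases "finite A")
      case True
      have "{i\<in>A. i < n} \<subset> A" using n(1) by auto
      then show ?thesis using n(2) psubset_card_mono[OF True] by (auto simp: copies_def)
    qed (simp add: copies_def)
  next
    fix j assume j: "j \<in> copies (card A)"
    have "\<exists>m. j < card {i\<in>A. i < m}"
    proof (cases "finite A")
      case True
      then have "{i\<in>A. i < Suc (Max A)} = A" by (auto simp: less_Suc_eq_le)
      moreover have "j < card A" using j ne True by (auto simp: copies_def split: if_splits)
      ultimately show ?thesis by metis
    next
      case False
      then obtain B where B: "B \<subseteq> A" "finite B" "card B = Suc j" using infinite_arbitrarily_large by metis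
      then have "B \<subseteq> {i\<in>A. i < Suc (Max B)}" by (auto simp: less_Suc_eq_le)
      then have "card B \<le> card {i\<in>A. i < Suc (Max B)}" by (intro card_mono) auto
      then show ?thesis using B(3) by (intro exI[of _ "Suc (Max B)"]) simp
    qed
    then show "j \<in> (\<lambda>n. card {i\<in>A. i < n}) ` A" using rank_surj[of j A] by auto
  qed
qed

text \<open>Sums become integrals for counting measures, where a bijection is a change of
  variables.\<close>

lemma suminf_copies_reindex:
  fixes f :: "nat \<Rightarrow> ennreal"
  assumes bij: "bij_betw r A (copies k)" and 0: "\<And>n. n \<notin> A \<Longrightarrow> f n = 0"
    and s: "\<And>n. n \<in> A \<Longrightarrow> s (r n) = n"
  shows "(\<Sum>j. if j \<in> copies k then f (s j) else 0) = (\<Sum>n. f n)"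
proof -
  have "(\<Sum>j. if j \<in> copies k then f (s j) else 0) = (\<integral>\<^sup>+j. (if j \<in> copies k then f (s j) else 0) \<partial>count_space UNIV)"
    by (simp add: nn_integral_count_space_nat)
  also have "\<dots> = (\<integral>\<^sup>+j. f (s j) \<partial>count_space (copies k))"
    by (subst nn_integral_count_space_indicator) (auto intro!: nn_integral_cong)
  also have "\<dots> = (\<integral>\<^sup>+n. f (s (r n)) \<partial>count_space A)"
    by (rule nn_integral_bij_count_space[OF bij, symmetric])
  also have "\<dots> = (\<integral>\<^sup>+n. f n \<partial>count_space A)" by (rule nn_integral_cong) (simp add: s)
  also have "\<dots> = (\<integral>\<^sup>+n. f n \<partial>count_space UNIV)"
    by (subst nn_integral_count_space_indicator) (auto intro!: nn_integral_cong simp: 0 indicator_def)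
  finally show ?thesis by (simp add: nn_integral_count_space_nat)
qed

lemma suminf_single:
  fixes f :: "nat \<Rightarrow> ennreal"
  shows "(\<Sum>n. if n = k then f n else 0) = f k"
proof -
  have "(\<Sum>n. if n = k then f n else 0) = (\<Sum>n\<in>{k}. if n = k then f n else 0)"
    by (rule suminf_finite) auto
  then show ?thesis by simp
qed

lemma cs_regular_borel_finite:
  fixes M :: "complex measure"
  assumes "sets M = sets borel" "finite_measure M" "compact K" "AE z in M. z \<in> K"
  shows "cs_regular_borel M"
proof -
  interpret finite_measure M by fact
  have sp: "space M = UNIV" using sets_eq_imp_space_eq[OF assms(1)] by simp
  have fin: "emeasure M (space M) \<noteq> \<infinity>" by (simp add: emeasure_eq_measure)
  have null: "emeasure M (space M - K) = 0"
    using emeasure_eq_0_AE[of "\<lambda>x. x \<notin> K" M] assms(4) by (simp add: set_diff_eq)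
  show ?thesis
    unfolding cs_regular_borel_def
  proof (intro conjI ballI)
    show "emeasure M (space M) < \<infinity>" by (simp add: emeasure_eq_measure)
    fix B assume "B \<in> sets M"
    then have B: "B \<in> sets borel" by (simp add: assms(1))
    show "emeasure M B = (INF U\<in>{U. open U \<and> B \<subseteq> U}. emeasure M U)"
      using outer_regular[OF assms(1) fin B] by (simp add: conj_commute)
    show "emeasure M B = (SUP K\<in>{K. compact K \<and> K \<subseteq> B}. emeasure M K)"
      using inner_regular[OF assms(1) fin B] by (simp add: conj_commute)
  qed (use assms null in auto)
qed

text \<open>The dominating measure \<open>\<sigma>\<close> is the sum of the measures \<open>\<nu> n\<close> of the cyclic subspaces, and
  \<open>\<nu> n\<close> has density \<open>h n\<close>. The multiplicity at \<open>z\<close> is the number of \<open>n\<close> with \<open>h n z > 0\<close>,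
  and the copies are numbered by the rank of \<open>n\<close> among these. Since \<open>card\<close> is 0 on infinite
  sets, \<open>F 0\<close> is the part of infinite multiplicity.\<close>

theorem multiplicity_decomposition_exists:
  fixes N :: "'a::chilbert_space \<Rightarrow> 'a"
  assumes sep: "separable_hspace TYPE('a)" and normal: "normal_op N"
  shows "\<exists>\<mu>. multiplicity_decomposition N \<mu>"
proof -
  obtain R where R: "R > 0" "\<And>x. norm (N x) \<le> R * norm x"
    using bounded_clinear_bound[OF normal_op_bounded[OF normal]] by blast
  interpret normal_operator N R by unfold_locales (use normal R in auto)
  obtain \<nu> :: "nat \<Rightarrow> complex measure" and V :: "'a \<Rightarrow> nat \<Rightarrow> complex \<Rightarrow> complex" where
    sets_\<nu>: "\<And>n. sets (\<nu> n) = sets borel" and fin_\<nu>: "\<And>n. finite_measure (\<nu> n)"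
    and supp: "\<And>n. AE z in \<nu> n. z \<in> cball 0 R" and mass: "\<And>n. emeasure (\<nu> n) UNIV \<le> ennreal ((1/2)^n)"
    and V [measurable]: "\<And>x n. V x n \<in> borel_measurable borel"
    and V_norm: "\<And>x. ennreal ((norm x)\<^sup>2) = (\<Sum>n. sqn (\<nu> n) (V x n))"
    and V_add: "\<And>x y n. AE z in \<nu> n. V (x + y) n z = V x n z + V y n z"
    and V_scale: "\<And>c x n. AE z in \<nu> n. V (c *\<^sub>C x) n z = c * V x n z"
    and V_N: "\<And>x n. AE z in \<nu> n. V (N x) n z = z * V x n z"
    and V_surj: "\<forall>g. (\<forall>n. g n \<in> borel_measurable borel) \<longrightarrow> (\<Sum>n. sqn (\<nu> n) (g n)) < \<infinity> \<longrightarrow>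
       (\<exists>x. \<forall>n. AE z in \<nu> n. V x n z = g n z)"
    by (rule spectral_representation[OF sep], rule that)
  have space_\<nu>: "space (\<nu> n) = UNIV" for n using sets_eq_imp_space_eq[OF sets_\<nu>] by simp
  define \<sigma> where "\<sigma> = sum_measure borel \<nu>"
  have sets_\<sigma> [simp, measurable_cong]: "sets \<sigma> = sets borel" by (simp add: \<sigma>_def)
  have space_\<sigma> [simp]: "space \<sigma> = UNIV" by (simp add: \<sigma>_def)
  have em_\<sigma>: "emeasure \<sigma> A = (\<Sum>n. emeasure (\<nu> n) A)" if "A \<in> sets borel" for A
    unfolding \<sigma>_def by (rule emeasure_sum_measure[OF sets_\<nu> that])
  interpret \<sigma>: finite_measure \<sigma>
  proof (rule finite_measureI)
    have "emeasure \<sigma> (space \<sigma>) \<le> (\<Sum>n. ennreal ((1/2)^n))"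
      by (simp add: em_\<sigma>) (intro suminf_le mass, auto)
    also have "\<dots> < \<infinity>" by (subst suminf_ennreal2) (auto simp: summable_geometric)
    finally show "emeasure \<sigma> (space \<sigma>) \<noteq> \<infinity>" by simp
  qed
  have "\<exists>h\<in>borel_measurable borel. (\<forall>z. 0 \<le> h z) \<and> density \<sigma> (\<lambda>z. ennreal (h z)) = \<nu> n" for n
  proof -
    have ac: "absolutely_continuous \<sigma> (\<nu> n)"
      unfolding absolutely_continuous_def
    proof
      fix A assume "A \<in> null_sets \<sigma>"
      then have A: "A \<in> sets borel" "emeasure \<sigma> A = 0" by auto
      then have "emeasure (\<nu> n) A = 0" by (simp add: em_\<sigma> suminf_ennreal_eq_0_iff)
      then show "A \<in> null_sets (\<nu> n)" using A by (auto simp: null_sets_def sets_\<nu>)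
    qed
    obtain h where h [measurable]: "h \<in> borel_measurable \<sigma>" and d: "density \<sigma> h = \<nu> n"
      using \<sigma>.Radon_Nikodym_finite_measure[OF fin_\<nu> _ ac] sets_\<nu> by auto
    have "(\<integral>\<^sup>+z. h z \<partial>\<sigma>) = emeasure (density \<sigma> h) UNIV"
      by (simp add: emeasure_density)
    also have "\<dots> \<noteq> \<infinity>" using finite_measure.emeasure_finite[OF fin_\<nu>] unfolding d by simp
    finally have ae: "AE z in \<sigma>. h z \<noteq> \<infinity>" by (intro nn_integral_PInf_AE) auto
    have "density \<sigma> (\<lambda>z. ennreal (enn2real (h z))) = density \<sigma> h"
      by (rule density_cong) (use ae in \<open>auto simp: less_top\<close>)
    then show ?thesis using d h by (intro bexI[of _ "\<lambda>z. enn2real (h z)"]) auto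
  qed
  then obtain h where h [measurable]: "\<And>n. h n \<in> borel_measurable borel" and h0: "\<And>n z. 0 \<le> h n z"
    and dens: "\<And>n. density \<sigma> (\<lambda>z. ennreal (h n z)) = \<nu> n" by metis
  have AE_\<nu>: "(AE z in \<nu> n. P z) \<longleftrightarrow> (AE z in \<sigma>. 0 < h n z \<longrightarrow> P z)" for n P
    by (subst dens[symmetric]) (simp add: AE_density)
  have nn_\<nu>: "(\<integral>\<^sup>+z. f z \<partial>\<nu> n) = (\<integral>\<^sup>+z. ennreal (h n z) * f z \<partial>\<sigma>)" if "f \<in> borel_measurable borel" for f n
    by (subst dens[symmetric]) (rule nn_integral_density, use that in auto)
  define I where "I z = {n. 0 < h n z}" for z
  define rank where "rank z n = card {i\<in>I z. i < n}" for z n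
  \<comment> \<open>The inverse of the rank. For ranks that do not occur the value is arbitrary, and
    \<open>rel\<close> masks those.\<close>
  define idx where "idx z j = (LEAST n. n \<in> I z \<and> rank z n = j)" for z j
  \<comment> \<open>Points where all densities vanish also have \<open>card (I z) = 0\<close>;
    without the second condition they would count as infinite multiplicity.\<close>
  define F where "F k = {z. card (I z) = k \<and> I z \<noteq> {}}" for k
  have I_meas [measurable]: "Measurable.pred borel (\<lambda>z. n \<in> I z)" for n unfolding I_def by simp
  have card_meas [measurable]: "(\<lambda>z. card (I z)) \<in> measurable borel (count_space UNIV)"
    by measurable
  have rank_meas [measurable]: "(\<lambda>z. rank z n) \<in> measurable borel (count_space UNIV)" for n
    unfolding rank_def by (rule measurable_card) measurable
  have idx_meas [measurable]: "(\<lambda>z. idx z j) \<in> measurable borel (count_space UNIV)" for j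
    unfolding idx_def by measurable
  have I_ne [measurable]: "Measurable.pred borel (\<lambda>z. I z \<noteq> {})"
  proof -
    have "(\<lambda>z. I z \<noteq> {}) = (\<lambda>z. \<exists>n. n \<in> I z)" by auto
    then show ?thesis by simp
  qed
  have F_meas [measurable]: "F k \<in> sets borel" for k unfolding F_def by measurable
  have bij: "bij_betw (rank z) (I z) (copies (card (I z)))" if "I z \<noteq> {}" for z
    using rank_bij_copies[OF that] by (simp add: rank_def[abs_def])
  have idx_rank: "idx z (rank z n) = n" if n: "n \<in> I z" for z n
    unfolding idx_def
  proof (rule Least_equality)
    fix m assume m: "m \<in> I z \<and> rank z m = rank z n"
    have "I z \<noteq> {}" using n by auto
    from bij[OF this] m n show "n \<le> m" by (auto simp: bij_betw_def dest: inj_onD)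
  qed (use n in simp)
  have rank_idx: "rank z (idx z j) = j" "idx z j \<in> I z" if z: "z \<in> F k" and j: "j \<in> copies k" for z j k
  proof -
    have "j \<in> rank z ` I z" using bij[of z] z j by (auto simp: F_def bij_betw_def)
    then obtain n where "n \<in> I z" "j = rank z n" by auto
    then show "rank z (idx z j) = j" "idx z j \<in> I z" using idx_rank by auto
  qed
  define \<mu> where "\<mu> k = density \<sigma> (indicator (F k))" for k
  have sets_\<mu>: "sets (\<mu> k) = sets borel" for k by (simp add: \<mu>_def)
  have AE_\<mu>: "(AE z in \<mu> k. P z) \<longleftrightarrow> (AE z in \<sigma>. z \<in> F k \<longrightarrow> P z)" for k P
    unfolding \<mu>_def by (subst AE_density) (auto simp: indicator_def)
  have nn_\<mu>: "(\<integral>\<^sup>+z. f z \<partial>\<mu> k) = (\<integral>\<^sup>+z. indicator (F k) z * f z \<partial>\<sigma>)" if "f \<in> borel_measurable borel" for f k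
    unfolding \<mu>_def by (rule nn_integral_density) (use that in auto)
  have fin_\<mu>: "finite_measure (\<mu> k)" for k
    unfolding \<mu>_def by (rule finite_measureI) (simp add: emeasure_density)
  \<comment> \<open>The square root of the density converts the norm for \<open>\<nu> n\<close> into
    the norm for \<open>\<sigma>\<close>, and over the point \<open>z\<close> the function with
    index \<open>idx z j\<close> is moved to copy \<open>j\<close>.\<close>
  define rel where "rel g k j z = (if z \<in> F k \<and> j \<in> copies k
    then g (idx z j) z * complex_of_real (sqrt (h (idx z j) z)) else 0)" for g :: "nat \<Rightarrow> complex \<Rightarrow> complex" and k j z
  have rel_meas: "rel g k j \<in> borel_measurable borel" if "\<And>n. g n \<in> borel_measurable borel" for g k j
  proof -
    have [measurable]: "g n \<in> borel_measurable borel" for n by (rule that)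
    have 1 [measurable]: "(\<lambda>z. g (idx z j) z) \<in> borel_measurable borel"
      by (rule measurable_compose_countable[OF _ idx_meas]) measurable
    have 2 [measurable]: "(\<lambda>z. h (idx z j) z) \<in> borel_measurable borel"
      by (rule measurable_compose_countable[OF _ idx_meas]) measurable
    show ?thesis unfolding rel_def[abs_def] by measurable
  qed
  have rel_norm: "model_norm2 \<mu> (rel g) = (\<Sum>n. sqn (\<nu> n) (g n))" if g: "\<And>n. g n \<in> borel_measurable borel" for g
  proof -
    note [measurable] = rel_meas[OF g] g
    define G where "G z n = ennreal (h n z) * ennreal ((cmod (g n z))\<^sup>2)" for z n
    have G_meas [measurable]: "(\<lambda>z. G z n) \<in> borel_measurable borel" for n unfolding G_def by measurable
    have rel_G: "ennreal ((cmod (rel g k j z))\<^sup>2) = (if z \<in> F k \<and> j \<in> copies k then G z (idx z j) else 0)" for k j z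
      using h0[of "idx z j" z]
      by (auto simp: rel_def G_def norm_mult power_mult_distrib ennreal_mult mult.commute)
    have "model_norm2 \<mu> (rel g) = (\<Sum>k. \<Sum>j. \<integral>\<^sup>+z. (if z \<in> F k \<and> j \<in> copies k then G z (idx z j) else 0) \<partial>\<sigma>)"
      unfolding model_norm2_def
    proof (intro suminf_cong)
      fix k j
      show "(if j \<in> copies k then \<integral>\<^sup>+z. ennreal ((cmod (rel g k j z))\<^sup>2) \<partial>\<mu> k else 0)
        = (\<integral>\<^sup>+z. (if z \<in> F k \<and> j \<in> copies k then G z (idx z j) else 0) \<partial>\<sigma>)"
        by (subst nn_\<mu>) (auto simp: rel_G intro!: nn_integral_cong split: split_indicator)
    qed
    also have "\<dots> = (\<integral>\<^sup>+z. (\<Sum>k. \<Sum>j. if z \<in> F k \<and> j \<in> copies k then G z (idx z j) else 0) \<partial>\<sigma>)"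
    proof -
      have [measurable]: "(\<lambda>z. G z (idx z j)) \<in> borel_measurable borel" for j
        by (rule measurable_compose_countable[OF _ idx_meas]) measurable
      show ?thesis by (subst nn_integral_suminf, measurable, intro suminf_cong nn_integral_suminf[symmetric]) measurable
    qed
    \<comment> \<open>At each point only \<open>k = card (I z)\<close> contributes, and the rank
      reorders the sum over \<open>I z\<close> as a sum over the copies.\<close>
    also have "\<dots> = (\<integral>\<^sup>+z. (\<Sum>n. G z n) \<partial>\<sigma>)"
    proof (rule nn_integral_cong)
      fix z
      have G0: "G z n = 0" if "n \<notin> I z" for n using that h0[of n z] by (simp add: I_def G_def)
      show "(\<Sum>k. \<Sum>j. if z \<in> F k \<and> j \<in> copies k then G z (idx z j) else 0) = (\<Sum>n. G z n)"
      proof (cases "I z = {}")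
        case True
        then show ?thesis by (simp add: F_def G0)
      next
        case False
        have "(\<Sum>j. if z \<in> F k \<and> j \<in> copies k then G z (idx z j) else 0)
          = (if k = card (I z) then (\<Sum>j. if j \<in> copies k then G z (idx z j) else 0) else 0)" for k
          using False by (auto simp: F_def)
        then have "(\<Sum>k. \<Sum>j. if z \<in> F k \<and> j \<in> copies k then G z (idx z j) else 0)
          = (\<Sum>j. if j \<in> copies (card (I z)) then G z (idx z j) else 0)"
          by (simp add: suminf_single)
        also have "\<dots> = (\<Sum>n. G z n)"
          by (rule suminf_copies_reindex[OF bij[OF False]]) (auto simp: G0 idx_rank)
        finally show ?thesis .
      qed
    qed
    also have "\<dots> = (\<Sum>n. \<integral>\<^sup>+z. G z n \<partial>\<sigma>)" by (rule nn_integral_suminf) measurable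
    also have "\<dots> = (\<Sum>n. sqn (\<nu> n) (g n))"
      unfolding sqn_def G_def by (intro suminf_cong nn_\<nu>[symmetric]) measurable
    finally show ?thesis .
  qed
  \<comment> \<open>An exceptional set for \<open>\<nu> n\<close> is null for
    \<open>\<sigma>\<close> where \<open>h n\<close> is positive, and \<open>idx z j\<close> picks
    such an \<open>n\<close>. As the index varies with \<open>z\<close>, all countably many
    exceptional sets are joined first.\<close>
  have rel_AE: "AE z in \<mu> k. \<forall>j\<in>copies k. P (idx z j) z" if P: "\<And>n. AE z in \<nu> n. P n z" for P k
  proof -
    have "AE z in \<sigma>. \<forall>n. 0 < h n z \<longrightarrow> P n z" using P by (simp add: AE_\<nu> AE_all_countable)
    then show ?thesis unfolding AE_\<mu>
      by eventually_elim (use rank_idx in \<open>auto simp: I_def\<close>)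
  qed
  define U where "U x = rel (V x)" for x
  have "unitary_to_model N \<mu> U"
    unfolding unitary_to_model_def
  proof (intro conjI allI impI)
    show norm: "ennreal ((norm x)\<^sup>2) = model_norm2 \<mu> (U x)" for x
      unfolding U_def by (simp add: rel_norm V_norm)
    show "model_elem \<mu> (U x)" for x
      unfolding model_elem_def norm[symmetric] by (auto simp: U_def rel_meas)
    show "ae_eq_model \<mu> (U (x + y)) (\<lambda>k j z. U x k j z + U y k j z)" for x y
      unfolding ae_eq_model_def
    proof (intro allI ballI)
      fix k j assume "j \<in> copies k"
      then show "AE z in \<mu> k. U (x + y) k j z = U x k j z + U y k j z"
        using rel_AE[OF V_add[of x y], of k] by (auto simp: U_def rel_def algebra_simps)
    qed
    show "ae_eq_model \<mu> (U (c *\<^sub>C x)) (\<lambda>k j z. c * U x k j z)" for c x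
      unfolding ae_eq_model_def
    proof (intro allI ballI)
      fix k j assume "j \<in> copies k"
      then show "AE z in \<mu> k. U (c *\<^sub>C x) k j z = c * U x k j z"
        using rel_AE[OF V_scale[of c x], of k] by (auto simp: U_def rel_def)
    qed
    show "ae_eq_model \<mu> (U (N x)) (\<lambda>k j z. z * U x k j z)" for x
      unfolding ae_eq_model_def
    proof (intro allI ballI)
      fix k j assume "j \<in> copies k"
      then show "AE z in \<mu> k. U (N x) k j z = z * U x k j z"
        using rel_AE[OF V_N[of x], of k] by (auto simp: U_def rel_def)
    qed
    fix g assume g: "model_elem \<mu> g"
    \<comment> \<open>Outside \<open>copies k\<close> a model element carries no measurability, so
      it is set to 0 there before indices depending on \<open>z\<close> are substituted.\<close>
    define g' where "g' k j = (if j \<in> copies k then g k j else (\<lambda>z. 0))" for k j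
    have [measurable]: "g' k j \<in> borel_measurable borel" for k j
      using g by (auto simp: model_elem_def g'_def)
    \<comment> \<open>The inverse of \<open>rel\<close>; the value 0 where the density vanishes is
      invisible to \<open>\<nu> n\<close>.\<close>
    define f where "f n z = (if 0 < h n z then g' (card (I z)) (rank z n) z / complex_of_real (sqrt (h n z)) else 0)" for n z
    have f_meas: "f n \<in> borel_measurable borel" for n
    proof -
      have [measurable]: "(\<lambda>z. g' k (rank z n) z) \<in> borel_measurable borel" for k
        by (rule measurable_compose_countable[OF _ rank_meas]) measurable
      have [measurable]: "(\<lambda>z. g' (card (I z)) (rank z n) z) \<in> borel_measurable borel"
        by (rule measurable_compose_countable[OF _ card_meas]) measurable
      show ?thesis unfolding f_def[abs_def] by measurable
    qed
    have rel_f: "rel f k j z = g k j z" if "z \<in> F k" "j \<in> copies k" for k j z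
      using rank_idx[OF that] that by (auto simp: rel_def f_def I_def F_def g'_def)
    have rel_f_ae: "AE z in \<mu> k. rel f k j z = g k j z" if "j \<in> copies k" for k j
      unfolding AE_\<mu> using rel_f that by auto
    have "(\<Sum>n. sqn (\<nu> n) (f n)) = model_norm2 \<mu> (rel f)" by (rule rel_norm[OF f_meas, symmetric])
    also have "\<dots> = model_norm2 \<mu> g"
      unfolding model_norm2_def
    proof (intro suminf_cong)
      fix k j
      show "(if j \<in> copies k then \<integral>\<^sup>+z. ennreal ((cmod (rel f k j z))\<^sup>2) \<partial>\<mu> k else 0)
        = (if j \<in> copies k then \<integral>\<^sup>+z. ennreal ((cmod (g k j z))\<^sup>2) \<partial>\<mu> k else 0)"
        using rel_f_ae[of j k] by (auto intro!: nn_integral_cong_AE)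
    qed
    also have "\<dots> < \<infinity>" using g by (simp add: model_elem_def)
    finally obtain x where x: "\<And>n. AE z in \<nu> n. V x n z = f n z" using V_surj f_meas by blast
    have "ae_eq_model \<mu> (U x) g"
      unfolding ae_eq_model_def
    proof (intro allI ballI)
      fix k j assume j: "j \<in> copies k"
      from rel_AE[OF x, of k] rel_f_ae[OF j] show "AE z in \<mu> k. U x k j z = g k j z"
      proof eventually_elim
        case (elim z)
        have "rel (V x) k j z = rel f k j z" using elim(1) j by (simp add: rel_def)
        then show ?case using elim(2) by (simp add: U_def)
      qed
    qed
    then show "\<exists>x. ae_eq_model \<mu> (U x) g" by blast
  qed
  moreover have "cs_regular_borel (\<mu> k)" for k
  proof (rule cs_regular_borel_finite[OF sets_\<mu> fin_\<mu>, of "cball 0 R"])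
    have "\<forall>n. AE z in \<sigma>. 0 < h n z \<longrightarrow> z \<in> cball 0 R" using supp unfolding AE_\<nu> by blast
    then have "AE z in \<sigma>. \<forall>n. 0 < h n z \<longrightarrow> z \<in> cball 0 R" by (rule AE_all_countable[THEN iffD2])
    then show "AE z in \<mu> k. z \<in> cball 0 R"
      unfolding AE_\<mu> by eventually_elim (auto simp: F_def I_def)
  qed simp
  moreover have "mutually_singular (\<mu> i) (\<mu> j)" if "i \<noteq> j" for i j
    unfolding mutually_singular_def
  proof (intro bexI conjI)
    have "F j \<inter> F i = {}" using that by (auto simp: F_def)
    then have "(\<integral>\<^sup>+z. indicator (F i) z * indicator (F j) z \<partial>\<sigma>) = 0"
      by (subst nn_integral_0_iff_AE) (auto split: split_indicator)
    then show "emeasure (\<mu> i) (F j) = 0" by (simp add: \<mu>_def emeasure_density)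
    have "(\<integral>\<^sup>+z. indicator (F j) z * indicator (UNIV - F j) z \<partial>\<sigma>) = 0"
      by (subst nn_integral_0_iff_AE) (auto split: split_indicator)
    then show "emeasure (\<mu> j) (UNIV - F j) = 0" by (simp add: \<mu>_def emeasure_density)
  qed simp
  ultimately show ?thesis unfolding multiplicity_decomposition_def by blast
qed

section \<open>Operators on the model space\<close>

locale spectral_model =
  fixes N :: "'a::chilbert_space \<Rightarrow> 'a" and \<mu> :: "nat \<Rightarrow> complex measure"
    and U :: "'a \<Rightarrow> nat \<Rightarrow> nat \<Rightarrow> complex \<Rightarrow> complex"
  assumes N: "bounded_clinear N" and cs: "cs_regular_borel (\<mu> k)" and unitary: "unitary_to_model N \<mu> U"
begin

lemma sets_\<mu> [simp, measurable_cong]: "sets (\<mu> k) = sets borel"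
  using cs[of k] unfolding cs_regular_borel_def by blast

lemma space_\<mu> [simp]: "space (\<mu> k) = UNIV"
  using sets_eq_imp_space_eq[OF sets_\<mu>] by simp

lemma finite_\<mu>: "finite_measure (\<mu> k)"
proof (rule finite_measureI)
  have "emeasure (\<mu> k) (space (\<mu> k)) < \<infinity>" using cs[of k] unfolding cs_regular_borel_def by blast
  then show "emeasure (\<mu> k) (space (\<mu> k)) \<noteq> \<infinity>" by simp
qed

lemma borel_measurable_\<mu> [simp]: "borel_measurable (\<mu> k) = borel_measurable borel"
  by (rule measurable_cong_sets) auto

lemma U_elem: "model_elem \<mu> (U x)"
  and U_add: "ae_eq_model \<mu> (U (x + y)) (\<lambda>k j z. U x k j z + U y k j z)"
  and U_scale: "ae_eq_model \<mu> (U (c *\<^sub>C x)) (\<lambda>k j z. c * U x k j z)"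
  and U_norm: "ennreal ((norm x)\<^sup>2) = model_norm2 \<mu> (U x)"
  and U_surj: "model_elem \<mu> g \<Longrightarrow> \<exists>x. ae_eq_model \<mu> (U x) g"
  and U_N: "ae_eq_model \<mu> (U (N x)) (\<lambda>k j z. z * U x k j z)"
  using unitary unfolding unitary_to_model_def by blast+

lemma ae_eqD: "ae_eq_model \<mu> g h \<Longrightarrow> j \<in> copies k \<Longrightarrow> AE z in \<mu> k. g k j z = h k j z"
  by (simp add: ae_eq_model_def)

lemma ae_eqI: "(\<And>k j. j \<in> copies k \<Longrightarrow> AE z in \<mu> k. g k j z = h k j z) \<Longrightarrow> ae_eq_model \<mu> g h"
  by (simp add: ae_eq_model_def)

lemma ae_eq_sym: "ae_eq_model \<mu> g h \<Longrightarrow> ae_eq_model \<mu> h g"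
  by (auto simp: ae_eq_model_def eq_commute)

lemma ae_eq_lift:
  assumes "ae_eq_model \<mu> g h" "\<And>k j z. j \<in> copies k \<Longrightarrow> g k j z = h k j z \<Longrightarrow> g' k j z = h' k j z"
  shows "ae_eq_model \<mu> g' h'"
proof (rule ae_eqI)
  fix k j assume j: "j \<in> copies k"
  show "AE z in \<mu> k. g' k j z = h' k j z"
    using ae_eqD[OF assms(1) j] by eventually_elim (rule assms(2)[OF j])
qed

lemma ae_eq_lift2:
  assumes "ae_eq_model \<mu> g h" "ae_eq_model \<mu> p q"
    "\<And>k j z. j \<in> copies k \<Longrightarrow> g k j z = h k j z \<Longrightarrow> p k j z = q k j z \<Longrightarrow> g' k j z = h' k j z"
  shows "ae_eq_model \<mu> g' h'"
proof (rule ae_eqI)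
  fix k j assume j: "j \<in> copies k"
  show "AE z in \<mu> k. g' k j z = h' k j z"
    using ae_eqD[OF assms(1) j] ae_eqD[OF assms(2) j] by eventually_elim (rule assms(3)[OF j])
qed

lemma ae_eq_trans: "ae_eq_model \<mu> f g \<Longrightarrow> ae_eq_model \<mu> g h \<Longrightarrow> ae_eq_model \<mu> f h"
  by (rule ae_eq_lift2[of f g g h]) auto

lemma model_norm2_cong:
  assumes "ae_eq_model \<mu> g h"
  shows "model_norm2 \<mu> g = model_norm2 \<mu> h"
  unfolding model_norm2_def
proof (intro suminf_cong if_cong refl nn_integral_cong_AE)
  fix k j assume "j \<in> copies k"
  from ae_eqD[OF assms this]
  show "AE z in \<mu> k. ennreal ((cmod (g k j z))\<^sup>2) = ennreal ((cmod (h k j z))\<^sup>2)"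
    by eventually_elim simp
qed

lemma U_meas [measurable]: "j \<in> copies k \<Longrightarrow> U x k j \<in> borel_measurable borel"
  using U_elem[of x] by (simp add: model_elem_def)

lemma U_finite: "model_norm2 \<mu> (U x) < \<infinity>"
  using U_elem[of x] by (simp add: model_elem_def)

lemma model_norm2_zero: "model_norm2 \<mu> (\<lambda>k j z. 0) = 0"
  by (simp add: model_norm2_def cong: if_cong)

lemma U_diff: "ae_eq_model \<mu> (U (x - y)) (\<lambda>k j z. U x k j z - U y k j z)"
  using U_add[of x "- y"] U_scale[of "-1" y] by (rule ae_eq_lift2) (simp add: scaleC_minus1)

lemma U_zero: "ae_eq_model \<mu> (U 0) (\<lambda>k j z. 0)"
  using U_scale[of 0 0] by simp

lemma norm_eqI: "ae_eq_model \<mu> (U x) g \<Longrightarrow> ennreal ((norm x)\<^sup>2) = model_norm2 \<mu> g"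
  by (simp add: U_norm model_norm2_cong)

lemma U_inj:
  assumes "ae_eq_model \<mu> (U x) g" "ae_eq_model \<mu> (U y) g"
  shows "x = y"
proof -
  have "ae_eq_model \<mu> (U x) (U y)" using assms ae_eq_sym ae_eq_trans by blast
  with U_diff[of x y] have "ae_eq_model \<mu> (U (x - y)) (\<lambda>k j z. 0)" by (rule ae_eq_lift2) simp
  from norm_eqI[OF this] show ?thesis by (simp add: model_norm2_zero)
qed

lemma model_elemI:
  assumes "\<And>k j. j \<in> copies k \<Longrightarrow> g k j \<in> borel_measurable borel" "model_norm2 \<mu> g < \<infinity>"
  shows "model_elem \<mu> g"
  using assms by (simp add: model_elem_def)

lemma component_norm_le:
  assumes "j \<in> copies k"
  shows "(\<integral>\<^sup>+z. ennreal ((cmod (g k j z))\<^sup>2) \<partial>\<mu> k) \<le> model_norm2 \<mu> g"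
proof -
  define a where "a k j = (if j \<in> copies k then (\<integral>\<^sup>+z. ennreal ((cmod (g k j z))\<^sup>2) \<partial>(\<mu> k)) else 0)" for k j
  have "a k j \<le> (\<Sum>j. a k j)" using sum_le_suminf[of "a k" "{j}"] by simp
  also have "\<dots> \<le> (\<Sum>k. \<Sum>j. a k j)" using sum_le_suminf[of "\<lambda>k. \<Sum>j. a k j" "{k}"] by simp
  finally show ?thesis using assms by (simp add: a_def model_norm2_def)
qed

lemma model_norm2_single:
  assumes "j \<in> copies k" "\<And>k' j'. k' \<noteq> k \<or> j' \<noteq> j \<Longrightarrow> g k' j' = (\<lambda>z. 0)"
  shows "model_norm2 \<mu> g = (\<integral>\<^sup>+z. ennreal ((cmod (g k j z))\<^sup>2) \<partial>\<mu> k)"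
proof -
  have inner: "(\<Sum>j'. if j' \<in> copies k' then \<integral>\<^sup>+z. ennreal ((cmod (g k' j' z))\<^sup>2) \<partial>\<mu> k' else 0)
      = (if k' = k then (\<integral>\<^sup>+z. ennreal ((cmod (g k j z))\<^sup>2) \<partial>\<mu> k) else 0)" for k'
  proof -
    have "(\<Sum>j'. if j' \<in> copies k' then \<integral>\<^sup>+z. ennreal ((cmod (g k' j' z))\<^sup>2) \<partial>\<mu> k' else 0)
      = (\<Sum>j'. if j' = j then (if k' = k then (\<integral>\<^sup>+z. ennreal ((cmod (g k j z))\<^sup>2) \<partial>\<mu> k) else 0) else 0)"
      using assms by (intro suminf_cong) auto
    then show ?thesis by (simp add: suminf_single[of j])
  qed
  show ?thesis unfolding model_norm2_def inner by (rule suminf_single)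
qed

text \<open>\<open>U\<close> is additive and homogeneous only up to null sets, so the formula
  \<open>\<Phi>\<close> has to respect almost everywhere equality. Surjectivity of \<open>U\<close>
  supplies the values of \<open>T\<close>, and injectivity upgrades the almost everywhere identities
  to exact linearity.\<close>

lemma operator_exists:
  assumes meas: "\<And>g k j. (\<And>k j. j \<in> copies k \<Longrightarrow> g k j \<in> borel_measurable borel) \<Longrightarrow> j \<in> copies k
      \<Longrightarrow> \<Phi> g k j \<in> borel_measurable borel"
    and cong: "\<And>g h. ae_eq_model \<mu> g h \<Longrightarrow> ae_eq_model \<mu> (\<Phi> g) (\<Phi> h)"
    and add: "\<And>g h. \<Phi> (\<lambda>k j z. g k j z + h k j z) = (\<lambda>k j z. \<Phi> g k j z + \<Phi> h k j z)"
    and scale: "\<And>g c. \<Phi> (\<lambda>k j z. c * g k j z) = (\<lambda>k j z. c * \<Phi> g k j z)"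
    and norm: "\<And>x. model_norm2 \<mu> (\<Phi> (U x)) \<le> ennreal (C * (norm x)\<^sup>2)" and C: "C \<ge> 0"
  shows "\<exists>T. bounded_clinear T \<and> (\<forall>x. ae_eq_model \<mu> (U (T x)) (\<Phi> (U x)))"
proof -
  have "model_elem \<mu> (\<Phi> (U x))" for x
    using le_less_trans[OF norm ennreal_less_top] by (intro model_elemI meas) auto
  then have "\<forall>x. \<exists>y. ae_eq_model \<mu> (U y) (\<Phi> (U x))" using U_surj by blast
  from choice[OF this] obtain T where T: "\<And>x. ae_eq_model \<mu> (U (T x)) (\<Phi> (U x))" by blast
  have "bounded_clinear T"
  proof (rule bounded_clinearI)
    fix x y
    have 1: "ae_eq_model \<mu> (U (T (x + y))) (\<lambda>k j z. \<Phi> (U x) k j z + \<Phi> (U y) k j z)"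
      using ae_eq_trans[OF T cong[OF U_add]] by (simp add: add)
    have "ae_eq_model \<mu> (\<lambda>k j z. U (T x) k j z + U (T y) k j z) (\<lambda>k j z. \<Phi> (U x) k j z + \<Phi> (U y) k j z)"
      by (rule ae_eq_lift2[OF T[of x] T[of y]]) simp
    with U_add have "ae_eq_model \<mu> (U (T x + T y)) (\<lambda>k j z. \<Phi> (U x) k j z + \<Phi> (U y) k j z)"
      by (rule ae_eq_trans)
    with 1 show "T (x + y) = T x + T y" by (rule U_inj)
  next
    fix c x
    have 1: "ae_eq_model \<mu> (U (T (c *\<^sub>C x))) (\<lambda>k j z. c * \<Phi> (U x) k j z)"
      using ae_eq_trans[OF T cong[OF U_scale]] by (simp add: scale)
    have "ae_eq_model \<mu> (\<lambda>k j z. c * U (T x) k j z) (\<lambda>k j z. c * \<Phi> (U x) k j z)"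
      by (rule ae_eq_lift[OF T[of x]]) simp
    with U_scale have "ae_eq_model \<mu> (U (c *\<^sub>C T x)) (\<lambda>k j z. c * \<Phi> (U x) k j z)"
      by (rule ae_eq_trans)
    with 1 show "T (c *\<^sub>C x) = c *\<^sub>C T x" by (rule U_inj)
  next
    fix x
    have "ennreal ((norm (T x))\<^sup>2) \<le> ennreal (C * (norm x)\<^sup>2)" unfolding norm_eqI[OF T] by (rule norm)
    then have "(norm (T x))\<^sup>2 \<le> (sqrt C * norm x)\<^sup>2" using C by (simp add: power_mult_distrib)
    then show "norm (T x) \<le> sqrt C * norm x" by (rule power2_le_imp_le) (use C in simp)
  qed
  then show ?thesis using T by blast
qed

section \<open>Multiplication operators and the adjoint of \<open>N\<close>\<close>

definition mult_op :: "(complex \<Rightarrow> complex) \<Rightarrow> ('a \<Rightarrow> 'a) \<Rightarrow> bool" where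
  "mult_op \<phi> T \<longleftrightarrow> bounded_clinear T \<and> (\<forall>x. ae_eq_model \<mu> (U (T x)) (\<lambda>k j z. \<phi> z * U x k j z))"

lemma mult_op_eq: "mult_op \<phi> T \<Longrightarrow> ae_eq_model \<mu> (U (T x)) (\<lambda>k j z. \<phi> z * U x k j z)"
  by (simp add: mult_op_def)

lemma mult_op_exists:
  assumes [measurable]: "\<phi> \<in> borel_measurable borel"
    and C: "C \<ge> 0" "\<And>x. model_norm2 \<mu> (\<lambda>k j z. \<phi> z * U x k j z) \<le> ennreal (C * (norm x)\<^sup>2)"
  shows "\<exists>T. mult_op \<phi> T"
proof -
  have "\<exists>T. bounded_clinear T \<and> (\<forall>x. ae_eq_model \<mu> (U (T x)) (\<lambda>k j z. \<phi> z * U x k j z))"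
    by (rule operator_exists[where \<Phi>="\<lambda>g k j z. \<phi> z * g k j z" and C=C])
       (use C in \<open>auto simp: algebra_simps intro: ae_eq_lift\<close>)
  then show ?thesis by (simp add: mult_op_def)
qed

lemma mult_op_N: "mult_op (\<lambda>z. z) N"
  by (simp add: mult_op_def N U_N)

lemma model_norm2_add_cong:
  assumes [measurable]: "\<And>k j. j \<in> copies k \<Longrightarrow> g k j \<in> borel_measurable borel" "\<And>k j. j \<in> copies k \<Longrightarrow> h k j \<in> borel_measurable borel"
    "\<And>k j. j \<in> copies k \<Longrightarrow> g' k j \<in> borel_measurable borel" "\<And>k j. j \<in> copies k \<Longrightarrow> h' k j \<in> borel_measurable borel"
    and eq: "\<And>k j z. (cmod (g k j z))\<^sup>2 + (cmod (h k j z))\<^sup>2 = (cmod (g' k j z))\<^sup>2 + (cmod (h' k j z))\<^sup>2"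
  shows "model_norm2 \<mu> g + model_norm2 \<mu> h = model_norm2 \<mu> g' + model_norm2 \<mu> h'"
proof -
  have sum: "model_norm2 \<mu> g + model_norm2 \<mu> h = (\<Sum>k. \<Sum>j. if j \<in> copies k
      then (\<integral>\<^sup>+z. ennreal ((cmod (g k j z))\<^sup>2 + (cmod (h k j z))\<^sup>2) \<partial>(\<mu> k)) else 0)"
    if m: "\<And>k j. j \<in> copies k \<Longrightarrow> g k j \<in> borel_measurable borel" "\<And>k j. j \<in> copies k \<Longrightarrow> h k j \<in> borel_measurable borel"
    for g h :: "nat \<Rightarrow> nat \<Rightarrow> complex \<Rightarrow> complex"
    unfolding model_norm2_def
  proof (subst suminf_add, simp, simp, intro suminf_cong, subst suminf_add, simp, simp, intro suminf_cong)
    fix k j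
    note [measurable] = m
    show "(if j \<in> copies k then \<integral>\<^sup>+z. ennreal ((cmod (g k j z))\<^sup>2) \<partial>\<mu> k else 0) +
      (if j \<in> copies k then \<integral>\<^sup>+z. ennreal ((cmod (h k j z))\<^sup>2) \<partial>\<mu> k else 0) =
      (if j \<in> copies k then \<integral>\<^sup>+z. ennreal ((cmod (g k j z))\<^sup>2 + (cmod (h k j z))\<^sup>2) \<partial>\<mu> k else 0)"
      by (auto simp: nn_integral_add[symmetric])
  qed
  show ?thesis using assms by (simp add: sum cong: if_cong)
qed

text \<open>Polarised form of the equality of the real parts of \<open>z * u * cnj v\<close> and
  \<open>u * cnj (cnj z * v)\<close>, with the negative squares moved across so that it can be
  integrated without subtraction in \<open>ennreal\<close>.\<close>

lemma cmod_adjoint_identity: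
  "(cmod (z * u + v))\<^sup>2 + (cmod (u - cnj z * v))\<^sup>2 = (cmod (z * u - v))\<^sup>2 + (cmod (u + cnj z * v))\<^sup>2"
  unfolding cmod_power2 by (simp add: power2_eq_square algebra_simps)

text \<open>The model records norms only, so inner products are compared by polarisation:
  \<open>cmod_adjoint_identity\<close> gives the real parts, and replacing \<open>x\<close> by
  \<open>\<i> *\<^sub>C x\<close> gives the imaginary parts.\<close>

lemma adjoint_mult_op:
  assumes S: "mult_op cnj S"
  shows "adjoint N = S"
proof (rule adjoint_unique[OF N])
  have re: "Re (cinner (N x) y) = Re (cinner x (S y))" for x y
  proof -
    define g1 where "g1 k j z = z * U x k j z + U y k j z" for k j z
    define g2 where "g2 k j z = U x k j z - cnj z * U y k j z" for k j z
    define g3 where "g3 k j z = z * U x k j z - U y k j z" for k j z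
    define g4 where "g4 k j z = U x k j z + cnj z * U y k j z" for k j z
    have e1: "ae_eq_model \<mu> (U (N x + y)) g1"
      by (rule ae_eq_lift2[OF U_add[of "N x" y] U_N[of x]]) (auto simp: g1_def)
    have e2: "ae_eq_model \<mu> (U (x - S y)) g2"
      by (rule ae_eq_lift2[OF U_diff[of x "S y"] mult_op_eq[OF S, of y]]) (auto simp: g2_def)
    have e3: "ae_eq_model \<mu> (U (N x - y)) g3"
      by (rule ae_eq_lift2[OF U_diff[of "N x" y] U_N[of x]]) (auto simp: g3_def)
    have e4: "ae_eq_model \<mu> (U (x + S y)) g4"
      by (rule ae_eq_lift2[OF U_add[of x "S y"] mult_op_eq[OF S, of y]]) (auto simp: g4_def)
    have cnj_m [measurable]: "cnj \<in> borel_measurable borel" by (intro borel_measurable_continuous_onI continuous_intros)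
    have "ennreal ((norm (N x + y))\<^sup>2) + ennreal ((norm (x - S y))\<^sup>2)
        = ennreal ((norm (N x - y))\<^sup>2) + ennreal ((norm (x + S y))\<^sup>2)"
      unfolding norm_eqI[OF e1] norm_eqI[OF e2] norm_eqI[OF e3] norm_eqI[OF e4]
      by (rule model_norm2_add_cong)
         (auto simp: g1_def[abs_def] g2_def[abs_def] g3_def[abs_def] g4_def[abs_def] cmod_adjoint_identity)
    then have "(norm (N x + y))\<^sup>2 + (norm (x - S y))\<^sup>2 = (norm (N x - y))\<^sup>2 + (norm (x + S y))\<^sup>2"
      by (simp add: ennreal_plus[symmetric] del: ennreal_plus)
    then show ?thesis by (simp add: norm_add_sq norm_diff_sq)
  qed
  fix x y
  have "Re (cinner (N (\<i> *\<^sub>C x)) y) = Re (cinner (\<i> *\<^sub>C x) (S y))" by (rule re)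
  then have "Im (cinner (N x) y) = Im (cinner x (S y))"
    by (simp add: bounded_clinear_scaleC[OF N] cinner_scaleC_left)
  with re show "cinner (N x) y = cinner x (S y)" by (simp add: complex_eq_iff)
qed

text \<open>\<open>z\<close> and its conjugate have equal modulus, so the bound of \<open>N\<close>
  carries over to multiplication by the conjugate.\<close>

lemma mult_op_adjoint: "mult_op cnj (adjoint N)"
proof -
  obtain K where K: "K > 0" "\<And>x. norm (N x) \<le> K * norm x" using bounded_clinear_bound[OF N] by blast
  have "\<exists>S. mult_op cnj S"
  proof (rule mult_op_exists)
    show "cnj \<in> borel_measurable borel" by (intro borel_measurable_continuous_onI continuous_intros)
    show "0 \<le> K\<^sup>2" by simp
    fix x
    have "model_norm2 \<mu> (\<lambda>k j z. cnj z * U x k j z) = model_norm2 \<mu> (\<lambda>k j z. z * U x k j z)"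
      by (simp add: model_norm2_def norm_mult cong: if_cong)
    also have "\<dots> = ennreal ((norm (N x))\<^sup>2)" by (rule norm_eqI[OF U_N, symmetric])
    also have "\<dots> \<le> ennreal (K\<^sup>2 * (norm x)\<^sup>2)"
      using K(2)[of x] by (intro ennreal_leI) (simp add: power_mono flip: power_mult_distrib)
    finally show "model_norm2 \<mu> (\<lambda>k j z. cnj z * U x k j z) \<le> ennreal (K\<^sup>2 * (norm x)\<^sup>2)" .
  qed
  then show ?thesis using adjoint_mult_op by auto
qed

section \<open>Infinite multiplicity: a transformation that is not closable\<close>

lemma ennreal_tail_tendsto_0:
  fixes a :: "nat \<Rightarrow> ennreal"
  assumes "(\<Sum>j. a j) < \<infinity>"
  shows "(\<lambda>n. \<Sum>j. if n \<le> j then a j else 0) \<longlonglongrightarrow> 0"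
proof -
  have "(\<lambda>n. \<integral>\<^sup>+j. (if n \<le> j then a j else 0) \<partial>count_space UNIV) \<longlonglongrightarrow> (\<integral>\<^sup>+j. 0 \<partial>(count_space UNIV :: nat measure))"
  proof (rule nn_integral_dominated_convergence[where w=a])
    show "(\<integral>\<^sup>+j. a j \<partial>count_space UNIV) < \<infinity>" using assms by (simp add: nn_integral_count_space_nat)
    show "AE j in count_space UNIV. (\<lambda>n. if n \<le> j then a j else 0) \<longlonglongrightarrow> 0"
    proof (rule AE_I2)
      fix j
      have "\<forall>\<^sub>F n in sequentially. (if n \<le> j then a j else 0) = 0"
        using eventually_gt_at_top[of j] by eventually_elim simp
      then show "(\<lambda>n. if n \<le> j then a j else 0) \<longlonglongrightarrow> 0" by (rule tendsto_eventually)
    qed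
  qed auto
  then show ?thesis by (simp add: nn_integral_count_space_nat)
qed

lemma ennreal_square_tendsto_0:
  assumes "(\<lambda>n. ennreal ((norm (f n))\<^sup>2)) \<longlonglongrightarrow> 0"
  shows "f \<longlonglongrightarrow> 0"
proof -
  have "(\<lambda>n. ennreal ((norm (f n))\<^sup>2)) \<longlonglongrightarrow> ennreal 0" using assms by simp
  then have "(\<lambda>n. (norm (f n))\<^sup>2) \<longlonglongrightarrow> 0" by (subst (asm) tendsto_ennreal_iff) auto
  then have "(\<lambda>n. sqrt ((norm (f n))\<^sup>2)) \<longlonglongrightarrow> sqrt 0" by (intro tendsto_intros)
  then show ?thesis by (simp add: tendsto_norm_zero_iff)
qed

text \<open>Moves component \<open>i\<close> of the part of infinite multiplicity to component 0;
  once placed in a common component, such functions can be added.\<close>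

definition row :: "nat \<Rightarrow> (nat \<Rightarrow> nat \<Rightarrow> complex \<Rightarrow> complex) \<Rightarrow> nat \<Rightarrow> nat \<Rightarrow> complex \<Rightarrow> complex" where
  "row i g k j z = (if k = 0 \<and> j = 0 then g 0 i z else 0)"

lemma copies_0 [simp]: "j \<in> copies 0"
  by (simp add: copies_def)

lemma row_cong:
  assumes "ae_eq_model \<mu> g h"
  shows "ae_eq_model \<mu> (row i g) (row i h)"
proof (rule ae_eqI)
  fix k j
  show "AE z in \<mu> k. row i g k j z = row i h k j z"
    using ae_eqD[OF assms copies_0[of i]] by (cases "k = 0 \<and> j = 0") (auto simp: row_def)
qed

lemma row_operator_exists: "\<exists>V. bounded_clinear V \<and> (\<forall>x. ae_eq_model \<mu> (U (V x)) (row i (U x)))"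
proof (rule operator_exists[where C=1])
  fix g :: "nat \<Rightarrow> nat \<Rightarrow> complex \<Rightarrow> complex" and k j :: nat
  assume "\<And>k j. j \<in> copies k \<Longrightarrow> g k j \<in> borel_measurable borel"
  then show "row i g k j \<in> borel_measurable borel"
    by (cases "k = 0 \<and> j = 0") (auto simp: row_def[abs_def])
next
  fix x
  have "model_norm2 \<mu> (row i (U x)) = (\<integral>\<^sup>+z. ennreal ((cmod (U x 0 i z))\<^sup>2) \<partial>\<mu> 0)"
    by (subst model_norm2_single[of 0 0]) (auto simp: row_def fun_eq_iff)
  also have "\<dots> \<le> model_norm2 \<mu> (U x)" by (rule component_norm_le) simp
  finally show "model_norm2 \<mu> (row i (U x)) \<le> ennreal (1 * (norm x)\<^sup>2)" by (simp add: U_norm)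
next
  fix g h assume "ae_eq_model \<mu> g h"
  then show "ae_eq_model \<mu> (row i g) (row i h)" by (rule row_cong)
qed (auto simp: row_def fun_eq_iff)

lemma row_commutes_mult_op:
  assumes V: "\<And>x. ae_eq_model \<mu> (U (V x)) (row i (U x))" and T: "mult_op \<phi> T"
  shows "V (T x) = T (V x)"
proof (rule U_inj)
  show "ae_eq_model \<mu> (U (V (T x))) (row i (\<lambda>k j z. \<phi> z * U x k j z))"
    by (rule ae_eq_trans[OF V row_cong[OF mult_op_eq[OF T]]])
  show "ae_eq_model \<mu> (U (T (V x))) (row i (\<lambda>k j z. \<phi> z * U x k j z))"
    by (rule ae_eq_lift2[OF mult_op_eq[OF T, of "V x"] V[of x]]) (auto simp: row_def)
qed

lemma vN_generated_bounded:
  assumes "T \<in> vN_generated N"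
  shows "bounded_clinear T"
proof -
  have "von_neumann_algebra (commutant ({} :: ('a \<Rightarrow> 'a) set))" by (rule von_neumann_algebra_commutant) auto
  moreover have "N \<in> commutant {}" using N by (simp add: commutant_def)
  ultimately have "T \<in> commutant {}" using assms by (auto simp: vN_generated_def)
  then show ?thesis by (simp add: commutant_def)
qed

text \<open>On vectors with finitely many nonzero components in the part of infinite multiplicity, adding
  up these components commutes with the algebra; averages of \<open>n\<close> copies of one function tend to 0,
  but their image is constant.\<close>

lemma not_closable_of_infinite_multiplicity:
  assumes inf: "emeasure (\<mu> 0) UNIV \<noteq> 0"
  shows "\<not> closability_property (vN_generated N)"
proof -
  have "\<forall>i. \<exists>V. bounded_clinear V \<and> (\<forall>x. ae_eq_model \<mu> (U (V x)) (row i (U x)))"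
    by (intro allI row_operator_exists)
  from choice[OF this] obtain V
    where bV: "\<And>i. bounded_clinear (V i)" and V: "\<And>i x. ae_eq_model \<mu> (U (V i x)) (row i (U x))" by blast
  have V_eq: "V i x = y" if "ae_eq_model \<mu> (U x) g" "ae_eq_model \<mu> (U y) (row i g)" for i x y g
    by (rule U_inj[OF ae_eq_trans[OF V row_cong[OF that(1)]] that(2)])
  define D where "D = {x. \<exists>n. \<forall>i\<ge>n. V i x = 0}"
  define X where "X x = (\<Sum>i\<in>{i. V i x \<noteq> 0}. V i x)" for x
  have X_eq: "X x = (\<Sum>i<n. V i x)" if "\<And>i. i \<ge> n \<Longrightarrow> V i x = 0" for x n
    unfolding X_def by (rule sum.mono_neutral_left) (use that not_less in auto)
  have comm: "T (V i x) = V i (T x)" if T: "T \<in> vN_generated N" for T i x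
    by (rule vN_generated_commutes[OF N bV row_commutes_mult_op[OF V mult_op_N]
          row_commutes_mult_op[OF V mult_op_adjoint] T])
  have D2: "\<exists>n. (\<forall>i\<ge>n. V i x = 0) \<and> (\<forall>i\<ge>n. V i y = 0)" if xy: "x \<in> D" "y \<in> D" for x y
  proof -
    obtain m n where "\<forall>i\<ge>m. V i x = 0" "\<forall>i\<ge>n. V i y = 0"
      using xy unfolding D_def by blast
    then show ?thesis by (intro exI[of _ "max m n"]) auto
  qed
  have dense: "closure D = UNIV"
  proof -
    have "x \<in> closure D" for x
    proof -
      define cut where "cut n k j z = (if k = 0 \<and> n \<le> j then 0 else U x k j z)" for n k j z
      have cut_meas: "cut n k j \<in> borel_measurable borel" if "j \<in> copies k" for n k j
        using U_meas[OF that, of x] by (cases "k = 0 \<and> n \<le> j") (auto simp: cut_def[abs_def])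
      have "model_norm2 \<mu> (cut n) \<le> model_norm2 \<mu> (U x)" for n
        unfolding model_norm2_def by (intro suminf_le) (auto simp: cut_def intro!: nn_integral_mono)
      then have "model_norm2 \<mu> (cut n) < \<infinity>" for n by (rule le_less_trans) (rule U_finite)
      then have "\<exists>y. ae_eq_model \<mu> (U y) (cut n)" for n by (intro U_surj model_elemI cut_meas)
      then obtain y where y: "\<And>n. ae_eq_model \<mu> (U (y n)) (cut n)" by metis
      have yD: "y n \<in> D" for n
      proof -
        have "V i (y n) = 0" if "i \<ge> n" for i
        proof (rule V_eq[OF y])
          have "row i (cut n) = (\<lambda>k j z. 0)" using that by (auto simp: row_def cut_def fun_eq_iff)
          then show "ae_eq_model \<mu> (U 0) (row i (cut n))" using U_zero by simp
        qed
        then show ?thesis by (auto simp: D_def)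
      qed
      define a where "a j = (\<integral>\<^sup>+z. ennreal ((cmod (U x 0 j z))\<^sup>2) \<partial>\<mu> 0)" for j
      have "(\<Sum>j. a j) \<le> model_norm2 \<mu> (U x)"
        unfolding model_norm2_def a_def
        using sum_le_suminf[of "\<lambda>k. \<Sum>j. if j \<in> copies k then (\<integral>\<^sup>+z. ennreal ((cmod (U x k j z))\<^sup>2) \<partial>\<mu> k) else 0" "{0}"]
        by simp
      then have a: "(\<Sum>j. a j) < \<infinity>" by (rule le_less_trans) (rule U_finite)
      have "ennreal ((norm (x - y n))\<^sup>2) = (\<Sum>j. if n \<le> j then a j else 0)" for n
      proof -
        have "ae_eq_model \<mu> (U (x - y n)) (\<lambda>k j z. if k = 0 \<and> n \<le> j then U x k j z else 0)"
          by (rule ae_eq_lift2[OF U_diff[of x "y n"] y[of n]]) (auto simp: cut_def)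
        from norm_eqI[OF this]
        have "ennreal ((norm (x - y n))\<^sup>2) = model_norm2 \<mu> (\<lambda>k j z. if k = 0 \<and> n \<le> j then U x k j z else 0)" .
        also have "\<dots> = (\<Sum>k. if k = 0 then (\<Sum>j. if n \<le> j then a j else 0) else 0)"
          unfolding model_norm2_def
        proof (rule suminf_cong)
          fix k
          show "(\<Sum>j. if j \<in> copies k then \<integral>\<^sup>+z. ennreal ((cmod (if k = 0 \<and> n \<le> j then U x k j z else 0))\<^sup>2) \<partial>\<mu> k else 0)
            = (if k = 0 then (\<Sum>j. if n \<le> j then a j else 0) else 0)"
            by (cases "k = 0") (auto simp: a_def intro!: suminf_cong cong: if_cong)
        qed
        finally show ?thesis by (simp add: suminf_single[of 0])
      qed
      then have "(\<lambda>n. ennreal ((norm (x - y n))\<^sup>2)) \<longlonglongrightarrow> 0" using ennreal_tail_tendsto_0[OF a] by simp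
      then have "(\<lambda>n. x - y n) \<longlonglongrightarrow> 0" by (rule ennreal_square_tendsto_0)
      from tendsto_diff[OF tendsto_const[of x] this] have "y \<longlonglongrightarrow> x" by simp
      then show ?thesis using yD closure_sequential by blast
    qed
    then show ?thesis by auto
  qed
  have comD: "commutes_with X D (vN_generated N)"
    unfolding commutes_with_def
  proof (intro conjI ballI allI dense)
    show "0 \<in> D" using bounded_clinear_zero[OF bV] by (simp add: D_def)
  next
    fix x y assume xy: "x \<in> D" "y \<in> D"
    then obtain n where n: "\<And>i. i \<ge> n \<Longrightarrow> V i x = 0" "\<And>i. i \<ge> n \<Longrightarrow> V i y = 0" using D2 by blast
    then have n': "\<And>i. i \<ge> n \<Longrightarrow> V i (x + y) = 0" by (simp add: bounded_clinear_add[OF bV])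
    then show "x + y \<in> D" by (auto simp: D_def)
    show "X (x + y) = X x + X y"
      using X_eq[of n x] X_eq[of n y] X_eq[of n "x + y"] n n' by (simp add: bounded_clinear_add[OF bV] sum.distrib)
  next
    fix c x assume x: "x \<in> D"
    then obtain n where n: "\<And>i. i \<ge> n \<Longrightarrow> V i x = 0" by (auto simp: D_def)
    then have n': "\<And>i. i \<ge> n \<Longrightarrow> V i (c *\<^sub>C x) = 0" by (simp add: bounded_clinear_scaleC[OF bV])
    then show "c *\<^sub>C x \<in> D" by (auto simp: D_def)
    show "X (c *\<^sub>C x) = c *\<^sub>C X x"
      using X_eq[of n x] X_eq[of n "c *\<^sub>C x"] n n' by (simp add: bounded_clinear_scaleC[OF bV] scaleC_sum_right)
  next
    fix T assume T: "T \<in> vN_generated N"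
    note bT = vN_generated_bounded[OF T]
    have TD: "V i (T x) = 0" if "V i x = 0" for i x
      using comm[OF T, of i x] that bounded_clinear_zero[OF bT] by simp
    then show "T ` D \<subseteq> D" by (auto simp: D_def)
    fix x assume x: "x \<in> D"
    then obtain n where n: "\<And>i. i \<ge> n \<Longrightarrow> V i x = 0" by (auto simp: D_def)
    have n': "V i (T x) = 0" if "i \<ge> n" for i by (rule TD[OF n[OF that]])
    show "X (T x) = T (X x)"
      using X_eq[of n x] X_eq[of n "T x"] n n' by (simp add: bounded_clinear_sum[OF bT] comm[OF T])
  qed
  define m0 where "m0 = measure (\<mu> 0) UNIV"
  have m0: "emeasure (\<mu> 0) UNIV = ennreal m0"
    unfolding m0_def using finite_measure.emeasure_eq_measure[OF finite_\<mu>] by blast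
  define e where "e k j z = (if k = 0 \<and> j = 0 then 1 else 0 :: complex)" for k j :: nat and z :: complex
  have e_norm: "model_norm2 \<mu> e = ennreal m0"
    by (subst model_norm2_single[of 0 0]) (auto simp: e_def fun_eq_iff m0)
  have "e k j \<in> borel_measurable borel" for k j by (simp add: e_def[abs_def])
  then have "model_elem \<mu> e" by (rule model_elemI) (simp add: e_norm)
  then obtain u where u: "ae_eq_model \<mu> (U u) e" using U_surj by blast
  have u0: "u \<noteq> 0" using norm_eqI[OF u] inf by (auto simp: e_norm m0)
  \<comment> \<open>The average of \<open>Suc n\<close> copies of the constant function 1: each of
    the \<open>Suc n\<close> components has squared norm \<open>m0 / (Suc n)\<^sup>2\<close>, in
    total \<open>m0 / Suc n\<close>, while their sum is the constant 1 again.\<close>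
  define d where "d n k j z = (if k = 0 \<and> j \<le> n then complex_of_real (1 / Suc n) else 0)" for n k j :: nat and z :: complex
  have d_norm: "model_norm2 \<mu> (d n) = ennreal (m0 / Suc n)" for n
  proof -
    have "model_norm2 \<mu> (d n) = (\<Sum>k. if k = 0 then (\<Sum>j. if j \<le> n then ennreal ((1 / Suc n)\<^sup>2) * ennreal m0 else 0) else 0)"
      unfolding model_norm2_def
    proof (rule suminf_cong)
      fix k
      have "(if j \<in> copies k then \<integral>\<^sup>+z. ennreal ((cmod (d n k j z))\<^sup>2) \<partial>\<mu> k else 0)
        = (if k = 0 \<and> j \<le> n then ennreal ((1 / Suc n)\<^sup>2) * ennreal m0 else 0)" for j
      proof (cases "k = 0 \<and> j \<le> n")
        case True
        then have "d n k j z = complex_of_real (1 / Suc n)" for z by (simp add: d_def)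
        then have "(cmod (d n k j z))\<^sup>2 = (1 / Suc n)\<^sup>2" for z by (simp only: norm_of_real power2_abs)
        then show ?thesis using True by (simp add: m0)
      next
        case False
        then have "d n k j = (\<lambda>z. 0)" by (auto simp: d_def fun_eq_iff)
        then show ?thesis using False by auto
      qed
      then show "(\<Sum>j. if j \<in> copies k then \<integral>\<^sup>+z. ennreal ((cmod (d n k j z))\<^sup>2) \<partial>\<mu> k else 0)
        = (if k = 0 then (\<Sum>j. if j \<le> n then ennreal ((1 / Suc n)\<^sup>2) * ennreal m0 else 0) else 0)"
        by (cases "k = 0") simp_all
    qed
    also have "\<dots> = (\<Sum>j. if j \<le> n then ennreal ((1 / Suc n)\<^sup>2) * ennreal m0 else 0)"
      by (rule suminf_single)
    also have "\<dots> = (\<Sum>j\<in>{..n}. if j \<le> n then ennreal ((1 / Suc n)\<^sup>2) * ennreal m0 else 0)"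
      by (rule suminf_finite) auto
    also have "\<dots> = (\<Sum>j\<in>{..n}. ennreal ((1 / Suc n)\<^sup>2 * m0))"
      by (intro sum.cong) (auto simp: ennreal_mult m0_def)
    also have "\<dots> = ennreal (\<Sum>j\<in>{..n}. (1 / Suc n)\<^sup>2 * m0)" by (rule sum_ennreal) (simp add: m0_def)
    also have "(\<Sum>j\<in>{..n}. (1 / Suc n)\<^sup>2 * m0) = m0 / Suc n"
    proof -
      have "c * ((1 / c)\<^sup>2 * m0) = m0 / c" if "c > 0" for c :: real
        using that by (simp add: power2_eq_square)
      from this[of "real (Suc n)"] show ?thesis by (simp only: sum_constant card_atMost of_nat_0_less_iff zero_less_Suc)
    qed
    finally show ?thesis .
  qed
  have "d n k j \<in> borel_measurable borel" for n k j by (simp add: d_def[abs_def])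
  then have "model_elem \<mu> (d n)" for n by (rule model_elemI) (simp add: d_norm)
  then have "\<exists>w. ae_eq_model \<mu> (U w) (d n)" for n by (rule U_surj)
  then obtain w where w: "\<And>n. ae_eq_model \<mu> (U (w n)) (d n)" by metis
  have Vw: "V i (w n) = (if i \<le> n then of_real (1 / Suc n) *\<^sub>C u else 0)" for i n
  proof (rule V_eq[OF w])
    show "ae_eq_model \<mu> (U (if i \<le> n then of_real (1 / Suc n) *\<^sub>C u else 0)) (row i (d n))"
    proof (cases "i \<le> n")
      case True
      have "ae_eq_model \<mu> (U (of_real (1 / Suc n) *\<^sub>C u)) (row i (d n))"
        by (rule ae_eq_lift2[OF U_scale[of "of_real (1 / Suc n)" u] u]) (use True in \<open>auto simp: row_def d_def e_def\<close>)
      then show ?thesis using True by simp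
    next
      case False
      then have "row i (d n) = (\<lambda>k j z. 0)" by (auto simp: row_def d_def fun_eq_iff)
      then show ?thesis using False U_zero by simp
    qed
  qed
  have wD: "w n \<in> D" for n
    unfolding D_def by (intro CollectI exI[of _ "Suc n"]) (simp add: Vw)
  have Xw: "X (w n) = u" for n
  proof -
    have "X (w n) = (\<Sum>i<Suc n. V i (w n))" by (rule X_eq) (simp add: Vw)
    also have "\<dots> = (\<Sum>i<Suc n. of_real (1 / Suc n) *\<^sub>C u)" by (intro sum.cong) (auto simp: Vw)
    also have "\<dots> = (\<Sum>i<Suc n. of_real (1 / Suc n)) *\<^sub>C u" by (rule scaleC_sum_left[symmetric])
    also have "(\<Sum>i<Suc n. complex_of_real (1 / Suc n)) = 1"
      by (simp only: sum_constant card_lessThan) (simp add: field_simps del: of_nat_Suc)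
    finally show ?thesis by simp
  qed
  have w0: "w \<longlonglongrightarrow> 0"
  proof (rule ennreal_square_tendsto_0)
    have "(\<lambda>n. ennreal (m0 * (1 / real (Suc n)))) \<longlonglongrightarrow> ennreal (m0 * 0)"
      by (intro tendsto_ennrealI tendsto_intros LIMSEQ_Suc[OF lim_1_over_n])
    then show "(\<lambda>n. ennreal ((norm (w n))\<^sup>2)) \<longlonglongrightarrow> 0" unfolding norm_eqI[OF w] d_norm by simp
  qed
  have "(0, u) \<in> closure (graph X D)"
    unfolding closure_sequential
  proof (intro exI conjI allI)
    show "(w n, u) \<in> graph X D" for n using wD Xw by (auto simp: graph_def)
    show "(\<lambda>n. (w n, u)) \<longlonglongrightarrow> (0, u)" by (intro tendsto_Pair w0 tendsto_const)
  qed
  moreover have "(0, 0) \<in> closure (graph X D)"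
  proof -
    have "V i 0 = 0" for i by (rule bounded_clinear_zero[OF bV])
    then have "(0, 0) \<in> graph X D" by (auto simp: graph_def D_def X_def)
    then show ?thesis using closure_subset by blast
  qed
  ultimately have "\<not> closable X D" using u0 unfolding closable_def by blast
  then show ?thesis using comD unfolding closability_property_def by blast
qed

end

section \<open>Borel functions of a normal operator belong to its von Neumann algebra\<close>

context spectral_model
begin

lemma zero_in_copies: "0 \<in> copies k"
  by (simp add: copies_def)

text \<open>The bound is tested on a vector whose only component is the indicator of the region
  outside the disc. There \<open>(cmod z)\<^sup>2\<close> exceeds \<open>R\<^sup>2\<close>, and the
  bound forces the excess to have integral 0.\<close>

lemma AE_support:
  assumes R: "R \<ge> 0" "\<And>x. norm (N x) \<le> R * norm x"
  shows "AE z in \<mu> k. z \<in> cball 0 R"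
proof -
  define B where "B = {z::complex. R < cmod z}"
  have B [measurable]: "B \<in> sets borel" unfolding B_def by measurable
  define g where "g k' j z = (if k' = k \<and> j = 0 then indicator B z else 0 :: complex)" for k' j :: nat and z
  have g_meas: "g k' j \<in> borel_measurable borel" for k' j
    by (cases "k' = k \<and> j = 0") (auto simp: g_def[abs_def])
  have g_norm: "model_norm2 \<mu> g = emeasure (\<mu> k) B"
  proof -
    have "model_norm2 \<mu> g = (\<integral>\<^sup>+z. ennreal ((cmod (g k 0 z))\<^sup>2) \<partial>\<mu> k)"
      by (rule model_norm2_single[OF zero_in_copies]) (auto simp: g_def fun_eq_iff)
    also have "\<dots> = (\<integral>\<^sup>+z. indicator B z \<partial>\<mu> k)"
      by (rule nn_integral_cong) (auto simp: g_def indicator_def)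
    finally show ?thesis by simp
  qed
  have fin: "emeasure (\<mu> k) B < \<infinity>"
    using finite_measure.emeasure_finite[OF finite_\<mu>] by (simp add: less_top)
  have "model_elem \<mu> g" by (rule model_elemI) (use g_meas g_norm fin in auto)
  then obtain x where x: "ae_eq_model \<mu> (U x) g" using U_surj by blast
  have Nx: "ae_eq_model \<mu> (U (N x)) (\<lambda>k j z. z * g k j z)"
    by (rule ae_eq_lift2[OF U_N[of x] x]) simp
  have "ennreal ((norm (N x))\<^sup>2) = (\<integral>\<^sup>+z. ennreal ((cmod (z * g k 0 z))\<^sup>2) \<partial>\<mu> k)"
    unfolding norm_eqI[OF Nx] by (subst model_norm2_single[OF zero_in_copies]) (auto simp: g_def fun_eq_iff)
  \<comment> \<open>Writing \<open>(cmod z)\<^sup>2\<close> as \<open>R\<^sup>2\<close> plus a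
    nonnegative excess lets a finite term be cancelled from an inequality in
    \<open>ennreal\<close>.\<close>
  also have "\<dots> = (\<integral>\<^sup>+z. ennreal (R\<^sup>2) * indicator B z + ennreal ((cmod z)\<^sup>2 - R\<^sup>2) * indicator B z \<partial>\<mu> k)"
  proof (rule nn_integral_cong)
    fix z :: complex
    have "R\<^sup>2 \<le> (cmod z)\<^sup>2" if "z \<in> B" using that R by (intro power_mono) (auto simp: B_def)
    then show "ennreal ((cmod (z * g k 0 z))\<^sup>2) = ennreal (R\<^sup>2) * indicator B z + ennreal ((cmod z)\<^sup>2 - R\<^sup>2) * indicator B z"
      by (auto simp: g_def indicator_def ennreal_plus[symmetric] simp del: ennreal_plus)
  qed
  also have "\<dots> = ennreal (R\<^sup>2) * emeasure (\<mu> k) B + (\<integral>\<^sup>+z. ennreal ((cmod z)\<^sup>2 - R\<^sup>2) * indicator B z \<partial>\<mu> k)"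
    by (subst nn_integral_add) (auto simp: nn_integral_cmult)
  finally have 1: "ennreal ((norm (N x))\<^sup>2)
      = ennreal (R\<^sup>2) * emeasure (\<mu> k) B + (\<integral>\<^sup>+z. ennreal ((cmod z)\<^sup>2 - R\<^sup>2) * indicator B z \<partial>\<mu> k)" .
  have "(norm (N x))\<^sup>2 \<le> R\<^sup>2 * (norm x)\<^sup>2"
    using power_mono[OF R(2)[of x], of 2] by (simp add: power_mult_distrib)
  then have "ennreal ((norm (N x))\<^sup>2) \<le> ennreal (R\<^sup>2) * ennreal ((norm x)\<^sup>2)"
    by (simp add: ennreal_mult[symmetric] ennreal_leI)
  also have "\<dots> = ennreal (R\<^sup>2) * emeasure (\<mu> k) B" unfolding norm_eqI[OF x] g_norm by simp
  finally have "ennreal (R\<^sup>2) * emeasure (\<mu> k) B + (\<integral>\<^sup>+z. ennreal ((cmod z)\<^sup>2 - R\<^sup>2) * indicator B z \<partial>\<mu> k)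
      \<le> ennreal (R\<^sup>2) * emeasure (\<mu> k) B + 0" unfolding 1 by simp
  moreover have "ennreal (R\<^sup>2) * emeasure (\<mu> k) B < top" using fin by (simp add: ennreal_mult_less_top)
  ultimately have "(\<integral>\<^sup>+z. ennreal ((cmod z)\<^sup>2 - R\<^sup>2) * indicator B z \<partial>\<mu> k) = 0"
    by (subst (asm) ennreal_add_left_cancel_le) auto
  then have "AE z in \<mu> k. ennreal ((cmod z)\<^sup>2 - R\<^sup>2) * indicator B z = 0"
    by (subst (asm) nn_integral_0_iff_AE) auto
  then show ?thesis
  proof eventually_elim
    case (elim z)
    show ?case
    proof (rule ccontr)
      assume "z \<notin> cball 0 R"
      then have z: "z \<in> B" by (simp add: B_def)
      then have "R\<^sup>2 < (cmod z)\<^sup>2" using R by (intro power_strict_mono) (auto simp: B_def)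
      then show False using elim z by simp
    qed
  qed
qed

text \<open>The scalar spectral measure of \<open>x\<close>: by \<open>sqn_weight\<close>,
  multiplying the components of \<open>x\<close> by \<open>\<phi>\<close> gives a squared norm equal
  to the integral of the squared modulus of \<open>\<phi>\<close>. Estimates over all components
  thus concern one measure.\<close>

definition weight :: "'a \<Rightarrow> complex measure" where
  "weight x = sum_measure borel (\<lambda>k. sum_measure borel (\<lambda>j. if j \<in> copies k
     then density (\<mu> k) (\<lambda>z. ennreal ((cmod (U x k j z))\<^sup>2)) else null_measure borel))"

lemma sets_weight [simp, measurable_cong]: "sets (weight x) = sets borel"
  by (simp add: weight_def)

lemma nn_integral_weight:
  assumes f: "f \<in> borel_measurable borel"
  shows "(\<integral>\<^sup>+z. f z \<partial>weight x) = (\<Sum>k. \<Sum>j. if j \<in> copies k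
    then (\<integral>\<^sup>+z. ennreal ((cmod (U x k j z))\<^sup>2) * f z \<partial>\<mu> k) else 0)"
proof -
  define W where "W k j = (if j \<in> copies k
     then density (\<mu> k) (\<lambda>z. ennreal ((cmod (U x k j z))\<^sup>2)) else null_measure borel)" for k j
  have W: "sets (W k j) = sets borel" for k j by (simp add: W_def)
  have 1: "(\<integral>\<^sup>+z. f z \<partial>weight x) = (\<Sum>k. \<Sum>j. \<integral>\<^sup>+z. f z \<partial>W k j)"
    unfolding weight_def W_def[symmetric]
    by (subst nn_integral_sum_measure[OF _ f], simp, intro suminf_cong nn_integral_sum_measure W f)
  have 2: "(\<integral>\<^sup>+z. f z \<partial>W k j) = (if j \<in> copies k
    then (\<integral>\<^sup>+z. ennreal ((cmod (U x k j z))\<^sup>2) * f z \<partial>\<mu> k) else 0)" for k j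
    using f by (auto simp: W_def nn_integral_density nn_integral_null_measure)
  show ?thesis unfolding 1 by (simp only: 2)
qed

lemma sqn_weight:
  assumes [measurable]: "\<phi> \<in> borel_measurable borel"
  shows "sqn (weight x) \<phi> = model_norm2 \<mu> (\<lambda>k j z. \<phi> z * U x k j z)"
  unfolding sqn_def
  by (subst nn_integral_weight)
     (auto simp: model_norm2_def norm_mult power_mult_distrib ennreal_mult mult.commute cong: if_cong)

lemma AE_weight:
  assumes "\<And>k. AE z in \<mu> k. z \<in> A" and [measurable]: "A \<in> sets borel"
  shows "AE z in weight x. z \<in> A"
proof -
  have "(\<integral>\<^sup>+z. indicator (- A) z \<partial>weight x) = (\<Sum>k::nat. \<Sum>j::nat. 0)"
  proof (subst nn_integral_weight, simp, intro suminf_cong)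
    fix k j :: nat
    have "(\<integral>\<^sup>+z. ennreal ((cmod (U x k j z))\<^sup>2) * indicator (- A) z \<partial>\<mu> k) = (\<integral>\<^sup>+z. 0 \<partial>\<mu> k)"
      by (rule nn_integral_cong_AE) (use assms(1)[of k] in eventually_elim, simp)
    then show "(if j \<in> copies k then \<integral>\<^sup>+z. ennreal ((cmod (U x k j z))\<^sup>2) * indicator (- A) z \<partial>\<mu> k else 0) = 0"
      by simp
  qed
  then have "(\<integral>\<^sup>+z. indicator (- A) z \<partial>weight x) = 0" by simp
  then have "AE z in weight x. indicator (- A) z = (0::ennreal)"
    by (subst (asm) nn_integral_0_iff_AE) auto
  then show ?thesis by eventually_elim (auto simp: indicator_def split: if_splits)
qed

lemma sqn_weight_const: "sqn (weight x) (\<lambda>z. c) = ennreal ((cmod c)\<^sup>2 * (norm x)\<^sup>2)"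
proof -
  have "sqn (weight x) (\<lambda>z. 1) = ennreal ((norm x)\<^sup>2)" by (simp add: sqn_weight U_norm)
  then show ?thesis using sqn_scale[of "\<lambda>z. 1" "weight x" c] by (simp add: ennreal_mult)
qed

lemma mult_op_unique: "mult_op \<phi> S \<Longrightarrow> mult_op \<phi> T \<Longrightarrow> S = T"
  using U_inj mult_op_eq by blast

lemma mult_op_add:
  assumes "mult_op \<phi> S" "mult_op \<psi> T"
  shows "mult_op (\<lambda>z. \<phi> z + \<psi> z) (\<lambda>x. S x + T x)"
  unfolding mult_op_def
proof (intro conjI allI)
  show "bounded_clinear (\<lambda>x. S x + T x)" using bounded_clinear_plus[of S T] assms by (simp add: mult_op_def)
  fix x
  have "ae_eq_model \<mu> (\<lambda>k j z. U (S x) k j z + U (T x) k j z) (\<lambda>k j z. (\<phi> z + \<psi> z) * U x k j z)"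
    by (rule ae_eq_lift2[OF mult_op_eq[OF assms(1), of x] mult_op_eq[OF assms(2), of x]]) (simp add: distrib_right)
  with U_add show "ae_eq_model \<mu> (U (S x + T x)) (\<lambda>k j z. (\<phi> z + \<psi> z) * U x k j z)" by (rule ae_eq_trans)
qed

lemma mult_op_const: "mult_op (\<lambda>z. c) (\<lambda>x. c *\<^sub>C x)"
  by (simp add: mult_op_def bounded_clinear_scaleC_op U_scale)

lemma mult_op_mult:
  assumes "mult_op \<phi> S" "mult_op \<psi> T"
  shows "mult_op (\<lambda>z. \<phi> z * \<psi> z) (\<lambda>x. S (T x))"
  unfolding mult_op_def
proof (intro conjI allI)
  show "bounded_clinear (\<lambda>x. S (T x))" using bounded_clinear_compose[of S T] assms by (simp add: mult_op_def)
  fix x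
  show "ae_eq_model \<mu> (U (S (T x))) (\<lambda>k j z. \<phi> z * \<psi> z * U x k j z)"
    by (rule ae_eq_lift2[OF mult_op_eq[OF assms(1), of "T x"] mult_op_eq[OF assms(2), of x]]) simp
qed

lemma mult_op_npoly: "npoly N f T \<Longrightarrow> mult_op f T"
  by (induction rule: npoly.induct)
     (auto intro: mult_op_const mult_op_N mult_op_adjoint mult_op_add mult_op_mult)

lemma bounded_mult_op_exists:
  assumes \<phi> [measurable]: "\<phi> \<in> borel_measurable borel" and K: "K \<in> sets borel" "\<And>k. AE z in \<mu> k. z \<in> K"
    and C: "\<And>z. z \<in> K \<Longrightarrow> cmod (\<phi> z) \<le> C"
  shows "\<exists>T. mult_op \<phi> T"
proof (rule mult_op_exists[OF \<phi>, of "C\<^sup>2"])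
  fix x
  have "model_norm2 \<mu> (\<lambda>k j z. \<phi> z * U x k j z) = sqn (weight x) \<phi>" by (rule sqn_weight[OF \<phi>, symmetric])
  also have "\<dots> \<le> sqn (weight x) (\<lambda>z. of_real C)"
    unfolding sqn_def
  proof (rule nn_integral_mono_AE)
    show "AE z in weight x. ennreal ((cmod (\<phi> z))\<^sup>2) \<le> ennreal ((cmod (complex_of_real C))\<^sup>2)"
      using AE_weight[OF K(2,1), of x]
    proof eventually_elim
      case (elim z)
      from C[OF this] have "(cmod (\<phi> z))\<^sup>2 \<le> C\<^sup>2" by (intro power_mono) auto
      then show ?case by (simp add: ennreal_leI)
    qed
  qed
  also have "\<dots> = ennreal (C\<^sup>2 * (norm x)\<^sup>2)" by (simp add: sqn_weight_const)
  finally show "model_norm2 \<mu> (\<lambda>k j z. \<phi> z * U x k j z) \<le> ennreal (C\<^sup>2 * (norm x)\<^sup>2)" .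
qed simp

text \<open>The squared norm of the error is an integral for \<open>weight x\<close>, so dominated
  convergence yields strong convergence of the operators.\<close>

lemma mult_op_tendsto:
  assumes \<phi>: "\<And>n. \<phi> n \<in> borel_measurable borel" "\<psi> \<in> borel_measurable borel"
    and K: "K \<in> sets borel" "\<And>k. AE z in \<mu> k. z \<in> K"
    and C: "\<And>n z. z \<in> K \<Longrightarrow> cmod (\<phi> n z) \<le> C" and lim: "\<And>z. z \<in> K \<Longrightarrow> (\<lambda>n. \<phi> n z) \<longlonglongrightarrow> \<psi> z"
    and T: "\<And>n. mult_op (\<phi> n) (T n)" and S: "mult_op \<psi> S"
  shows "(\<lambda>n. T n x) \<longlonglongrightarrow> S x"
proof -
  have m: "borel_measurable (weight x) = (borel_measurable borel :: (complex \<Rightarrow> complex) set)"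
    by (rule measurable_cong_sets) auto
  have "(\<lambda>n. sqn (weight x) (\<lambda>z. \<phi> n z - \<psi> z)) \<longlonglongrightarrow> 0"
  proof (rule sqn_dominated[where w="\<lambda>z. of_real C"])
    show "AE z in weight x. cmod (\<phi> n z) \<le> cmod (complex_of_real C)" for n
      using AE_weight[OF K(2,1), of x]
    proof eventually_elim
      case (elim z)
      from C[OF this, of n] show ?case by simp
    qed
    show "AE z in weight x. (\<lambda>n. \<phi> n z) \<longlonglongrightarrow> \<psi> z"
      using AE_weight[OF K(2,1), of x] by eventually_elim (rule lim)
  qed (use \<phi> in \<open>auto simp: m sqn_weight_const\<close>)
  moreover have "ennreal ((norm (T n x - S x))\<^sup>2) = sqn (weight x) (\<lambda>z. \<phi> n z - \<psi> z)" for n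
  proof -
    have "ae_eq_model \<mu> (\<lambda>k j z. U (T n x) k j z - U (S x) k j z) (\<lambda>k j z. (\<phi> n z - \<psi> z) * U x k j z)"
      by (rule ae_eq_lift2[OF mult_op_eq[OF T[of n], of x] mult_op_eq[OF S, of x]]) (simp add: left_diff_distrib)
    from norm_eqI[OF ae_eq_trans[OF U_diff this]] show ?thesis using \<phi> by (simp add: sqn_weight)
  qed
  ultimately have "(\<lambda>n. T n x - S x) \<longlonglongrightarrow> 0" by (intro ennreal_square_tendsto_0) simp
  then show ?thesis by (rule LIM_zero_cancel)
qed

lemma limit_in_von_neumann_algebra:
  fixes T :: "nat \<Rightarrow> 'a \<Rightarrow> 'a"
  assumes A: "von_neumann_algebra A" and T: "\<And>n. T n \<in> A" and S: "bounded_clinear S"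
    and lim: "\<And>x. (\<lambda>n. T n x) \<longlonglongrightarrow> S x"
  shows "S \<in> A"
proof -
  have "S \<in> wot_closure A"
    unfolding wot_closure_def
  proof (intro CollectI allI impI)
    fix F :: "('a \<times> 'a) set" and e :: real assume F: "finite F" and e: "e > 0"
    have "\<forall>\<^sub>F n in sequentially. cmod (cinner (S x - T n x) y) < e" for x y
    proof -
      have "(\<lambda>n. cmod (cinner (S x - T n x) y)) \<longlonglongrightarrow> cmod (cinner (S x - S x) y)"
        by (intro tendsto_intros lim)
      then have "(\<lambda>n. cmod (cinner (S x - T n x) y)) \<longlonglongrightarrow> 0" by simp
      then show ?thesis by (rule order_tendstoD(2)) (rule e)
    qed
    then have "\<forall>\<^sub>F n in sequentially. \<forall>p\<in>F. cmod (cinner (S (fst p) - T n (fst p)) (snd p)) < e"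
      using F by (intro eventually_ball_finite) auto
    then obtain n where "\<forall>p\<in>F. cmod (cinner (S (fst p) - T n (fst p)) (snd p)) < e"
      unfolding eventually_sequentially by blast
    then show "\<exists>T\<in>A. \<forall>(x, y)\<in>F. cmod (cinner (S x - T x) y) < e"
      using T[of n] by (intro bexI[of _ "T n"]) auto
  qed
  then show ?thesis using A S unfolding von_neumann_algebra_def by blast
qed

text \<open>\<open>T\<close> is fixed before the algebra \<open>A\<close> varies; the induction
  finds in each \<open>A\<close> some operator multiplying by \<open>\<phi>\<close>, and uniqueness
  identifies it with \<open>T\<close>. Bounded pointwise limits stay in \<open>A\<close> because
  strong convergence implies weak operator convergence.\<close>

lemma bounded_mult_op_in_vN_generated:
  assumes \<phi>: "\<phi> \<in> borel_measurable borel" and C: "\<And>z. cmod (\<phi> z) \<le> C"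
  shows "\<exists>T\<in>vN_generated N. mult_op \<phi> T"
proof -
  obtain R where R: "R > 0" "\<And>x. norm (N x) \<le> R * norm x" using bounded_clinear_bound[OF N] by blast
  define K where "K = cball (0::complex) R"
  have K: "K \<in> sets borel" "\<And>k. AE z in \<mu> k. z \<in> K" "compact K"
    using AE_support[of R] R by (auto simp: K_def)
  obtain T where T: "mult_op \<phi> T" using bounded_mult_op_exists[OF \<phi> K(1,2)] C by blast
  have "T \<in> A" if A: "von_neumann_algebra A" "N \<in> A" for A
  proof -
    \<comment> \<open>Measurability is part of the inductive property because the limit case uses it
      for the approximating functions.\<close>
    have "\<phi> \<in> borel_measurable borel \<and> (\<exists>T\<in>A. mult_op \<phi> T)"
    proof (rule borel_bounded_induct[where K=K and g=\<phi> and C=C])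
      fix p :: "complex \<Rightarrow> real" assume "real_polynomial_function p"
      then obtain S where S: "npoly N (\<lambda>z. complex_of_real (p z)) S" using npoly_real_polynomial by blast
      show "(\<lambda>z. complex_of_real (p z)) \<in> borel_measurable borel \<and> (\<exists>T\<in>A. mult_op (\<lambda>z. complex_of_real (p z)) T)"
        using borel_measurable_continuous_onI[OF npoly_continuous[OF S]] mult_op_npoly[OF S]
          npoly_in_von_neumann_algebra[OF A S] by blast
    next
      fix f g assume *: "f \<in> borel_measurable borel \<and> (\<exists>T\<in>A. mult_op f T)" "g \<in> borel_measurable borel \<and> (\<exists>T\<in>A. mult_op g T)"
      then obtain S T where ST: "S \<in> A" "T \<in> A" "mult_op f S" "mult_op g T" by blast
      then have "(\<lambda>x. S x + T x) \<in> A" using A(1) unfolding von_neumann_algebra_def by blast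
      then show "(\<lambda>z. f z + g z) \<in> borel_measurable borel \<and> (\<exists>T\<in>A. mult_op (\<lambda>z. f z + g z) T)"
        using mult_op_add[OF ST(3,4)] * by auto
    next
      fix c f assume *: "f \<in> borel_measurable borel \<and> (\<exists>T\<in>A. mult_op f T)"
      then obtain S where S: "S \<in> A" "mult_op f S" by blast
      then have "(\<lambda>x. c *\<^sub>C S x) \<in> A" using A(1) unfolding von_neumann_algebra_def by blast
      then show "(\<lambda>z. c * f z) \<in> borel_measurable borel \<and> (\<exists>T\<in>A. mult_op (\<lambda>z. c * f z) T)"
        using mult_op_mult[OF mult_op_const S(2)] * by auto
    next
      fix f :: "nat \<Rightarrow> complex \<Rightarrow> complex" and g B
      assume f: "\<And>n. f n \<in> borel_measurable borel \<and> (\<exists>T\<in>A. mult_op (f n) T)" and g: "g \<in> borel_measurable borel"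
        and B: "\<And>n z. z \<in> K \<Longrightarrow> cmod (f n z) \<le> B" and lim: "\<And>z. z \<in> K \<Longrightarrow> (\<lambda>n. f n z) \<longlonglongrightarrow> g z"
      have "\<forall>n. \<exists>T. T \<in> A \<and> mult_op (f n) T" using f by blast
      from choice[OF this] obtain T where T: "\<And>n. T n \<in> A" "\<And>n. mult_op (f n) (T n)" by blast
      have "cmod (g z) \<le> B" if "z \<in> K" for z
        by (rule tendsto_upperbound[OF tendsto_norm[OF lim[OF that]]]) (use B that in auto)
      then obtain S where S: "mult_op g S" using bounded_mult_op_exists[OF g K(1,2)] by blast
      have "(\<lambda>n. T n x) \<longlonglongrightarrow> S x" for x
        by (rule mult_op_tendsto[OF _ g K(1,2) B lim T(2) S]) (use f in auto)
      then have "S \<in> A"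
        by (intro limit_in_von_neumann_algebra[OF A(1) T(1)]) (use S in \<open>auto simp: mult_op_def\<close>)
      then show "g \<in> borel_measurable borel \<and> (\<exists>T\<in>A. mult_op g T)" using g S by blast
    qed (use K \<phi> C in auto)
    then show ?thesis using mult_op_unique[OF T] by blast
  qed
  then have "T \<in> vN_generated N" unfolding vN_generated_def by blast
  then show ?thesis using T by blast
qed

end

section \<open>Finite multiplicity: pointwise orthonormal frames\<close>

definition dot :: "nat \<Rightarrow> (nat \<Rightarrow> complex) \<Rightarrow> (nat \<Rightarrow> complex) \<Rightarrow> complex" where
  "dot k a b = (\<Sum>j<k. a j * cnj (b j))"

lemma dot_cong: "(\<And>j. j < k \<Longrightarrow> a j = a' j) \<Longrightarrow> (\<And>j. j < k \<Longrightarrow> b j = b' j) \<Longrightarrow> dot k a b = dot k a' b'"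
  unfolding dot_def by (rule sum.cong) auto

lemma dot_commute: "dot k b a = cnj (dot k a b)"
  by (simp add: dot_def mult.commute)

lemma dot_diff_left: "dot k (\<lambda>j. a j - b j) c = dot k a c - dot k b c"
  by (simp add: dot_def left_diff_distrib sum_subtractf)

lemma dot_scale_left: "dot k (\<lambda>j. c * a j) b = c * dot k a b"
  by (simp add: dot_def sum_distrib_left mult.assoc)

lemma dot_sum_left: "dot k (\<lambda>j. \<Sum>i\<in>I. a i j) b = (\<Sum>i\<in>I. dot k (a i) b)"
  by (simp add: dot_def sum_distrib_right sum.swap[of _ I])

lemma dot_self: "dot k a a = complex_of_real (\<Sum>j<k. (cmod (a j))\<^sup>2)"
  by (simp add: dot_def complex_norm_square[symmetric] del: of_real_power)

text \<open>The Gram-Schmidt remainder: for orthonormal \<open>h\<close>, the part of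
  \<open>u\<close> orthogonal to the first \<open>r\<close> vectors. On the first \<open>k\<close>
  coordinates it vanishes exactly when \<open>u\<close> lies in their span.\<close>

definition resid :: "nat \<Rightarrow> nat \<Rightarrow> (nat \<Rightarrow> nat \<Rightarrow> complex) \<Rightarrow> (nat \<Rightarrow> complex) \<Rightarrow> nat \<Rightarrow> complex" where
  "resid k r h u j = u j - (\<Sum>i<r. dot k u (h i) * h i j)"

definition orthonormal :: "nat \<Rightarrow> nat \<Rightarrow> (nat \<Rightarrow> nat \<Rightarrow> complex) \<Rightarrow> bool" where
  "orthonormal k r h \<longleftrightarrow> (\<forall>i<r. \<forall>l<r. dot k (h i) (h l) = (if i = l then 1 else 0))"

lemma dot_resid_left: "dot k (resid k r h u) v = dot k u v - (\<Sum>i<r. dot k u (h i) * dot k (h i) v)"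
  by (simp add: resid_def[abs_def] dot_diff_left dot_sum_left dot_scale_left)

lemma dot_resid:
  assumes "orthonormal k r h" "l < r"
  shows "dot k (resid k r h u) (h l) = 0"
proof -
  have "(\<Sum>i<r. dot k u (h i) * dot k (h i) (h l)) = (\<Sum>i<r. if i = l then dot k u (h l) else 0)"
    using assms by (intro sum.cong) (auto simp: orthonormal_def)
  then show ?thesis using assms(2) by (simp add: dot_resid_left)
qed

text \<open>The difference of the two sides is the squared length of the remainder.\<close>

lemma bessel:
  assumes "orthonormal k r h"
  shows "(\<Sum>i<r. (cmod (dot k u (h i)))\<^sup>2) \<le> (\<Sum>j<k. (cmod (u j))\<^sup>2)"
proof -
  let ?p = "resid k r h u"
  have "dot k u ?p = cnj (dot k ?p u)" by (rule dot_commute)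
  also have "dot k ?p u = dot k u u - (\<Sum>i<r. dot k u (h i) * cnj (dot k u (h i)))"
    unfolding dot_resid_left
    by (intro arg_cong2[where f=minus] refl sum.cong arg_cong2[where f=times] dot_commute)
  also have "\<dots> = complex_of_real ((\<Sum>j<k. (cmod (u j))\<^sup>2) - (\<Sum>i<r. (cmod (dot k u (h i)))\<^sup>2))"
    by (simp add: dot_self complex_norm_square[symmetric] del: of_real_power)
  finally have 1: "dot k u ?p = complex_of_real ((\<Sum>j<k. (cmod (u j))\<^sup>2) - (\<Sum>i<r. (cmod (dot k u (h i)))\<^sup>2))"
    by simp
  have "dot k ?p ?p = dot k u ?p - (\<Sum>i<r. dot k u (h i) * dot k (h i) ?p)"
    by (rule dot_resid_left)
  also have "(\<Sum>i<r. dot k u (h i) * dot k (h i) ?p) = 0"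
  proof (intro sum.neutral ballI)
    fix i assume "i \<in> {..<r}"
    then show "dot k u (h i) * dot k (h i) ?p = 0"
      using dot_resid[OF assms, of i u] dot_commute[of k "h i" ?p] by simp
  qed
  finally have "complex_of_real (\<Sum>j<k. (cmod (?p j))\<^sup>2)
      = complex_of_real ((\<Sum>j<k. (cmod (u j))\<^sup>2) - (\<Sum>i<r. (cmod (dot k u (h i)))\<^sup>2))"
    unfolding dot_self 1 by simp
  then have "(\<Sum>j<k. (cmod (?p j))\<^sup>2) = (\<Sum>j<k. (cmod (u j))\<^sup>2) - (\<Sum>i<r. (cmod (dot k u (h i)))\<^sup>2)"
    by (simp only: of_real_eq_iff)
  moreover have "0 \<le> (\<Sum>j<k. (cmod (?p j))\<^sup>2)" by (rule sum_nonneg) simp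
  ultimately show ?thesis by linarith
qed

text \<open>Bessel's inequality for the \<open>k\<close> standard unit vectors is summed up;
  exchanging the sums gives \<open>r\<close>, because every member of the family has length
  1.\<close>

lemma orthonormal_card_le:
  assumes "orthonormal k r h"
  shows "r \<le> k"
proof -
  have "(\<Sum>i<r. (cmod (h i m))\<^sup>2) \<le> 1" if m: "m < k" for m
  proof -
    define e where "e j = (if j = m then 1 else 0 :: complex)" for j
    have "dot k e (h i) = cnj (h i m)" for i
    proof -
      have "dot k e (h i) = (\<Sum>j<k. if j = m then cnj (h i m) else 0)"
        unfolding dot_def e_def by (intro sum.cong) auto
      then show ?thesis using m by simp
    qed
    moreover have "(\<Sum>j<k. (cmod (e j))\<^sup>2) = (\<Sum>j<k. if j = m then 1 else 0)"
      unfolding e_def by (intro sum.cong) auto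
    ultimately show ?thesis using bessel[OF assms, of e] m by simp
  qed
  then have "(\<Sum>m<k. \<Sum>i<r. (cmod (h i m))\<^sup>2) \<le> (\<Sum>m<k. 1)" by (intro sum_mono) auto
  moreover have "(\<Sum>m<k. \<Sum>i<r. (cmod (h i m))\<^sup>2) = (\<Sum>i<r. \<Sum>m<k. (cmod (h i m))\<^sup>2)" by (rule sum.swap)
  moreover have "(\<Sum>m<k. (cmod (h i m))\<^sup>2) = 1" if "i < r" for i
  proof -
    have "complex_of_real (\<Sum>m<k. (cmod (h i m))\<^sup>2) = complex_of_real 1"
      using assms that unfolding dot_self[symmetric] by (simp add: orthonormal_def)
    then show ?thesis by (simp only: of_real_eq_iff)
  qed
  ultimately have "real r \<le> real k" by simp
  then show ?thesis by simp
qed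

lemma orthonormal_extend:
  assumes h: "orthonormal k r h" and y: "\<And>j. j < k \<Longrightarrow> y j = resid k r h u j / complex_of_real (sqrt q)"
    and q: "q = (\<Sum>j<k. (cmod (resid k r h u j))\<^sup>2)" "q > 0"
  shows "orthonormal k (Suc r) (h(r := y))"
proof -
  have y_eq: "dot k y v = inverse (complex_of_real (sqrt q)) * dot k (resid k r h u) v" for v
  proof -
    have "dot k y v = dot k (\<lambda>j. inverse (complex_of_real (sqrt q)) * resid k r h u j) v"
      by (rule dot_cong) (auto simp: y divide_inverse mult.commute)
    then show ?thesis by (simp add: dot_scale_left)
  qed
  have yh: "dot k y (h l) = 0" if "l < r" for l by (simp add: y_eq dot_resid[OF h that])
  have hy: "dot k (h l) y = 0" if "l < r" for l using yh[OF that] dot_commute[of k "h l" y] by simp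
  have "(\<Sum>j<k. (cmod (y j))\<^sup>2) = (\<Sum>j<k. (cmod (resid k r h u j))\<^sup>2 / q)"
    using q(2) by (intro sum.cong) (auto simp: y norm_divide power_divide)
  also have "\<dots> = 1" using q by (simp add: sum_divide_distrib[symmetric])
  finally have "dot k y y = 1" by (simp add: dot_self)
  then show ?thesis using h yh hy by (auto simp: orthonormal_def less_Suc_eq)
qed

lemma commutes_withD:
  assumes "commutes_with X D A"
  shows "x \<in> D \<Longrightarrow> y \<in> D \<Longrightarrow> x + y \<in> D" "x \<in> D \<Longrightarrow> y \<in> D \<Longrightarrow> X (x + y) = X x + X y"
    "x \<in> D \<Longrightarrow> c *\<^sub>C x \<in> D" "x \<in> D \<Longrightarrow> X (c *\<^sub>C x) = c *\<^sub>C X x"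
  using assms by (simp_all add: commutes_with_def)

section \<open>Frames inside the domain and the pointwise action of \<open>X\<close>\<close>

context spectral_model
begin

lemma commutes_mult:
  assumes com: "commutes_with X D (vN_generated N)" and x: "x \<in> D"
    and \<phi>: "\<phi> \<in> borel_measurable borel" "\<And>z. cmod (\<phi> z) \<le> C"
  shows "\<exists>y\<in>D. ae_eq_model \<mu> (U y) (\<lambda>k j z. \<phi> z * U x k j z) \<and>
    ae_eq_model \<mu> (U (X y)) (\<lambda>k j z. \<phi> z * U (X x) k j z)"
proof -
  obtain T where T: "T \<in> vN_generated N" "mult_op \<phi> T"
    using bounded_mult_op_in_vN_generated[OF \<phi>] by blast
  have "T x \<in> D" "X (T x) = T (X x)" using com T(1) x unfolding commutes_with_def by blast+
  then show ?thesis using mult_op_eq[OF T(2), of x] mult_op_eq[OF T(2), of "X x"] by (intro bexI[of _ "T x"]) auto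
qed

text \<open>\<open>X\<close> is linear over bounded Borel functions. One \<open>y\<close> serves
  both identities, so a pointwise relation between members of \<open>D\<close> carries over to their
  images.\<close>

lemma commutes_combination:
  fixes r :: nat
  assumes com: "commutes_with X D (vN_generated N)" and g: "\<And>i. i < r \<Longrightarrow> g i \<in> D"
    and \<phi>: "\<And>i. i < r \<Longrightarrow> \<phi> i \<in> borel_measurable borel" "\<And>i z. i < r \<Longrightarrow> cmod (\<phi> i z) \<le> C"
  shows "\<exists>y\<in>D. ae_eq_model \<mu> (U y) (\<lambda>k j z. \<Sum>i<r. \<phi> i z * U (g i) k j z) \<and>
    ae_eq_model \<mu> (U (X y)) (\<lambda>k j z. \<Sum>i<r. \<phi> i z * U (X (g i)) k j z)"
  using g \<phi>
proof (induction r)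
  case 0
  have "0 \<in> D" using com by (simp add: commutes_with_def)
  moreover from commutes_withD(4)[OF com this, of 0] have "X 0 = 0" by simp
  ultimately have "0 \<in> D" "X 0 = 0" by auto
  then show ?case using U_zero by (intro bexI[of _ 0]) auto
next
  case (Suc r)
  have "\<exists>y\<in>D. ae_eq_model \<mu> (U y) (\<lambda>k j z. \<Sum>i<r. \<phi> i z * U (g i) k j z) \<and>
    ae_eq_model \<mu> (U (X y)) (\<lambda>k j z. \<Sum>i<r. \<phi> i z * U (X (g i)) k j z)"
    by (rule Suc.IH) (use Suc.prems in auto)
  then obtain y where y: "y \<in> D" "ae_eq_model \<mu> (U y) (\<lambda>k j z. \<Sum>i<r. \<phi> i z * U (g i) k j z)"
    "ae_eq_model \<mu> (U (X y)) (\<lambda>k j z. \<Sum>i<r. \<phi> i z * U (X (g i)) k j z)" by blast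
  obtain w where w: "w \<in> D" "ae_eq_model \<mu> (U w) (\<lambda>k j z. \<phi> r z * U (g r) k j z)"
    "ae_eq_model \<mu> (U (X w)) (\<lambda>k j z. \<phi> r z * U (X (g r)) k j z)"
    using commutes_mult[OF com, of "g r" "\<phi> r" C] Suc.prems by auto
  note yw = commutes_withD(1,2)[OF com y(1) w(1)]
  have "ae_eq_model \<mu> (\<lambda>k j z. U y k j z + U w k j z) (\<lambda>k j z. \<Sum>i<Suc r. \<phi> i z * U (g i) k j z)"
    by (rule ae_eq_lift2[OF y(2) w(2)]) simp
  then have 1: "ae_eq_model \<mu> (U (y + w)) (\<lambda>k j z. \<Sum>i<Suc r. \<phi> i z * U (g i) k j z)"
    by (rule ae_eq_trans[OF U_add])
  have "ae_eq_model \<mu> (\<lambda>k j z. U (X y) k j z + U (X w) k j z) (\<lambda>k j z. \<Sum>i<Suc r. \<phi> i z * U (X (g i)) k j z)"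
    by (rule ae_eq_lift2[OF y(3) w(3)]) simp
  then have 2: "ae_eq_model \<mu> (U (X y + X w)) (\<lambda>k j z. \<Sum>i<Suc r. \<phi> i z * U (X (g i)) k j z)"
    by (rule ae_eq_trans[OF U_add])
  show ?case using 1 2 yw by (intro bexI[of _ "y + w"]) auto
qed

text \<open>The fibre of \<open>x\<close> at the point \<open>z\<close>; the component index comes
  last so that a fibre is a vector for \<open>dot\<close>.\<close>

definition pt :: "nat \<Rightarrow> 'a \<Rightarrow> complex \<Rightarrow> nat \<Rightarrow> complex" where
  "pt k x z j = U x k j z"

lemma less_in_copies: "j < k \<Longrightarrow> j \<in> copies k"
  by (simp add: copies_def)

lemma ae_eq_pt:
  assumes "ae_eq_model \<mu> (U x) g"
  shows "AE z in \<mu> k. \<forall>j<k. pt k x z j = g k j z"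
proof -
  have "AE z in \<mu> k. \<forall>j\<in>{..<k}. U x k j z = g k j z"
    by (rule AE_finite_allI) (use ae_eqD[OF assms less_in_copies] in auto)
  then show ?thesis by eventually_elim (simp add: pt_def)
qed

lemma pt_measurable [measurable]: "j < k \<Longrightarrow> (\<lambda>z. pt k x z j) \<in> borel_measurable borel"
  using U_meas[OF less_in_copies] by (simp add: pt_def)

lemma dot_measurable [measurable]: "(\<lambda>z. dot k (pt k x z) (pt k y z)) \<in> borel_measurable borel"
proof -
  have [measurable]: "cnj \<in> borel_measurable borel" by (intro borel_measurable_continuous_onI continuous_intros)
  show ?thesis unfolding dot_def by (intro borel_measurable_sum) measurable
qed

text \<open>Orthonormality holds at every point of \<open>E\<close> rather than almost everywhere,
  so that a single point bounds the length \<open>r\<close>; null sets are removed whenever a frame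
  is extended.\<close>

definition frame :: "nat \<Rightarrow> 'a set \<Rightarrow> nat \<Rightarrow> complex set \<Rightarrow> (nat \<Rightarrow> 'a) \<Rightarrow> bool" where
  "frame k D r E h \<longleftrightarrow> E \<in> sets borel \<and> (\<forall>i<r. h i \<in> D) \<and> (\<forall>z\<in>E. orthonormal k r (\<lambda>i. pt k (h i) z))"

text \<open>One Gram-Schmidt step inside \<open>D\<close>. The coefficients \<open>c i\<close> and
  the inverse length of the remainder may be unbounded, so the step is made on a set
  \<open>B n\<close> where both are bounded. These sets exhaust the points of \<open>E\<close> with
  nonzero remainder, so one of them is not null.\<close>

lemma frame_extend:
  assumes com: "commutes_with X D (vN_generated N)" and fr: "frame k D r E h" and g: "g \<in> D"
    and ne: "\<not> (AE z in \<mu> k. z \<in> E \<longrightarrow> (\<forall>j<k. resid k r (\<lambda>i. pt k (h i) z) (pt k g z) j = 0))"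
  shows "\<exists>E' h'. E' \<subseteq> E \<and> emeasure (\<mu> k) E' \<noteq> 0 \<and> frame k D (Suc r) E' h'"
proof -
  have E [measurable]: "E \<in> sets borel" using fr by (simp add: frame_def)
  define c where "c i z = dot k (pt k g z) (pt k (h i) z)" for i z
  define p where "p j z = resid k r (\<lambda>i. pt k (h i) z) (pt k g z) j" for j z
  define q where "q z = (\<Sum>j<k. (cmod (p j z))\<^sup>2)" for z
  have c_meas [measurable]: "c i \<in> borel_measurable borel" for i unfolding c_def[abs_def] by measurable
  have p_eq: "p j z = pt k g z j - (\<Sum>i<r. c i z * pt k (h i) z j)" for j z by (simp add: p_def resid_def c_def)
  have p_meas [measurable]: "p j \<in> borel_measurable borel" if "j < k" for j
    unfolding p_eq[abs_def] using that by measurable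
  have q_meas [measurable]: "q \<in> borel_measurable borel"
    unfolding q_def[abs_def] by (intro borel_measurable_sum) measurable
  have q0: "0 \<le> q z" for z by (simp add: q_def sum_nonneg)
  define B where "B n = {z\<in>E. 1 / real (Suc n) \<le> q z \<and> (\<forall>i<r. cmod (c i z) \<le> real (Suc n))}" for n
  have B_meas [measurable]: "B n \<in> sets borel" for n unfolding B_def by measurable
  have "\<exists>n. emeasure (\<mu> k) (B n) \<noteq> 0"
  proof (rule ccontr)
    assume "\<not> ?thesis"
    then have "AE z in \<mu> k. z \<notin> B n" for n by (intro AE_not_in) (auto simp: null_sets_def)
    then have "AE z in \<mu> k. \<forall>n. z \<notin> B n" by (intro AE_all_countable[THEN iffD2] allI)
    then have "AE z in \<mu> k. z \<in> E \<longrightarrow> (\<forall>j<k. p j z = 0)"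
    proof eventually_elim
      case (elim z)
      show ?case
      proof (rule impI, rule ccontr)
        assume z: "z \<in> E" and "\<not> (\<forall>j<k. p j z = 0)"
        then obtain j where j: "j < k" "p j z \<noteq> 0" by blast
        have "0 < (cmod (p j z))\<^sup>2" using j by simp
        also have "\<dots> \<le> q z" unfolding q_def by (rule member_le_sum) (use j in auto)
        finally have qz: "0 < q z" .
        obtain n1 where n1: "1 / real (Suc n1) < q z" using nat_approx_posE[OF qz] by blast
        obtain n2 where n2: "(\<Sum>i<r. cmod (c i z)) \<le> real n2" using real_arch_simple by blast
        define n where "n = max n1 n2"
        have "1 / real (Suc n) \<le> 1 / real (Suc n1)" by (simp add: n_def frac_le)
        moreover have "cmod (c i z) \<le> real (Suc n)" if "i < r" for i
        proof -
          have "cmod (c i z) \<le> (\<Sum>i<r. cmod (c i z))" by (rule member_le_sum) (use that in auto)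
          then show ?thesis using n2 by (simp add: n_def)
        qed
        ultimately have "z \<in> B n" using z n1 by (auto simp: B_def)
        then show False using elim by blast
      qed
    qed
    then show False using ne by (simp add: p_def)
  qed
  then obtain n where n: "emeasure (\<mu> k) (B n) \<noteq> 0" by blast
  define M where "M = real (Suc n)"
  have M: "M \<ge> 1" by (simp add: M_def)
  \<comment> \<open>On \<open>B n\<close> the numerators are at most \<open>M\<close> and
    \<open>sqrt (q z)\<close> is at least \<open>1 / M\<close>, which gives the bound
    \<open>M * M\<close>; the indicator extends it to the whole plane.\<close>
  define \<phi> where "\<phi> i z = indicator (B n) z * ((if i = r then 1 else - c i z) / complex_of_real (sqrt (q z)))" for i z
  have \<phi>_meas: "\<phi> i \<in> borel_measurable borel" for i
    unfolding \<phi>_def[abs_def] by (cases "i = r") (simp_all)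
  have \<phi>_bound: "cmod (\<phi> i z) \<le> M * M" if i: "i < Suc r" for i z
  proof (cases "z \<in> B n")
    case True
    have "1 / M \<le> q z" using True by (simp add: B_def M_def)
    moreover have "(1 / M)\<^sup>2 \<le> 1 / M" using M by (simp add: power2_eq_square field_simps)
    ultimately have "sqrt ((1 / M)\<^sup>2) \<le> sqrt (q z)" by (simp only: real_sqrt_le_iff)
    then have sq: "1 / M \<le> sqrt (q z)" using M by simp
    have num: "cmod (if i = r then 1 else - c i z) \<le> M" using True i M by (auto simp: B_def M_def)
    have "cmod (\<phi> i z) = cmod (if i = r then 1 else - c i z) / sqrt (q z)"
      using True q0[of z] by (simp add: \<phi>_def norm_divide)
    also have "\<dots> \<le> M / (1 / M)" using num sq M by (intro frac_le) auto
    finally show ?thesis by simp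
  qed (use M in \<open>simp add: \<phi>_def\<close>)
  define gg where "gg i = (if i = r then g else h i)" for i
  have gD: "gg i \<in> D" if "i < Suc r" for i using fr g that by (auto simp: gg_def frame_def)
  have "\<exists>y\<in>D. ae_eq_model \<mu> (U y) (\<lambda>k j z. \<Sum>i<Suc r. \<phi> i z * U (gg i) k j z) \<and>
      ae_eq_model \<mu> (U (X y)) (\<lambda>k j z. \<Sum>i<Suc r. \<phi> i z * U (X (gg i)) k j z)"
    by (rule commutes_combination[OF com gD \<phi>_meas \<phi>_bound])
  then obtain y where y: "y \<in> D" "ae_eq_model \<mu> (U y) (\<lambda>k j z. \<Sum>i<Suc r. \<phi> i z * U (gg i) k j z)"
    by (elim bexE conjE) (rule that)
  \<comment> \<open>The formula for \<open>y\<close> holds off a null set, which is removed so that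
    orthonormality holds at every remaining point.\<close>
  obtain Z where Z: "{z \<in> space (\<mu> k). \<not> (\<forall>j<k. pt k y z j = (\<Sum>i<Suc r. \<phi> i z * U (gg i) k j z))} \<subseteq> Z"
    "emeasure (\<mu> k) Z = 0" "Z \<in> sets (\<mu> k)" using AE_E[OF ae_eq_pt[OF y(2), of k]] by blast
  have y_eq: "pt k y z j = p j z / complex_of_real (sqrt (q z))" if "z \<in> B n - Z" "j < k" for z j
  proof -
    have "pt k y z j = (\<Sum>i<Suc r. \<phi> i z * U (gg i) k j z)" using Z(1) that by auto
    also have "\<dots> = (pt k g z j - (\<Sum>i<r. c i z * pt k (h i) z j)) / complex_of_real (sqrt (q z))"
      using that by (simp add: \<phi>_def gg_def pt_def sum_divide_distrib diff_divide_distrib sum_negf)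
    finally show ?thesis by (simp add: p_eq)
  qed
  have "frame k D (Suc r) (B n - Z) (h(r := y))"
    unfolding frame_def
  proof (intro conjI ballI allI impI)
    show "B n - Z \<in> sets borel" using Z(3) by simp
    show "(h(r := y)) i \<in> D" if "i < Suc r" for i using that y(1) fr by (auto simp: frame_def less_Suc_eq)
    fix z assume z: "z \<in> B n - Z"
    have eq: "(\<lambda>i. pt k ((h(r := y)) i) z) = (\<lambda>i. pt k (h i) z)(r := pt k y z)" by (auto simp: fun_eq_iff)
    show "orthonormal k (Suc r) (\<lambda>i. pt k ((h(r := y)) i) z)"
      unfolding eq
    proof (rule orthonormal_extend[where u="pt k g z" and q="q z"])
      show "orthonormal k r (\<lambda>i. pt k (h i) z)" using fr z by (auto simp: frame_def B_def)
      show "pt k y z j = resid k r (\<lambda>i. pt k (h i) z) (pt k g z) j / complex_of_real (sqrt (q z))" if "j < k" for j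
        using y_eq[OF z that] by (simp add: p_def)
      have "0 < 1 / real (Suc n)" by simp
      also have "\<dots> \<le> q z" using z by (simp add: B_def)
      finally show "0 < q z" .
    qed (simp add: q_def p_def)
  qed
  moreover have "B n - Z \<subseteq> E" by (auto simp: B_def)
  moreover have "emeasure (\<mu> k) (B n - Z) = emeasure (\<mu> k) (B n)"
    using Z by (intro emeasure_Diff_null_set) (auto simp: null_sets_def)
  ultimately show ?thesis using n by (intro exI[of _ "B n - Z"] exI[of _ "h(r := y)"]) auto
qed

text \<open>Otherwise frames on non-null subsets could be extended up to length
  \<open>k + 1\<close>, which dimension \<open>k\<close> forbids.\<close>

lemma maximal_frame_exists:
  assumes com: "commutes_with X D (vN_generated N)" and E0: "E0 \<in> sets borel" "emeasure (\<mu> k) E0 \<noteq> 0"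
  shows "\<exists>r E h. E \<subseteq> E0 \<and> emeasure (\<mu> k) E \<noteq> 0 \<and> frame k D r E h \<and>
    (\<forall>g\<in>D. AE z in \<mu> k. z \<in> E \<longrightarrow> (\<forall>j<k. resid k r (\<lambda>i. pt k (h i) z) (pt k g z) j = 0))"
proof (rule ccontr)
  assume contra: "\<not> ?thesis"
  have "\<exists>E h. E \<subseteq> E0 \<and> emeasure (\<mu> k) E \<noteq> 0 \<and> frame k D r E h" for r
  proof (induction r)
    case 0
    have "frame k D 0 E0 (\<lambda>_. 0)" using E0 by (simp add: frame_def orthonormal_def)
    then show ?case using E0 by blast
  next
    case (Suc r)
    then obtain E h where E: "E \<subseteq> E0" "emeasure (\<mu> k) E \<noteq> 0" "frame k D r E h" by blast
    then obtain g where "g \<in> D" "\<not> (AE z in \<mu> k. z \<in> E \<longrightarrow> (\<forall>j<k. resid k r (\<lambda>i. pt k (h i) z) (pt k g z) j = 0))"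
      using contra by blast
    from frame_extend[OF com E(3) this] show ?case using E(1) by (meson order_trans)
  qed
  from this[of "Suc k"] obtain E h where E: "emeasure (\<mu> k) E \<noteq> 0" "frame k D (Suc k) E h" by blast
  then obtain z where "z \<in> E" by fastforce
  then have "orthonormal k (Suc k) (\<lambda>i. pt k (h i) z)" using E(2) by (simp add: frame_def)
  from orthonormal_card_le[OF this] show False by simp
qed

text \<open>All components of both sequences are gathered in one nonnegative function
  \<open>u n\<close> that tends to 0 in mean, so one subsequence serves them all.\<close>

lemma AE_convergent_subsequence:
  assumes x: "x \<longlonglongrightarrow> x0" and y: "y \<longlonglongrightarrow> y0"
  shows "\<exists>s. strict_mono s \<and> (AE z in \<mu> k. \<forall>j<k.
    (\<lambda>n. pt k (x (s n)) z j) \<longlonglongrightarrow> pt k x0 z j \<and> (\<lambda>n. pt k (y (s n)) z j) \<longlonglongrightarrow> pt k y0 z j)"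
proof -
  define u where "u n z = (\<Sum>j<k. (cmod (pt k (x n) z j - pt k x0 z j))\<^sup>2 + (cmod (pt k (y n) z j - pt k y0 z j))\<^sup>2)" for n z
  have u_meas [measurable]: "u n \<in> borel_measurable borel" for n
    unfolding u_def[abs_def] by (intro borel_measurable_sum) measurable
  have u0: "0 \<le> u n z" for n z by (simp add: u_def sum_nonneg)
  define b where "b n = real k * ((norm (x n - x0))\<^sup>2 + (norm (y n - y0))\<^sup>2)" for n
  have comp: "(\<integral>\<^sup>+z. ennreal ((cmod (pt k v z j - pt k w z j))\<^sup>2) \<partial>\<mu> k) \<le> ennreal ((norm (v - w))\<^sup>2)" if j: "j < k" for v w j
  proof -
    have "(\<integral>\<^sup>+z. ennreal ((cmod (pt k v z j - pt k w z j))\<^sup>2) \<partial>\<mu> k) = (\<integral>\<^sup>+z. ennreal ((cmod (U (v - w) k j z))\<^sup>2) \<partial>\<mu> k)"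
    proof (rule nn_integral_cong_AE)
      show "AE z in \<mu> k. ennreal ((cmod (pt k v z j - pt k w z j))\<^sup>2) = ennreal ((cmod (U (v - w) k j z))\<^sup>2)"
        using ae_eqD[OF U_diff[of v w] less_in_copies[OF j]] by eventually_elim (simp add: pt_def)
    qed
    also have "\<dots> \<le> model_norm2 \<mu> (U (v - w))" by (rule component_norm_le[OF less_in_copies[OF j]])
    finally show ?thesis by (simp add: U_norm)
  qed
  have int: "(\<integral>\<^sup>+z. ennreal (u n z) \<partial>\<mu> k) \<le> ennreal (b n)" for n
  proof -
    have "(\<integral>\<^sup>+z. ennreal (u n z) \<partial>\<mu> k) = (\<integral>\<^sup>+z. (\<Sum>j<k. ennreal ((cmod (pt k (x n) z j - pt k x0 z j))\<^sup>2)
        + ennreal ((cmod (pt k (y n) z j - pt k y0 z j))\<^sup>2)) \<partial>\<mu> k)"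
    proof (rule nn_integral_cong)
      fix z
      show "ennreal (u n z) = (\<Sum>j<k. ennreal ((cmod (pt k (x n) z j - pt k x0 z j))\<^sup>2)
        + ennreal ((cmod (pt k (y n) z j - pt k y0 z j))\<^sup>2))"
        unfolding u_def by (subst sum_ennreal[symmetric]) (auto intro!: sum.cong)
    qed
    also have "\<dots> = (\<Sum>j<k. (\<integral>\<^sup>+z. ennreal ((cmod (pt k (x n) z j - pt k x0 z j))\<^sup>2) \<partial>\<mu> k)
        + (\<integral>\<^sup>+z. ennreal ((cmod (pt k (y n) z j - pt k y0 z j))\<^sup>2) \<partial>\<mu> k))"
      by (subst nn_integral_sum) (auto intro!: sum.cong simp: nn_integral_add)
    also have "\<dots> \<le> (\<Sum>j<k. ennreal ((norm (x n - x0))\<^sup>2) + ennreal ((norm (y n - y0))\<^sup>2))"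
      by (intro sum_mono add_mono comp) auto
    also have "\<dots> = ennreal (b n)"
      by (simp add: b_def ennreal_plus[symmetric] ennreal_of_nat_eq_real_of_nat ennreal_mult[symmetric] del: ennreal_plus)
    finally show ?thesis .
  qed
  have integrable: "integrable (\<mu> k) (u n)" for n
    by (rule integrableI_nonneg) (use u0 le_less_trans[OF int ennreal_less_top] in auto)
  have "(\<lambda>n. \<integral>z. norm (u n z) \<partial>\<mu> k) \<longlonglongrightarrow> 0"
  proof (rule tendsto_sandwich[of "\<lambda>_. 0" _ _ b])
    have "(\<integral>z. norm (u n z) \<partial>\<mu> k) \<le> b n" for n
    proof -
      have "ennreal (\<integral>z. u n z \<partial>\<mu> k) \<le> ennreal (b n)"
        using int[of n] nn_integral_eq_integral[OF integrable[of n]] u0 by simp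
      then show ?thesis using u0 by (simp add: b_def)
    qed
    then show "\<forall>\<^sub>F n in sequentially. (\<integral>z. norm (u n z) \<partial>\<mu> k) \<le> b n" by simp
    have "b \<longlonglongrightarrow> real k * ((norm (x0 - x0))\<^sup>2 + (norm (y0 - y0))\<^sup>2)"
      unfolding b_def by (intro tendsto_intros x y)
    then show "b \<longlonglongrightarrow> 0" by simp
  qed auto
  from tendsto_L1_AE_subseq[OF integrable this]
  obtain s where s: "strict_mono s" "AE z in \<mu> k. (\<lambda>n. u (s n) z) \<longlonglongrightarrow> 0" by blast
  have sub: "f \<longlonglongrightarrow> l" if le: "\<And>n. (cmod (f n - l))\<^sup>2 \<le> v n" and v: "v \<longlonglongrightarrow> 0" for f l v
  proof -
    have "(\<lambda>n. (cmod (f n - l))\<^sup>2) \<longlonglongrightarrow> 0"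
      by (rule tendsto_sandwich[OF _ _ tendsto_const v]) (use le in auto)
    then have "(\<lambda>n. sqrt ((cmod (f n - l))\<^sup>2)) \<longlonglongrightarrow> sqrt 0" by (intro tendsto_intros)
    then have "(\<lambda>n. f n - l) \<longlonglongrightarrow> 0" by (simp add: tendsto_norm_zero_iff)
    then show ?thesis by (rule LIM_zero_cancel)
  qed
  have "AE z in \<mu> k. \<forall>j<k.
    (\<lambda>n. pt k (x (s n)) z j) \<longlonglongrightarrow> pt k x0 z j \<and> (\<lambda>n. pt k (y (s n)) z j) \<longlonglongrightarrow> pt k y0 z j"
    using s(2)
  proof eventually_elim
    case (elim z)
    show ?case
    proof (intro allI impI)
      fix j assume j: "j < k"
      have le: "(cmod (pt k (x n) z j - pt k x0 z j))\<^sup>2 + (cmod (pt k (y n) z j - pt k y0 z j))\<^sup>2 \<le> u n z" for n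
        unfolding u_def
        by (rule member_le_sum[where f="\<lambda>j. (cmod (pt k (x n) z j - pt k x0 z j))\<^sup>2 + (cmod (pt k (y n) z j - pt k y0 z j))\<^sup>2"])
           (use j in auto)
      show "(\<lambda>n. pt k (x (s n)) z j) \<longlonglongrightarrow> pt k x0 z j \<and> (\<lambda>n. pt k (y (s n)) z j) \<longlonglongrightarrow> pt k y0 z j"
      proof (intro conjI; rule sub[OF _ elim])
        fix n
        show "(cmod (pt k (x (s n)) z j - pt k x0 z j))\<^sup>2 \<le> u (s n) z"
          using le[of "s n"] zero_le_power2[of "cmod (pt k (y (s n)) z j - pt k y0 z j)"] by linarith
        show "(cmod (pt k (y (s n)) z j - pt k y0 z j))\<^sup>2 \<le> u (s n) z"
          using le[of "s n"] zero_le_power2[of "cmod (pt k (x (s n)) z j - pt k x0 z j)"] by linarith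
      qed
    qed
  qed
  then show ?thesis using s(1) by blast
qed

text \<open>Pairwise singularity gives a separate set for each \<open>i\<close>; the countable
  intersection still carries \<open>\<mu> k\<close> and is null for every other measure.\<close>

lemma carrier_exists:
  assumes sing: "\<And>i j. i \<noteq> j \<Longrightarrow> mutually_singular (\<mu> i) (\<mu> j)"
  shows "\<exists>S\<in>sets borel. emeasure (\<mu> k) (UNIV - S) = 0 \<and> (\<forall>i. i \<noteq> k \<longrightarrow> emeasure (\<mu> i) S = 0)"
proof -
  have "\<forall>i. \<exists>S. S \<in> sets borel \<and> emeasure (\<mu> k) (UNIV - S) = 0 \<and> (i \<noteq> k \<longrightarrow> emeasure (\<mu> i) S = 0)"
  proof
    fix i
    show "\<exists>S. S \<in> sets borel \<and> emeasure (\<mu> k) (UNIV - S) = 0 \<and> (i \<noteq> k \<longrightarrow> emeasure (\<mu> i) S = 0)"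
    proof (cases "i = k")
      case True
      then show ?thesis by (intro exI[of _ UNIV]) auto
    qed (use sing[of i k] in \<open>auto simp: mutually_singular_def\<close>)
  qed
  from choice[OF this] obtain S where S [measurable]: "\<And>i. S i \<in> sets borel"
    and S1: "\<And>i. emeasure (\<mu> k) (UNIV - S i) = 0" and S2: "\<And>i. i \<noteq> k \<Longrightarrow> emeasure (\<mu> i) (S i) = 0" by blast
  show ?thesis
  proof (intro bexI[of _ "\<Inter>i. S i"] conjI allI impI)
    have "UNIV - (\<Inter>i. S i) = (\<Union>i. UNIV - S i)" by auto
    moreover have "(\<Union>i. UNIV - S i) \<in> null_sets (\<mu> k)"
      by (rule null_sets_UN) (auto simp: null_sets_def S1)
    ultimately show "emeasure (\<mu> k) (UNIV - (\<Inter>i. S i)) = 0" by auto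
    fix i assume "i \<noteq> k"
    have "emeasure (\<mu> i) (\<Inter>i. S i) \<le> emeasure (\<mu> i) (S i)" by (rule emeasure_mono) auto
    then show "emeasure (\<mu> i) (\<Inter>i. S i) = 0" using S2[OF \<open>i \<noteq> k\<close>] by simp
  qed simp
qed

text \<open>On the part of a frame, \<open>X\<close> acts as multiplication by the matrix-valued function sending the
  frame to its image under \<open>X\<close>.\<close>

lemma commutes_frame_expansion:
  assumes com: "commutes_with X D (vN_generated N)" and fr: "frame k D r E h" and k: "k > 0"
    and E: "\<And>i. i \<noteq> k \<Longrightarrow> emeasure (\<mu> i) E = 0" and g: "g \<in> D"
    and span: "AE z in \<mu> k. z \<in> E \<longrightarrow> (\<forall>j<k. resid k r (\<lambda>i. pt k (h i) z) (pt k g z) j = 0)"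
  shows "AE z in \<mu> k. z \<in> E \<longrightarrow> (\<forall>j<k.
    pt k (X g) z j = (\<Sum>i<r. dot k (pt k g z) (pt k (h i) z) * pt k (X (h i)) z j))"
proof -
  have Eb [measurable]: "E \<in> sets borel" using fr by (simp add: frame_def)
  define c where "c i z = dot k (pt k g z) (pt k (h i) z)" for i z
  have c_meas [measurable]: "c i \<in> borel_measurable borel" for i unfolding c_def[abs_def] by measurable
  \<comment> \<open>The expansion coefficients may be unbounded on \<open>E\<close>; cut down to
    \<open>B n\<close> they are admissible multipliers, and the sets \<open>B n\<close> exhaust
    \<open>E\<close>.\<close>
  define B where "B n = {z\<in>E. \<forall>i<r. cmod (c i z) \<le> real n}" for n
  have B_meas [measurable]: "B n \<in> sets borel" for n unfolding B_def by measurable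
  have step: "AE z in \<mu> k. z \<in> B n \<longrightarrow> (\<forall>j<k. pt k (X g) z j = (\<Sum>i<r. c i z * pt k (X (h i)) z j))" for n
  proof -
    define \<phi> where "\<phi> i z = indicator (B n) z * c i z" for i z
    have \<phi>_meas: "\<phi> i \<in> borel_measurable borel" for i unfolding \<phi>_def[abs_def] by measurable
    have \<phi>_bound: "cmod (\<phi> i z) \<le> real n" if "i < r" for i z
      using that by (auto simp: \<phi>_def B_def indicator_def)
    have hD: "h i \<in> D" if "i < r" for i using fr that by (simp add: frame_def)
    have "\<exists>y\<in>D. ae_eq_model \<mu> (U y) (\<lambda>k j z. \<Sum>i<r. \<phi> i z * U (h i) k j z) \<and>
      ae_eq_model \<mu> (U (X y)) (\<lambda>k j z. \<Sum>i<r. \<phi> i z * U (X (h i)) k j z)"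
      by (rule commutes_combination[OF com hD \<phi>_meas \<phi>_bound])
    then obtain y where y: "y \<in> D" "ae_eq_model \<mu> (U y) (\<lambda>k j z. \<Sum>i<r. \<phi> i z * U (h i) k j z)"
      "ae_eq_model \<mu> (U (X y)) (\<lambda>k j z. \<Sum>i<r. \<phi> i z * U (X (h i)) k j z)"
      by (elim bexE conjE) (rule that)
    have ind: "(indicator (B n) :: complex \<Rightarrow> complex) \<in> borel_measurable borel"
      "\<And>z. cmod (indicator (B n) z) \<le> 1" by (auto simp: indicator_def)
    \<comment> \<open>\<open>w\<close> is \<open>g\<close> cut down to \<open>B n\<close>, and
      \<open>y\<close> is its expansion in the frame. They agree in part \<open>k\<close> because
      the frame spans, and in the other parts because \<open>E\<close> is null there. Hence
      \<open>X w = X y\<close>, and the two formulas for this vector are compared.\<close>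
    obtain w where w: "w \<in> D" "ae_eq_model \<mu> (U w) (\<lambda>k j z. indicator (B n) z * U g k j z)"
      "ae_eq_model \<mu> (U (X w)) (\<lambda>k j z. indicator (B n) z * U (X g) k j z)"
      using commutes_mult[OF com g ind] by (elim bexE conjE) (rule that)
    have "ae_eq_model \<mu> (\<lambda>k j z. indicator (B n) z * U g k j z) (\<lambda>k j z. \<Sum>i<r. \<phi> i z * U (h i) k j z)"
    proof (rule ae_eqI)
      fix l j assume j: "j \<in> copies l"
      show "AE z in \<mu> l. indicator (B n) z * U g l j z = (\<Sum>i<r. \<phi> i z * U (h i) l j z)"
      proof (cases "l = k")
        case False
        have "AE z in \<mu> l. z \<notin> E" using E[OF False] by (intro AE_not_in) (auto simp: null_sets_def)
        then show ?thesis by eventually_elim (simp add: \<phi>_def B_def indicator_def)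
      next
        case True
        have jk: "j < k" using j True k by (simp add: copies_def)
        show ?thesis unfolding True using span
        proof eventually_elim
          case (elim z)
          show ?case
          proof (cases "z \<in> B n")
            case True
            then have "resid k r (\<lambda>i. pt k (h i) z) (pt k g z) j = 0" using elim jk by (simp add: B_def)
            then show ?thesis using True by (simp add: resid_def \<phi>_def c_def pt_def[abs_def])
          qed (simp add: \<phi>_def)
        qed
      qed
    qed
    then have "w = y" using U_inj[OF ae_eq_trans[OF w(2)] y(2)] by blast
    then have 1: "AE z in \<mu> k. \<forall>j<k. pt k (X w) z j = (\<Sum>i<r. \<phi> i z * U (X (h i)) k j z)"
      using ae_eq_pt[OF y(3), of k] by simp
    show ?thesis using 1 ae_eq_pt[OF w(3), of k]
    proof eventually_elim
      case (elim z)
      show ?case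
      proof
        assume "z \<in> B n"
        then show "\<forall>j<k. pt k (X g) z j = (\<Sum>i<r. c i z * pt k (X (h i)) z j)"
          using elim by (simp add: \<phi>_def pt_def)
      qed
    qed
  qed
  have "AE z in \<mu> k. \<forall>n. z \<in> B n \<longrightarrow> (\<forall>j<k. pt k (X g) z j = (\<Sum>i<r. c i z * pt k (X (h i)) z j))"
    by (intro AE_all_countable[THEN iffD2] allI step)
  then show ?thesis
  proof eventually_elim
    case (elim z)
    show ?case
    proof
      assume z: "z \<in> E"
      obtain n where n: "(\<Sum>i<r. cmod (c i z)) \<le> real n" using real_arch_simple by blast
      have "cmod (c i z) \<le> real n" if "i < r" for i
        using member_le_sum[of i "{..<r}" "\<lambda>i. cmod (c i z)"] that n by simp
      then have "z \<in> B n" using z by (simp add: B_def)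
      then show "\<forall>j<k. pt k (X g) z j = (\<Sum>i<r. dot k (pt k g z) (pt k (h i) z) * pt k (X (h i)) z j)"
        using elim unfolding c_def by blast
    qed
  qed
qed

text \<open>By linearity it is enough that \<open>c n\<close> tending to 0 and
  \<open>X (c n)\<close> tending to \<open>y\<close> force \<open>y = 0\<close>. If a component of
  \<open>y\<close> were nonzero on a non-null set, a maximal frame there would express
  \<open>X (c n)\<close> through finitely many coefficients of \<open>c n\<close>, which tend to 0
  almost everywhere along a subsequence.\<close>

theorem closability_of_finite_multiplicity:
  assumes sing: "\<And>i j. i \<noteq> j \<Longrightarrow> mutually_singular (\<mu> i) (\<mu> j)" and null: "emeasure (\<mu> 0) UNIV = 0"
  shows "closability_property (vN_generated N)"
  unfolding closability_property_def
proof (intro allI impI)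
  fix X :: "'a \<Rightarrow> 'a" and D assume com: "commutes_with X D (vN_generated N)"
  have D_diff: "a - b \<in> D \<and> X (a - b) = X a - X b" if ab: "a \<in> D" "b \<in> D" for a b
  proof -
    note nb = commutes_withD(3,4)[OF com ab(2), of "-1"]
    show ?thesis using commutes_withD(1,2)[OF com ab(1) nb(1)] nb by (simp add: scaleC_minus1)
  qed
  have key: "y = 0" if c: "\<And>n. c n \<in> D" "c \<longlonglongrightarrow> 0" "(\<lambda>n. X (c n)) \<longlonglongrightarrow> y" for c y
  proof (rule U_inj[OF _ U_zero], rule ae_eqI)
    fix k j assume j: "j \<in> copies k"
    show "AE z in \<mu> k. U y k j z = 0"
    proof (cases "k = 0")
      case True
      have "AE z in \<mu> 0. False" using null by (intro AE_I[of _ _ UNIV]) auto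
      then show ?thesis unfolding True by eventually_elim simp
    next
      case False
      then have k: "k > 0" by simp
      have jk: "j < k" using j k by (simp add: copies_def)
      obtain S where S [measurable]: "S \<in> sets borel" and S1: "emeasure (\<mu> k) (UNIV - S) = 0"
        and S2: "\<And>i. i \<noteq> k \<Longrightarrow> emeasure (\<mu> i) S = 0" using carrier_exists[OF sing] by blast
      have [measurable]: "U y k j \<in> borel_measurable borel" by (rule U_meas[OF j])
      \<comment> \<open>Points are taken from the carrier of \<open>\<mu> k\<close> so that every
        Borel subset is null for the other measures, as \<open>commutes_frame_expansion\<close>
        demands.\<close>
      define E0 where "E0 = {z\<in>S. U y k j z \<noteq> 0}"
      have E0 [measurable]: "E0 \<in> sets borel" unfolding E0_def by measurable
      have "emeasure (\<mu> k) E0 = 0"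
      proof (rule ccontr)
        assume "emeasure (\<mu> k) E0 \<noteq> 0"
        from maximal_frame_exists[OF com E0 this] obtain r E h where E: "E \<subseteq> E0" "emeasure (\<mu> k) E \<noteq> 0"
          and fr: "frame k D r E h" and span: "\<And>g. g \<in> D \<Longrightarrow> AE z in \<mu> k. z \<in> E \<longrightarrow>
            (\<forall>j<k. resid k r (\<lambda>i. pt k (h i) z) (pt k g z) j = 0)" by blast
        have Eb: "E \<in> sets borel" using fr by (simp add: frame_def)
        have Enull: "emeasure (\<mu> i) E = 0" if "i \<noteq> k" for i
        proof -
          have "emeasure (\<mu> i) E \<le> emeasure (\<mu> i) S"
            by (rule emeasure_mono) (use E(1) in \<open>auto simp: E0_def\<close>)
          then show ?thesis using S2[OF that] by simp
        qed
        obtain s where s: "AE z in \<mu> k. \<forall>j<k. (\<lambda>n. pt k (c (s n)) z j) \<longlonglongrightarrow> pt k 0 z j \<and>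
            (\<lambda>n. pt k (X (c (s n))) z j) \<longlonglongrightarrow> pt k y z j"
          using AE_convergent_subsequence[OF c(2,3)] by blast
        have "AE z in \<mu> k. \<forall>n. z \<in> E \<longrightarrow> (\<forall>j<k. pt k (X (c n)) z j
            = (\<Sum>i<r. dot k (pt k (c n) z) (pt k (h i) z) * pt k (X (h i)) z j))"
          by (intro AE_all_countable[THEN iffD2] allI commutes_frame_expansion[OF com fr k Enull c(1) span] c(1))
        moreover have "AE z in \<mu> k. \<forall>j<k. pt k 0 z j = 0" using ae_eq_pt[OF U_zero] by simp
        ultimately have "AE z in \<mu> k. z \<notin> E" using s
        proof eventually_elim
          case (elim z)
          show ?case
          proof
            assume z: "z \<in> E"
            have c0: "(\<lambda>n. pt k (c (s n)) z m) \<longlonglongrightarrow> 0" if "m < k" for m using elim that by force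
            have "(\<lambda>n. dot k (pt k (c (s n)) z) (pt k (h i) z)) \<longlonglongrightarrow> (\<Sum>m<k. 0 * cnj (pt k (h i) z m))" for i
              unfolding dot_def by (intro tendsto_intros c0) auto
            then have d0: "(\<lambda>n. dot k (pt k (c (s n)) z) (pt k (h i) z)) \<longlonglongrightarrow> 0" for i by simp
            have "(\<lambda>n. \<Sum>i<r. dot k (pt k (c (s n)) z) (pt k (h i) z) * pt k (X (h i)) z j)
              \<longlonglongrightarrow> (\<Sum>i<r. 0 * pt k (X (h i)) z j)" by (intro tendsto_intros d0)
            moreover have "(\<lambda>n. \<Sum>i<r. dot k (pt k (c (s n)) z) (pt k (h i) z) * pt k (X (h i)) z j)
              = (\<lambda>n. pt k (X (c (s n))) z j)" using elim(1) z jk by auto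
            ultimately have "(\<lambda>n. pt k (X (c (s n))) z j) \<longlonglongrightarrow> 0" by simp
            moreover have "(\<lambda>n. pt k (X (c (s n))) z j) \<longlonglongrightarrow> pt k y z j" using elim(3) jk by blast
            ultimately have "pt k y z j = 0" using LIMSEQ_unique by blast
            then show False using z E(1) by (auto simp: E0_def pt_def)
          qed
        qed
        then have "emeasure (\<mu> k) {z \<in> space (\<mu> k). z \<in> E} = 0" by (rule emeasure_eq_0_AE)
        then show False using E(2) by simp
      qed
      then have "AE z in \<mu> k. z \<notin> E0" by (intro AE_not_in) (auto simp: null_sets_def)
      moreover have "AE z in \<mu> k. z \<notin> UNIV - S" using S1 by (intro AE_not_in) (auto simp: null_sets_def)
      ultimately show ?thesis by eventually_elim (auto simp: E0_def)
    qed
  qed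
  show "closable X D"
    unfolding closable_def
  proof (intro allI impI, elim conjE)
    fix x y1 y2 assume "(x, y1) \<in> closure (graph X D)" "(x, y2) \<in> closure (graph X D)"
    then obtain a b where a: "\<And>n. a n \<in> graph X D" "a \<longlonglongrightarrow> (x, y1)" and b: "\<And>n. b n \<in> graph X D" "b \<longlonglongrightarrow> (x, y2)"
      unfolding closure_sequential by blast
    have aD: "fst (a n) \<in> D" "snd (a n) = X (fst (a n))" for n using a(1)[of n] by (auto simp: graph_def)
    have bD: "fst (b n) \<in> D" "snd (b n) = X (fst (b n))" for n using b(1)[of n] by (auto simp: graph_def)
    have "y1 - y2 = 0"
    proof (rule key)
      show "fst (a n) - fst (b n) \<in> D" for n using D_diff aD bD by blast
      have "(\<lambda>n. fst (a n) - fst (b n)) \<longlonglongrightarrow> fst (x, y1) - fst (x, y2)"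
        by (intro tendsto_diff tendsto_fst a b)
      then show "(\<lambda>n. fst (a n) - fst (b n)) \<longlonglongrightarrow> 0" by simp
      have "(\<lambda>n. snd (a n) - snd (b n)) \<longlonglongrightarrow> snd (x, y1) - snd (x, y2)"
        by (intro tendsto_diff tendsto_snd a b)
      then show "(\<lambda>n. X (fst (a n) - fst (b n))) \<longlonglongrightarrow> y1 - y2" using D_diff aD bD by simp
    qed
    then show "y1 = y2" by simp
  qed
qed

end

theorem theorem3p8:
  fixes N :: "'a::chilbert_space \<Rightarrow> 'a"
  assumes "separable_hspace TYPE('a)"
    and "normal_op N"
  shows "closability_property (vN_generated N) \<longleftrightarrow> uniform_finite_multiplicity N"
proof
  assume cp: "closability_property (vN_generated N)"
  \<comment> \<open>\<open>uniform_finite_multiplicity\<close> asserts that some decomposition has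
    no infinite part, so a decomposition has to be constructed before the closability property can
    show that its infinite part vanishes.\<close>
  obtain \<mu> where \<mu>: "multiplicity_decomposition N \<mu>" using multiplicity_decomposition_exists[OF assms] by blast
  then obtain U where "unitary_to_model N \<mu> U" by (auto simp: multiplicity_decomposition_def)
  then interpret spectral_model N \<mu> U
    using \<mu> normal_op_bounded[OF assms(2)] by unfold_locales (auto simp: multiplicity_decomposition_def)
  have "emeasure (\<mu> 0) UNIV = 0" using not_closable_of_infinite_multiplicity cp by blast
  then show "uniform_finite_multiplicity N" using \<mu> by (auto simp: uniform_finite_multiplicity_def)
next
  assume "uniform_finite_multiplicity N"
  then obtain \<mu> where \<mu>: "multiplicity_decomposition N \<mu>" and null: "emeasure (\<mu> 0) UNIV = 0"
    by (auto simp: uniform_finite_multiplicity_def)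
  then obtain U where "unitary_to_model N \<mu> U" by (auto simp: multiplicity_decomposition_def)
  then interpret spectral_model N \<mu> U
    using \<mu> normal_op_bounded[OF assms(2)] by unfold_locales (auto simp: multiplicity_decomposition_def)
  show "closability_property (vN_generated N)"
    by (rule closability_of_finite_multiplicity[OF _ null]) (use \<mu> in \<open>auto simp: multiplicity_decomposition_def\<close>)
qed

end
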